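(* Let $R>0$ and $a\ge a_0$. Let $\delta>0$ be the noise level. Suppose that $W^{h*}\in H_N^{1,h}(\Omega^h)$ satisfies $$D_N^hW_y^{h*}+\sum_{i=1}^nA_i^hW_{x_i}^{h*}+F^h(W^{h*}(\mathbf{x}^h),\mathbf{x}^h)=0\ \text{ in }\Omega^h,\qquad W^{h*}|_{\partial\Omega^h}=P^{h*},$$ and that there exist $S^h,S^{h*}\in H_N^{1,h}(\Omega^h)$ with $$S^h|_{\partial\Omega^h}=P^h,\quad\|S^h\|_{H_N^{1,h}(\Omega^h)}<R,\quad S^{h*}|_{\partial\Omega^h}=P^{h*},\quad\|S^{h*}\|_{H_N^{1,h}(\Omega^h)}<R,\quad\|S^h-S^{h*}\|_{H_N^{1,h}(\Omega^h)}<\delta.$$ Let $\lambda_2=\lambda_1(2R,A,d,N,a,b,h_0)$ and let $W^h_{\min,\lambda_2}$ be the minimizer on $\overline{B(R,P^h)}$ of the functional $$J_{\lambda_2}(W^h)=\left\|\Big(D_N^hW_y^h+\sum_{i=1}^nA_i^hW_{x_i}^h+F^h(W^h(\mathbf{x}^h),\mathbf{x}^h)\Big)e^{\lambda_2 y}\right\|^2_{L_N^{2,h}(\Omega^h)}.$$ Let $\alpha_0\in(0,R)$ and suppose that $$W^{h*}\in B\big((R-\alpha_0)/3,P^{h*}\big)\quad\text{and}\quad C_3\delta<\alpha_0/3 .$$ Let $W_0^h\in B(R/3,P^h)$ be an arbitrary point and consider the gradient descent sequence $$W_k^h=W_{k-1}^h-\gamma J_{\lambda_2}'(W_{k-1}^h),\quad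 k=1,2,\dots,\qquad \gamma>0.$$ Then there exist a sufficiently small number $\gamma>0$ and a number $\theta=\theta(\gamma)\in(0,1)$ such that all functions $W_k^h\in B(R,P^h)$ and the following convergence estimates hold: $$\|W_k^h-W^h_{\min,\lambda_2}\|_{H_N^{1,h}(\Omega^h)}\le\theta^k\|W_0^h-W^h_{\min,\lambda_2}\|_{H_N^{1,h}(\Omega^h)},$$ $$\|W_k^h-W^{h*}\|_{H_N^{1,h}(\Omega^h)}\le C_3\delta+\theta^k\|W_0^h-W^h_{\min,\lambda_2}\|_{H_N^{1,h}(\Omega^h)},$$ $$\|a_k^h-a^{h*}\|_{L^{2,h}(\Omega^h)}\le C_3\delta+\theta^k\|W_0^h-W^h_{\min,\lambda_2}\|_{H_N^{1,h}(\Omega^h)},$$ where $a_k^h$ and $a^{h*}$ are the functions obtained from $W_k^h$ and $W^{h*}$, respectively, by the coefficient reconstruction formula given in the context.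
   Context: Geometry and data. $n\ge1$, $N\ge1$, $m>1$ are integers; $A,d>0$, $1<a<b$ are numbers; points of $\mathbb{R}^{n+1}$ are $\mathbf{x}=(x_1,\dots,x_n,y)$; $\Omega=\{-A<x_1,\dots,x_n<A,\ a<y<b\}$. For $\alpha\in[-d,d]$, $\mathbf{x}_\alpha=(\alpha,0,\dots,0)$ and $\nu(\mathbf{x},\alpha)=\frac{\mathbf{x}-\mathbf{x}_\alpha}{|\mathbf{x}-\mathbf{x}_\alpha|}=(\nu_1,\dots,\nu_{n+1})$. $K\ge0$, $K\in C^2(\overline\Omega\times[-d,d]^2)$; $\mu_s\in C^2(\mathbb{R}^{n+1})$, $\mu_s\ge0$, $\mu_s=0$ outside $\Omega$. The dimension $n$, the functions $K,\mu_s$ and the arbitrary number $R>0$ are given and fixed. Matrices and nonlinearity. $\{\Psi_r\}_{r\ge0}$ is the orthonormal basis of $L_2(-d,d)$ obtained by Gram–Schmidt from $\{\alpha^r e^\alpha\}_{r\ge0}$. For $k,r=0,\dots,N-1$ (row $k$, column $r$): $(M_N)_{kr}=\int_{-d}^d\Psi_r'\Psi_k\,d\alpha$, $(A_{n+1}(\mathbf{x}))_{kr}=\int_{-d}^d\frac{\partial_\alpha\nu_{n+1}}{\nu_{n+1}}\Psi_r\Psi_k\,d\alpha$, $(A_i(\mathbf{x}))_{kr}=\int_{-d}^d\left[\frac{\nu_i}{\nu_{n+1}}\Psi_r'+\frac{\partial_\alpha\nu_i}{\nu_{n+1}}\Psi_r\right]\Psi_k\,d\alpha$ ($i=1,\dots,n$),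 $D_N=M_N+A_{n+1}$. For $W=(w_0,\dots,w_{N-1})^T\in\mathbb{R}^N$, $F(W,\mathbf{x})\in\mathbb{R}^N$ has components $$F_k(W,\mathbf{x})=-\int_{-d}^d\frac{\mu_s(\mathbf{x})}{\nu_{n+1}(\mathbf{x},\alpha)}\,\frac{\partial}{\partial\alpha}\left[e^{-\sum_rw_r\Psi_r(\alpha)}\int_{-d}^dK(\mathbf{x},\alpha,\beta)e^{\sum_rw_r\Psi_r(\beta)}d\beta\right]\Psi_k(\alpha)\,d\alpha .$$ The number $a_0=a_0(A,d,N)>1$ is such that for all $a\ge a_0$ the matrix $D_N(\mathbf{x})$ is invertible for every $\mathbf{x}\in\overline\Omega$, with $D_N^{-1}$ bounded on $\overline\Omega$ by a constant $C_3$. $D_N^h,A_i^h,F^h$ are the restrictions of $D_N,A_i,F$ to $\mathbf{x}=\mathbf{x}^h\in\Omega^h$ (below). Semi-discrete spaces. For $i=1,\dots,n$ let $-A=x_{i,0}<x_{i,1}<\dots<x_{i,m}=A$ be the uniform partition with step $h\ge h_0$, $h_0>0$ fixed. For $J=(j_1,\dots,j_n)\in\{0,\dots,m\}^n$ put $X_J=(x_{1,j_1},\dots,x_{n,j_n})$; $J$ is interior if $1\le j_i\le m-1$ for all $i$. $\Omega^h=\{(X_J,y):y\in(a,b)\}$, with points denoted $\mathbf{x}^h$. The boundary $\partial\Omega^h$ consists of the points $(X_J,a)$, $(X_J,b)$ and of the points $(X_J,y)$ with $J$ not interior. A semi-discrete vector function $Q^h$ is a family of functions $Q_J^h(y)=Q^h(X_J,y)\in\mathbb{R}^N$.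 At interior $J$, $Q^h_{x_k}=\frac{Q^h_{J+e_k}(y)-Q^h_{J-e_k}(y)}{2h}$, and $Q_y^h$ is the usual $y$-derivative; differential expressions are considered only at interior $J$. Norms: $\|Q^h\|^2_{L_N^{2,h}(\Omega^h)}=\sum_{J\text{ interior}}\int_a^b|Q_J^h|^2dy$ ($L^{2,h}$ is the scalar version), $\|Q^h\|^2_{H_N^{1,h}(\Omega^h)}=\sum_{J\text{ interior}}\sum_{k=1}^n\int_a^b[|Q_J^h|^2+|Q_{x_k}^h(X_J,y)|^2+|\partial_yQ_J^h|^2]dy$; the (Hilbert) spaces consist of the $Q^h$ with finite norms, and $H_{N,0}^{1,h}(\Omega^h)=\{Q^h\in H_N^{1,h}(\Omega^h):Q^h|_{\partial\Omega^h}=0\}$. $P^h$ (noisy data) and $P^{h*}$ (exact data) are $N$-dimensional boundary vector functions on $\partial\Omega^h$. For $\rho>0$ and a boundary function $P$, $B(\rho,P)=\{W^h\in H_N^{1,h}(\Omega^h):W^h|_{\partial\Omega^h}=P,\ \|W^h\|_{H_N^{1,h}(\Omega^h)}<\rho\}$. Coefficient reconstruction formula. From $W^h=(w_0^h,\dots,w_{N-1}^h)^T$ one forms $w^h(\mathbf{x}^h,\alpha)=\sum_{r=0}^{N-1}w_r^h(\mathbf{x}^h)\Psi_r(\alpha)$ and $$a^h(\mathbf{x}^h)=-\frac1{2d}\int_{-d}^d\nu(\mathbf{x}^h,\alpha)\cdot\nabla_{\mathbf{x}^h}w^h(\mathbf{x}^h,\alpha)\,d\alpha+\frac1{2d}\int_{-d}^d\left(e^{-w^h(\mathbf{x}^h,\alpha)}\mu_s(\mathbf{x}^h)\int_{-d}^dK(\mathbf{x}^h,\alpha,\beta)e^{w^h(\mathbf{x}^h,\beta)}d\beta\right)d\alpha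 ,$$ where $\nabla_{\mathbf{x}^h}$ consists of the finite differences in $x_1,\dots,x_n$ above and of $\partial_y$. Constants. $C_3$ denotes positive constants, possibly different at different places, depending only on $A,d,N,a,b,h_0,\|K\|_{C^1(\overline\Omega\times[-d,d]^2)}$. For $\rho>0$, $\lambda_1(\rho,A,d,N,a,b,h_0)\ge1$ denotes a sufficiently large number, depending only on the listed parameters, such that for $a\ge a_0$, all $\lambda\ge\lambda_1$ and all $W_1^h,W_2^h\in\overline{B(\rho,P)}$ (for any boundary function $P$), $$J_\lambda(W_2^h)-J_\lambda(W_1^h)-J_\lambda'(W_1^h)(W_2^h-W_1^h)\ge C_3e^{2\lambda a}\|W_2^h-W_1^h\|^2_{H_N^{1,h}(\Omega^h)},$$ where $J_\lambda$ is the functional of the claim with $\lambda$ in place of $\lambda_2$ and $J_\lambda'(W^h)\in H_{N,0}^{1,h}(\Omega^h)$ is its Fréchet derivative with respect to increments in $H_{N,0}^{1,h}(\Omega^h)$ (identified via Riesz, $J_\lambda'(W^h)(v)$ being the scalar product). For $\lambda\ge\lambda_1(\rho,\dots)$ the functional $J_\lambda$ has a unique minimizer on $\overline{B(\rho,P)}$ when this set is nonempty.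
   Formalization: The third estimate is false as printed for early k (e.g. K=0, N=1, d small); it is proved as ‖a_k−a*‖ ≤ C_3δ + C_3θ^k‖W_0−W_min‖ for all k, and with the printed coefficient 1 for all k ≥ some k_0. *)

theory Defs
  imports "HOL-Analysis.Analysis"
begin

text \<open>
  Conventions.  A point of $n+1$ dimensional space is a pair \<open>(x, y)\<close> of type
  \<open>(real^'n) \<times> real\<close>, with the Euclidean norm and inner product of the product type.
  The index types \<open>'n\<close> (space coordinates) and \<open>'N\<close> (components) are
  finite and linearly ordered; the order of \<open>'n\<close> only serves to single out the first
  coordinate, the order of \<open>'N\<close> numbers the components by $0, \dots, N-1$.
\<close>

type_synonym 'n point = "(real^'n) \<times> real"

text \<open>
  A semi-discrete vector function: \<open>Q J y\<close> is the value at $(X_J, y)$.  Only the values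
  at multi-indices with entries in $\{0, \dots, m\}$ and at $y \in [a,b]$ are ever used.  The
  same type is used for boundary functions, which are only evaluated at boundary points.
\<close>

type_synonym ('n, 'N) sdfun = "nat^'n \<Rightarrow> real \<Rightarrow> real^'N"


section \<open>Geometry and smoothness\<close>

definition Omega :: "real \<Rightarrow> real \<Rightarrow> real \<Rightarrow> 'n::finite point set" where
  "Omega A a b = {x. (\<forall>i. - A < fst x $ i \<and> fst x $ i < A) \<and> a < snd x \<and> snd x < b}"

definition K_domain :: "real \<Rightarrow> real \<Rightarrow> real \<Rightarrow> real \<Rightarrow> ('n::finite point \<times> real \<times> real) set" where
  "K_domain A d a b = closure (Omega A a b) \<times> {-d..d} \<times> {-d..d}"

text \<open>
  Used for the whole space and for closed boxes with nonempty interior, where the derivatives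
  within the set are unique and are the continuous extensions of the interior ones.
\<close>

definition C2_on :: "'e::euclidean_space set \<Rightarrow> ('e \<Rightarrow> real) \<Rightarrow> bool" where
  "C2_on S f \<longleftrightarrow>
     (\<exists>(f' :: 'e \<Rightarrow> 'e \<Rightarrow>\<^sub>L real) (f'' :: 'e \<Rightarrow> 'e \<Rightarrow>\<^sub>L ('e \<Rightarrow>\<^sub>L real)).
        (\<forall>z\<in>S. (f has_derivative blinfun_apply (f' z)) (at z within S)) \<and>
        (\<forall>z\<in>S. (f' has_derivative blinfun_apply (f'' z)) (at z within S)) \<and>
        continuous_on S f'')"

definition C1_norm :: "'e::euclidean_space set \<Rightarrow> ('e \<Rightarrow> real) \<Rightarrow> real" where
  "C1_norm S f =
     (SUP z\<in>S. \<bar>f z\<bar>) + (\<Sum>e\<in>Basis. SUP z\<in>S. \<bar>frechet_derivative f (at z within S) e\<bar>)"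

definition source :: "real \<Rightarrow> 'n::{finite,linorder} point" where
  "source \<alpha> = (axis (Min UNIV) \<alpha>, 0)"

definition nu :: "'n::{finite,linorder} point \<Rightarrow> real \<Rightarrow> 'n point" where
  "nu x \<alpha> = (x - source \<alpha>) /\<^sub>R norm (x - source \<alpha>)"


section \<open>The basis, the matrices and the nonlinearity\<close>

text \<open>Gram--Schmidt orthonormalization of $\alpha^r e^\alpha$ in $L_2(-d,d)$.\<close>

fun Psi :: "real \<Rightarrow> nat \<Rightarrow> real \<Rightarrow> real" where
  "Psi d r =
     (let v = (\<lambda>\<alpha>. \<alpha> ^ r * exp \<alpha>
                 - (\<Sum>s<r. integral {-d..d} (\<lambda>t. t ^ r * exp t * Psi d s t) * Psi d s \<alpha>))
      in (\<lambda>\<alpha>. v \<alpha> / sqrt (integral {-d..d} (\<lambda>t. (v t)\<^sup>2))))"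

declare Psi.simps [simp del]

definition idx :: "'N::{finite,linorder} \<Rightarrow> nat" where
  "idx r = card {s. s < r}"

definition M_mat :: "real \<Rightarrow> real^'N::{finite,linorder}^'N::{finite,linorder}" where
  "M_mat d = (\<chi> k r. integral {-d..d} (\<lambda>\<alpha>. deriv (Psi d (idx r)) \<alpha> * Psi d (idx k) \<alpha>))"

definition Ay_mat :: "real \<Rightarrow> 'n::{finite,linorder} point \<Rightarrow> real^'N::{finite,linorder}^'N::{finite,linorder}" where
  "Ay_mat d x = (\<chi> k r. integral {-d..d} (\<lambda>\<alpha>.
     deriv (\<lambda>t. snd (nu x t)) \<alpha> / snd (nu x \<alpha>) * Psi d (idx r) \<alpha> * Psi d (idx k) \<alpha>))"

definition Ax_mat ::
  "real \<Rightarrow> 'n::{finite,linorder} \<Rightarrow> 'n point \<Rightarrow> real^'N::{finite,linorder}^'N::{finite,linorder}" where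
  "Ax_mat d i x = (\<chi> k r. integral {-d..d} (\<lambda>\<alpha>.
     (fst (nu x \<alpha>) $ i / snd (nu x \<alpha>) * deriv (Psi d (idx r)) \<alpha>
      + deriv (\<lambda>t. fst (nu x t) $ i) \<alpha> / snd (nu x \<alpha>) * Psi d (idx r) \<alpha>)
     * Psi d (idx k) \<alpha>))"

definition D_mat :: "real \<Rightarrow> 'n::{finite,linorder} point \<Rightarrow> real^'N::{finite,linorder}^'N::{finite,linorder}" where
  "D_mat d x = M_mat d + Ay_mat d x"

definition expand :: "real \<Rightarrow> real^'N::{finite,linorder} \<Rightarrow> real \<Rightarrow> real" where
  "expand d W \<alpha> = (\<Sum>r\<in>UNIV. W $ r * Psi d (idx r) \<alpha>)"

definition F_fun ::
  "real \<Rightarrow> ('n::{finite,linorder} point \<times> real \<times> real \<Rightarrow> real) \<Rightarrow> ('n point \<Rightarrow> real)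
   \<Rightarrow> real^'N::{finite,linorder} \<Rightarrow> 'n point \<Rightarrow> real^'N::{finite,linorder}" where
  "F_fun d K \<mu> W x = (\<chi> k. - integral {-d..d} (\<lambda>\<alpha>.
     \<mu> x / snd (nu x \<alpha>)
     * deriv (\<lambda>t. exp (- expand d W t)
                  * integral {-d..d} (\<lambda>\<beta>. K (x, t, \<beta>) * exp (expand d W \<beta>))) \<alpha>
     * Psi d (idx k) \<alpha>))"


section \<open>Semi-discrete spaces\<close>

definition step :: "real \<Rightarrow> nat \<Rightarrow> real" where
  "step A m = 2 * A / real m"

definition grid_pt :: "real \<Rightarrow> nat \<Rightarrow> nat^'n \<Rightarrow> real \<Rightarrow> 'n::finite point" where
  "grid_pt A m J y = ((\<chi> i. - A + real (J $ i) * step A m), y)"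

definition grid :: "nat \<Rightarrow> (nat^'n::finite) set" where
  "grid m = {J. \<forall>i. J $ i \<le> m}"

definition inner_grid :: "nat \<Rightarrow> (nat^'n::finite) set" where
  "inner_grid m = {J. \<forall>i. 1 \<le> J $ i \<and> J $ i \<le> m - 1}"

definition dx ::
  "real \<Rightarrow> nat \<Rightarrow> 'n::finite \<Rightarrow> ('n, 'N::finite) sdfun \<Rightarrow> ('n, 'N) sdfun" where
  "dx A m k Q J y = (Q (J + axis k 1) y - Q (J - axis k 1) y) /\<^sub>R (2 * step A m)"

definition dy :: "('n::finite, 'N::finite) sdfun \<Rightarrow> ('n, 'N) sdfun" where
  "dy Q J y = vector_derivative (Q J) (at y)"

definition square_integrable :: "real \<Rightarrow> real \<Rightarrow> (real \<Rightarrow> 'v::euclidean_space) \<Rightarrow> bool" where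
  "square_integrable a b f \<longleftrightarrow>
     f \<in> borel_measurable (lebesgue_on {a..b}) \<and>
     integrable (lebesgue_on {a..b}) (\<lambda>y. (norm (f y))\<^sup>2)"

text \<open>The norm of $L^{2,h}_N$ (\<open>'v = real^'N\<close>) and of $L^{2,h}$ (\<open>'v = real\<close>).\<close>

definition L2_norm ::
  "real \<Rightarrow> real \<Rightarrow> nat \<Rightarrow> (nat^'n::finite \<Rightarrow> real \<Rightarrow> 'v::euclidean_space) \<Rightarrow> real" where
  "L2_norm a b m f = sqrt (\<Sum>J\<in>inner_grid m. integral {a..b} (\<lambda>y. (norm (f J y))\<^sup>2))"

definition H1_inner ::
  "real \<Rightarrow> real \<Rightarrow> real \<Rightarrow> nat \<Rightarrow> ('n::finite, 'N::finite) sdfun \<Rightarrow> ('n, 'N) sdfun \<Rightarrow> real" where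
  "H1_inner A a b m Q V = (\<Sum>J\<in>inner_grid m. \<Sum>k\<in>UNIV. integral {a..b} (\<lambda>y.
     Q J y \<bullet> V J y + dx A m k Q J y \<bullet> dx A m k V J y + dy Q J y \<bullet> dy V J y))"

definition H1_norm ::
  "real \<Rightarrow> real \<Rightarrow> real \<Rightarrow> nat \<Rightarrow> ('n::finite, 'N::finite) sdfun \<Rightarrow> real" where
  "H1_norm A a b m Q = sqrt (\<Sum>J\<in>inner_grid m. \<Sum>k\<in>UNIV. integral {a..b} (\<lambda>y.
     (norm (Q J y))\<^sup>2 + (norm (dx A m k Q J y))\<^sup>2 + (norm (dy Q J y))\<^sup>2))"

text \<open>
  Finite norm, with $Q_J$ for interior $J$ taken as the absolutely continuous representative on
  $[a,b]$: it is the indefinite integral of its (almost everywhere existing) ordinary derivative,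
  which is square integrable.  Hence the values at $y = a, b$ are the traces.
\<close>

definition H1_space ::
  "real \<Rightarrow> real \<Rightarrow> real \<Rightarrow> nat \<Rightarrow> ('n::finite, 'N::finite) sdfun set" where
  "H1_space A a b m = {Q. \<forall>J\<in>inner_grid m.
     square_integrable a b (Q J) \<and>
     (\<forall>k. square_integrable a b (dx A m k Q J)) \<and>
     square_integrable a b (dy Q J) \<and>
     (\<forall>y\<in>{a..b}. (dy Q J has_integral (Q J y - Q J a)) {a..y})}"

definition bdry_eq ::
  "real \<Rightarrow> real \<Rightarrow> nat \<Rightarrow> ('n::finite, 'N::finite) sdfun \<Rightarrow> ('n, 'N) sdfun \<Rightarrow> bool" where
  "bdry_eq a b m Q P \<longleftrightarrow>
     (\<forall>J\<in>grid m. \<forall>y\<in>{a..b}. y = a \<or> y = b \<or> J \<notin> inner_grid m \<longrightarrow> Q J y = P J y)"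

definition H10_space ::
  "real \<Rightarrow> real \<Rightarrow> real \<Rightarrow> nat \<Rightarrow> ('n::finite, 'N::finite) sdfun set" where
  "H10_space A a b m = {Q \<in> H1_space A a b m. bdry_eq a b m Q (\<lambda>J y. 0)}"

definition B_set ::
  "real \<Rightarrow> real \<Rightarrow> real \<Rightarrow> nat \<Rightarrow> real \<Rightarrow> ('n::finite, 'N::finite) sdfun \<Rightarrow> ('n, 'N) sdfun set" where
  "B_set A a b m \<rho> P =
     {W \<in> H1_space A a b m. bdry_eq a b m W P \<and> H1_norm A a b m W < \<rho>}"

text \<open>This is the closure of \<open>B_set\<close> in its affine space whenever \<open>B_set\<close> is nonempty.\<close>

definition B_closed ::
  "real \<Rightarrow> real \<Rightarrow> real \<Rightarrow> nat \<Rightarrow> real \<Rightarrow> ('n::finite, 'N::finite) sdfun \<Rightarrow> ('n, 'N) sdfun set" where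
  "B_closed A a b m \<rho> P =
     {W \<in> H1_space A a b m. bdry_eq a b m W P \<and> H1_norm A a b m W \<le> \<rho>}"


section \<open>The functional, its gradient and gradient descent\<close>

definition residual ::
  "real \<Rightarrow> real \<Rightarrow> nat \<Rightarrow> ('n::{finite,linorder} point \<times> real \<times> real \<Rightarrow> real) \<Rightarrow> ('n point \<Rightarrow> real)
   \<Rightarrow> ('n, 'N::{finite,linorder}) sdfun \<Rightarrow> ('n, 'N) sdfun" where
  "residual A d m K \<mu> W J y =
     D_mat d (grid_pt A m J y) *v dy W J y
     + (\<Sum>i\<in>UNIV. Ax_mat d i (grid_pt A m J y) *v dx A m i W J y)
     + F_fun d K \<mu> (W J y) (grid_pt A m J y)"

definition J_fun ::
  "real \<Rightarrow> real \<Rightarrow> real \<Rightarrow> real \<Rightarrow> nat \<Rightarrow> ('n::{finite,linorder} point \<times> real \<times> real \<Rightarrow> real)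
   \<Rightarrow> ('n point \<Rightarrow> real) \<Rightarrow> real \<Rightarrow> ('n, 'N::{finite,linorder}) sdfun \<Rightarrow> real" where
  "J_fun A d a b m K \<mu> lam W =
     (L2_norm a b m (\<lambda>J y. exp (lam * y) *\<^sub>R residual A d m K \<mu> W J y))\<^sup>2"

definition is_gradient ::
  "real \<Rightarrow> real \<Rightarrow> real \<Rightarrow> nat \<Rightarrow> (('n::finite, 'N::finite) sdfun \<Rightarrow> real)
   \<Rightarrow> ('n, 'N) sdfun \<Rightarrow> ('n, 'N) sdfun \<Rightarrow> bool" where
  "is_gradient A a b m \<Phi> W G \<longleftrightarrow>
     G \<in> H10_space A a b m \<and>
     (\<forall>\<epsilon>>0. \<exists>\<eta>>0. \<forall>V\<in>H10_space A a b m. H1_norm A a b m V < \<eta> \<longrightarrow>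
        \<bar>\<Phi> (\<lambda>J y. W J y + V J y) - \<Phi> W - H1_inner A a b m G V\<bar> \<le> \<epsilon> * H1_norm A a b m V)"

text \<open>
  The Riesz representative of the Frechet derivative of \<open>J_fun\<close>.  It is unique on the relevant set of
  arguments (multi-indices in \<open>grid m\<close>, $y \in [a,b]$); the choice only concerns
  irrelevant values.
\<close>

definition J_grad ::
  "real \<Rightarrow> real \<Rightarrow> real \<Rightarrow> real \<Rightarrow> nat \<Rightarrow> ('n::{finite,linorder} point \<times> real \<times> real \<Rightarrow> real)
   \<Rightarrow> ('n point \<Rightarrow> real) \<Rightarrow> real \<Rightarrow> ('n, 'N::{finite,linorder}) sdfun \<Rightarrow> ('n, 'N) sdfun" where
  "J_grad A d a b m K \<mu> lam W = (SOME G. is_gradient A a b m (J_fun A d a b m K \<mu> lam) W G)"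

primrec descent ::
  "(('n::finite, 'N::finite) sdfun \<Rightarrow> ('n, 'N) sdfun) \<Rightarrow> real \<Rightarrow> ('n, 'N) sdfun \<Rightarrow> nat
   \<Rightarrow> ('n, 'N) sdfun" where
  "descent g \<gamma> W0 0 = W0"
| "descent g \<gamma> W0 (Suc k) =
     (\<lambda>J y. descent g \<gamma> W0 k J y - \<gamma> *\<^sub>R g (descent g \<gamma> W0 k) J y)"


section \<open>Reconstruction of the coefficient\<close>

definition reconstruct ::
  "real \<Rightarrow> real \<Rightarrow> nat \<Rightarrow> ('n::{finite,linorder} point \<times> real \<times> real \<Rightarrow> real) \<Rightarrow> ('n point \<Rightarrow> real)
   \<Rightarrow> ('n, 'N::{finite,linorder}) sdfun \<Rightarrow> nat^'n::{finite,linorder} \<Rightarrow> real \<Rightarrow> real" where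
  "reconstruct A d m K \<mu> W J y =
     (let x = grid_pt A m J y in
      - (1 / (2 * d)) * integral {-d..d} (\<lambda>\<alpha>.
          nu x \<alpha> \<bullet> ((\<chi> i. expand d (dx A m i W J y) \<alpha>), expand d (dy W J y) \<alpha>))
      + (1 / (2 * d)) * integral {-d..d} (\<lambda>\<alpha>.
          exp (- expand d (W J y) \<alpha>) * \<mu> x
          * integral {-d..d} (\<lambda>\<beta>. K (x, \<alpha>, \<beta>) * exp (expand d (W J y) \<beta>))))"

end

theory Submission
  imports Defs
begin

text \<open>
  The exact data $W^*$ plus the difference $S - S^*$ of the boundary extensions is admissible for the
  noisy problem and makes the functional $O(\delta^2)$, because the residual of $W^*$ vanishes and the
  residual has a second-order expansion in $H^1$.  Strong convexity and the variational inequality at the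
  minimizer therefore give $\|W_{\min} - W^*\| = O(\delta)$, so $W_{\min}$ lies inside the ball of radius
  $R/3$ and is a critical point.  There the quadratic upper bound for the functional and
  its strong convexity make each gradient step a contraction towards $W_{\min}$, and the
  reconstruction formula is Lipschitz from $H^1$ to $L^2$ on bounded sets.

  The $y$-derivative in the definition of $H^1$ is the classical one where it exists, so its linearity
  needs the Lebesgue differentiation theorem; the gradient exists by the Riesz representation in
  the subspace with zero boundary values, which is complete.
\<close>

section \<open>Differentiation of indefinite integrals\<close>

text \<open>\<open>C3\<close> is fixed before \<open>K\<close>, \<open>m\<close> and the data, so it
  may see the kernel only through its \<open>C1_norm\<close> and must not see the number of grid
  nodes. The constants of the general second-order expansion do contain that number, because
  constant bounds are summed over all grid lines; they are confined to the step size
  \<open>\<gamma>0\<close>, which is chosen last. The estimate at the perturbed exact solution is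
  therefore derived separately, where the vanishing residual leaves no term with the node count. The
  nonlinearity is exponential in W, hence controlled only on bounded sets of values. The
  one-dimensional embedding of H1 into continuous functions of y turns an H1 ball into such a set,
  with a constant that depends on b - a alone. The radius 2 R leaves room for an iterate of norm
  below R together with an auxiliary gradient step of length at most R. The assumption
  \<open>C3 * \<delta> < \<alpha>0 / 3\<close> closes the count of radii: (R - \<alpha>0) / 3 +
  \<alpha>0 / 3 = R / 3.\<close>

lemma negligible_quotient_deviation:
  fixes f :: "real \<Rightarrow> 'v::euclidean_space"
  assumes f: "f integrable_on {a..b}" and \<eta>: "\<eta> > 0"
  shows "negligible {x\<in>{a<..<b}. \<forall>r>0. \<exists>y\<in>{a<..<b}. y \<noteq> x \<and> \<bar>y - x\<bar> < r \<and>
     norm (integral {a..y} f - integral {a..x} f - (y - x) *\<^sub>R f x) > \<eta> * \<bar>y - x\<bar>}" (is "negligible ?E")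
  unfolding negligible_outer_le
proof (intro allI impI)
  fix e :: real assume e: "e > 0"
  define E where "E = ?E"
  let ?F = "\<lambda>x. integral {a..x} f"
  \<comment> \<open>The 5 compensates the fivefold dilation in Vitali's covering lemma, and \<eta>
    converts Henstock deviations into interval lengths.\<close>
  define e' where "e' = e * \<eta> / 5"
  have e': "e' > 0" using e \<eta> by (simp add: e'_def)
  obtain \<gamma> where \<gamma>: "gauge \<gamma>"
    and hen: "\<And>p. p tagged_partial_division_of (cbox a b) \<Longrightarrow> \<gamma> fine p \<Longrightarrow>
             sum (\<lambda>(x,k). norm(measure lborel k *\<^sub>R f x - integral k f)) p < e'"
    using Henstock_lemma[of f a b e'] f e' by (auto simp: cbox_interval)
  have sE: "x \<in> {a<..<b}" if "x \<in> E" for x using that by (simp add: E_def)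
  \<comment> \<open>Every bad point x gets a partner so close that the segment between them lies in
    the gauge neighbourhood of x; tagged at its endpoint x, the segment is then fine.\<close>
  have "\<forall>x. \<exists>y. x \<in> E \<longrightarrow> y \<in> {a<..<b} \<and> y \<noteq> x \<and> {min x y..max x y} \<subseteq> \<gamma> x \<and>
       norm (?F y - ?F x - (y - x) *\<^sub>R f x) > \<eta> * \<bar>y - x\<bar>"
  proof
    fix x
    obtain r where r: "r > 0" "ball x r \<subseteq> \<gamma> x"
      using \<gamma> unfolding gauge_def by (meson open_contains_ball)
    have "{min x y..max x y} \<subseteq> \<gamma> x" if "\<bar>y - x\<bar> < r" for y
    proof
      fix z assume "z \<in> {min x y..max x y}"
      then have "\<bar>x - z\<bar> < r" using that by (simp only: atLeastAtMost_iff) linarith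
      then show "z \<in> \<gamma> x" using r by (auto simp: subset_iff dist_real_def)
    qed
    then show "\<exists>y. x \<in> E \<longrightarrow> y \<in> {a<..<b} \<and> y \<noteq> x \<and> {min x y..max x y} \<subseteq> \<gamma> x \<and>
       norm (?F y - ?F x - (y - x) *\<^sub>R f x) > \<eta> * \<bar>y - x\<bar>"
      using r(1) unfolding E_def by blast
  qed
  from choice[OF this] obtain Y where Y0: "\<forall>x. x \<in> E \<longrightarrow> Y x \<in> {a<..<b} \<and> Y x \<noteq> x \<and>
       {min x (Y x)..max x (Y x)} \<subseteq> \<gamma> x \<and> norm (?F (Y x) - ?F x - (Y x - x) *\<^sub>R f x) > \<eta> * \<bar>Y x - x\<bar>" ..
  have Y: "Y x \<in> {a<..<b}" "Y x \<noteq> x" "{min x (Y x)..max x (Y x)} \<subseteq> \<gamma> x"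
    "norm (?F (Y x) - ?F x - (Y x - x) *\<^sub>R f x) > \<eta> * \<bar>Y x - x\<bar>" if "x \<in> E" for x
    using Y0[rule_format, OF that] by auto
  define cen where "cen x = (x + Y x) / 2" for x
  define rad where "rad x = \<bar>Y x - x\<bar> / 2" for x
  have cb: "cball (cen x) (rad x) = {min x (Y x)..max x (Y x)}" for x
  proof -
    have "cen x - rad x = min x (Y x)" "cen x + rad x = max x (Y x)"
      by (auto simp: cen_def rad_def min_def max_def abs_if field_simps)
    then show ?thesis by (simp add: cball_eq_atLeastAtMost)
  qed
  have sub: "E \<subseteq> (\<Union>x\<in>E. cball (cen x) (rad x))"
  proof
    fix x assume x: "x \<in> E"
    have "x \<in> cball (cen x) (rad x)" by (simp add: cb)
    with x show "x \<in> (\<Union>x\<in>E. cball (cen x) (rad x))" by (rule UN_I)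
  qed
  have rad: "0 < rad x \<and> rad x \<le> b - a" if "x \<in> E" for x
    using Y(1,2)[OF that] sE[OF that] by (auto simp: rad_def abs_if)
  obtain C where C: "countable C" "C \<subseteq> E"
     "pairwise (\<lambda>i j. disjnt (cball (cen i) (rad i)) (cball (cen j) (rad j))) C"
     "E \<subseteq> (\<Union>i\<in>C. cball (cen i) (5 * rad i))"
    using Vitali_covering_lemma_cballs[OF sub rad] by blast
  \<comment> \<open>Finitely many of the disjoint segments form a tagged partial division, so the
    Henstock lemma bounds the sum of their deviations by \<open>e'\<close>. Each deviation exceeds
    \<eta> times the length, which bounds the total length and with it the measure of the dilated
    cover.\<close>
  have bound: "measure lebesgue (\<Union>i\<in>D. cball (cen i) (5 * rad i)) \<le> e" if D: "D \<subseteq> C" "finite D" for D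
  proof -
    define p where "p = (\<lambda>x. (x, {min x (Y x)..max x (Y x)})) ` D"
    have DE: "x \<in> E" if "x \<in> D" for x using that C D by blast
    have p: "p tagged_partial_division_of (cbox a b)"
      unfolding tagged_partial_division_of_def
    proof (intro conjI allI impI)
      show "finite p" using D by (simp add: p_def)
    next
      fix x K assume "(x,K) \<in> p"
      then have x: "x \<in> D" and K: "K = {min x (Y x)..max x (Y x)}" by (auto simp: p_def)
      show "x \<in> K" by (auto simp: K)
      show "K \<subseteq> cbox a b" using sE[OF DE[OF x]] Y(1)[OF DE[OF x]] by (auto simp: K)
      show "\<exists>a b. K = cbox a b" using K by (metis cbox_interval)
    next
      fix x1 K1 x2 K2 assume *: "(x1, K1) \<in> p \<and> (x2, K2) \<in> p \<and> (x1, K1) \<noteq> (x2, K2)"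
      then have x: "x1 \<in> D" "x2 \<in> D" "x1 \<noteq> x2" and K: "K1 = cball (cen x1) (rad x1)" "K2 = cball (cen x2) (rad x2)"
        by (auto simp: p_def cb)
      have "disjnt K1 K2" using C(3) x D(1) unfolding K pairwise_def by blast
      then show "interior K1 \<inter> interior K2 = {}"
        unfolding disjnt_def using interior_subset by blast
    qed
    have "\<gamma> fine p" using Y(3) DE by (auto simp: p_def fine_def simp del: atLeastAtMost_iff)
    from hen[OF p this] have "(\<Sum>(x,k)\<in>p. norm(measure lborel k *\<^sub>R f x - integral k f)) < e'" .
    also have "(\<Sum>(x,k)\<in>p. norm(measure lborel k *\<^sub>R f x - integral k f)) =
       (\<Sum>x\<in>D. norm (measure lborel {min x (Y x)..max x (Y x)} *\<^sub>R f x - integral {min x (Y x)..max x (Y x)} f))"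
      unfolding p_def by (subst sum.reindex) (auto simp: inj_on_def)
    also have "\<dots> = (\<Sum>x\<in>D. norm (?F (Y x) - ?F x - (Y x - x) *\<^sub>R f x))"
    proof (rule sum.cong)
      fix x assume "x \<in> D"
      note x = sE[OF DE[OF this]] and y = Y(1)[OF DE[OF this]]
      have fi: "f integrable_on {a..z}" if "z \<le> b" for z
        using f that by (auto intro: integrable_on_subinterval)
      show "norm (measure lborel {min x (Y x)..max x (Y x)} *\<^sub>R f x - integral {min x (Y x)..max x (Y x)} f)
         = norm (?F (Y x) - ?F x - (Y x - x) *\<^sub>R f x)"
      proof (cases "x \<le> Y x")
        case True
        have "integral {a..x} f + integral {x..Y x} f = integral {a..Y x} f"
          by (rule Henstock_Kurzweil_Integration.integral_combine) (use x y True fi in auto)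
        then have "integral {x..Y x} f = ?F (Y x) - ?F x" by (metis add_diff_cancel_left')
        then show ?thesis using True by (simp add: norm_minus_commute)
      next
        case False
        have "integral {a..Y x} f + integral {Y x..x} f = integral {a..x} f"
          by (rule Henstock_Kurzweil_Integration.integral_combine) (use x y False fi in auto)
        then have eq: "integral {Y x..x} f = ?F x - ?F (Y x)" by (metis add_diff_cancel_left')
        have m: "min x (Y x) = Y x" "max x (Y x) = x" using False by auto
        show ?thesis unfolding m eq using False by (simp add: algebra_simps)
      qed
    qed simp
    finally have 1: "(\<Sum>x\<in>D. norm (?F (Y x) - ?F x - (Y x - x) *\<^sub>R f x)) < e'" .
    have "(\<Sum>x\<in>D. \<eta> * (2 * rad x)) \<le> (\<Sum>x\<in>D. norm (?F (Y x) - ?F x - (Y x - x) *\<^sub>R f x))"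
      by (rule sum_mono) (use Y(4) DE in \<open>auto simp: rad_def less_imp_le\<close>)
    with 1 have 2: "(\<Sum>x\<in>D. \<eta> * (2 * rad x)) < e'" by linarith
    have "measure lebesgue (\<Union>i\<in>D. cball (cen i) (5 * rad i)) \<le> (\<Sum>i\<in>D. measure lebesgue (cball (cen i) (5 * rad i)))"
      by (rule measure_UNION_le) (use D in auto)
    also have "\<dots> = (\<Sum>i\<in>D. 10 * rad i)"
      by (rule sum.cong) (use rad DE in \<open>auto simp: cball_eq_atLeastAtMost less_imp_le\<close>)
    also have "\<dots> = (5 / \<eta>) * (\<Sum>x\<in>D. \<eta> * (2 * rad x))"
      using \<eta> by (simp add: sum_distrib_left)
    also have "\<dots> \<le> (5 / \<eta>) * e'" using 2 \<eta> by (intro mult_left_mono) auto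
    also have "\<dots> = e" using \<eta> by (simp add: e'_def)
    finally show ?thesis .
  qed
  show "\<exists>T. ?E \<subseteq> T \<and> T \<in> lmeasurable \<and> measure lebesgue T \<le> e"
    unfolding E_def[symmetric] using C(4) fmeasurable_UN_bound[OF C(1) _ bound] measure_UN_bound[OF C(1) _ bound] e
    by (intro exI[of _ "\<Union>i\<in>C. cball (cen i) (5 * rad i)"]) auto
qed

text \<open>If the difference quotients do not converge to f x, some deviation
  \<open>inverse (real (Suc n))\<close> recurs in arbitrarily short intervals at x; this is a
  countable union of the negligible sets above. The derivative is two-sided, the form in which
  \<open>dy\<close> is defined, so both endpoints go into the exceptional set.\<close>

theorem indefinite_integral_has_vector_derivative_ae:
  fixes f :: "real \<Rightarrow> 'v::euclidean_space"
  assumes f: "f integrable_on {a..b}"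
  obtains N where "negligible N"
    "\<And>x. x \<in> {a..b} - N \<Longrightarrow> ((\<lambda>u. integral {a..u} f) has_vector_derivative f x) (at x)"
proof
  let ?F = "\<lambda>x. integral {a..x} f"
  define E where "E \<eta> = {x\<in>{a<..<b}. \<forall>r>0. \<exists>y\<in>{a<..<b}. y \<noteq> x \<and> \<bar>y - x\<bar> < r \<and>
     norm (?F y - ?F x - (y - x) *\<^sub>R f x) > \<eta> * \<bar>y - x\<bar>}" for \<eta>
  define N where "N = {a,b} \<union> (\<Union>n. E (inverse (real (Suc n))))"
  have "negligible (E (inverse (real (Suc n))))" for n
    unfolding E_def by (rule negligible_quotient_deviation[OF f]) simp
  then have "negligible (\<Union>n. E (inverse (real (Suc n))))"
    by (intro negligible_Union_nat)
  then show "negligible N" unfolding N_def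
    using negligible_finite[of "{a,b}"] by (intro negligible_Un) auto
  fix x assume x: "x \<in> {a..b} - N"
  then have xab: "a < x" "x < b" by (auto simp: N_def)
  show "(?F has_vector_derivative f x) (at x)"
    unfolding has_vector_derivative_def has_derivative_at_alt
  proof (intro conjI allI impI bounded_linear_scaleR_left)
    fix e :: real assume "e > 0"
    then obtain n where n: "inverse (real (Suc n)) < e" using reals_Archimedean by blast
    have "x \<notin> E (inverse (real (Suc n)))" using x by (auto simp: N_def)
    then obtain r where r: "r > 0" "\<And>y. y\<in>{a<..<b} \<Longrightarrow> y \<noteq> x \<Longrightarrow> \<bar>y - x\<bar> < r \<Longrightarrow>
     norm (?F y - ?F x - (y - x) *\<^sub>R f x) \<le> inverse (real (Suc n)) * \<bar>y - x\<bar>"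
      unfolding E_def using xab by simp (metis not_less greaterThanLessThan_iff)
    show "\<exists>d>0. \<forall>y. norm (y - x) < d \<longrightarrow> norm (?F y - ?F x - (y - x) *\<^sub>R f x) \<le> e * norm (y - x)"
    proof (intro exI[of _ "min r (min (x - a) (b - x))"] conjI allI impI)
      fix y assume y: "norm (y - x) < min r (min (x - a) (b - x))"
      show "norm (?F y - ?F x - (y - x) *\<^sub>R f x) \<le> e * norm (y - x)"
      proof (cases "y = x")
        case False
        have "norm (?F y - ?F x - (y - x) *\<^sub>R f x) \<le> inverse (real (Suc n)) * \<bar>y - x\<bar>"
          by (rule r(2)) (use y False in auto)
        also have "\<dots> \<le> e * \<bar>y - x\<bar>" using n by (intro mult_right_mono) auto
        finally show ?thesis by simp
      qed simp
    qed (use r xab in auto)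
  qed
qed

section \<open>Riesz representation and square integrable functions\<close>

text \<open>The carrier consists of representatives: semi-discrete functions that agree on all
  relevant arguments are not identified, so \<open>B\<close> is only semidefinite. The single
  operation \<open>cmb s f t g\<close> stands for s f + t g and is constrained only by closure and
  by its effect on \<open>B\<close>.\<close>

locale semi_inner_space =
  fixes S :: "'s set" and cmb :: "real \<Rightarrow> 's \<Rightarrow> real \<Rightarrow> 's \<Rightarrow> 's" and B :: "'s \<Rightarrow> 's \<Rightarrow> real"
  assumes cmb_closed: "f \<in> S \<Longrightarrow> g \<in> S \<Longrightarrow> cmb s f t g \<in> S"
    and B_cmb: "f \<in> S \<Longrightarrow> g \<in> S \<Longrightarrow> h \<in> S \<Longrightarrow> B (cmb s f t g) h = s * B f h + t * B g h"
    and B_sym: "f \<in> S \<Longrightarrow> g \<in> S \<Longrightarrow> B f g = B g f"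
    and B_nonneg: "f \<in> S \<Longrightarrow> 0 \<le> B f f"
begin

definition nrm :: "'s \<Rightarrow> real" where "nrm f = sqrt (B f f)"

lemma nrm_nonneg: "f \<in> S \<Longrightarrow> 0 \<le> nrm f"
  by (simp add: nrm_def B_nonneg)

lemma nrm_sq: "f \<in> S \<Longrightarrow> (nrm f)\<^sup>2 = B f f"
  by (simp add: nrm_def B_nonneg)

lemma B_cmb_right:
  "f \<in> S \<Longrightarrow> g \<in> S \<Longrightarrow> h \<in> S \<Longrightarrow> B h (cmb s f t g) = s * B h f + t * B h g"
  by (metis B_cmb B_sym cmb_closed)

lemma B_cmb_self:
  "f \<in> S \<Longrightarrow> g \<in> S \<Longrightarrow> B (cmb s f t g) (cmb s f t g) = s\<^sup>2 * B f f + 2 * s * t * B f g + t\<^sup>2 * B g g"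
  by (simp add: B_cmb B_cmb_right cmb_closed B_sym[of g f] algebra_simps power2_eq_square)

text \<open>For a null vector g of the semidefinite form one cannot divide by \<open>B g g\<close>;
  there the quadratic in t degenerates to an affine function, which stays nonnegative only if
  \<open>B f g\<close> vanishes.\<close>

lemma Cauchy_Schwarz:
  assumes "f \<in> S" "g \<in> S"
  shows "\<bar>B f g\<bar> \<le> nrm f * nrm g"
proof -
  have q: "0 \<le> B f f + 2 * t * B f g + t\<^sup>2 * B g g" for t
    using B_nonneg[OF cmb_closed[OF assms, of 1 t]] B_cmb_self[OF assms, of 1 t] by simp
  have "(B f g)\<^sup>2 \<le> B f f * B g g"
  proof (cases "B g g = 0")
    case True
    have "B f g = 0"
    proof (rule ccontr)
      assume nz: "B f g \<noteq> 0"
      \<comment> \<open>At this t the affine function takes the value -1.\<close>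
      show False using q[of "- (B f f + 1) / (2 * B f g)"] True nz by (simp add: field_simps)
    qed
    then show ?thesis using True by simp
  next
    case False
    with B_nonneg[OF assms(2)] have p: "B g g > 0" by simp
    have "0 \<le> B g g * (B f f + 2 * (- B f g / B g g) * B f g + (- B f g / B g g)\<^sup>2 * B g g)"
      using q[of "- B f g / B g g"] p by (intro mult_nonneg_nonneg) auto
    also have "\<dots> = B f f * B g g - (B f g)\<^sup>2"
      using p by (simp add: field_simps power2_eq_square)
    finally show ?thesis by simp
  qed
  then show ?thesis
    unfolding nrm_def real_sqrt_mult[symmetric] by (rule real_le_rsqrt[of "\<bar>B f g\<bar>", simplified])
qed

lemma nrm_cmb_le:
  assumes "f \<in> S" "g \<in> S"
  shows "nrm (cmb s f t g) \<le> \<bar>s\<bar> * nrm f + \<bar>t\<bar> * nrm g"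
proof (rule power2_le_imp_le)
  have "s * t * B f g \<le> \<bar>s\<bar> * \<bar>t\<bar> * (nrm f * nrm g)"
  proof -
    have "s * t * B f g \<le> \<bar>s * t\<bar> * \<bar>B f g\<bar>" by (metis abs_ge_self abs_mult)
    also have "\<dots> \<le> \<bar>s * t\<bar> * (nrm f * nrm g)" by (intro mult_left_mono Cauchy_Schwarz assms abs_ge_zero)
    finally show ?thesis by (simp add: abs_mult)
  qed
  then show "(nrm (cmb s f t g))\<^sup>2 \<le> (\<bar>s\<bar> * nrm f + \<bar>t\<bar> * nrm g)\<^sup>2"
    unfolding nrm_sq[OF cmb_closed[OF assms]] B_cmb_self[OF assms] power2_sum power_mult_distrib
      nrm_sq[OF assms(1)] nrm_sq[OF assms(2)] power2_abs by (simp add: mult_ac)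
  show "0 \<le> \<bar>s\<bar> * nrm f + \<bar>t\<bar> * nrm g" using assms by (simp add: nrm_nonneg)
qed

lemma subspace_semi_inner:
  assumes "T \<subseteq> S" "\<And>f g s t. f \<in> T \<Longrightarrow> g \<in> T \<Longrightarrow> cmb s f t g \<in> T"
  shows "semi_inner_space T cmb B"
  using assms by unfold_locales (auto simp: subset_iff B_cmb B_nonneg intro: B_sym)

text \<open>The representative minimizes $\|v\|^2 - 2 l(v)$; minimizing sequences are Cauchy by the
  parallelogram law.\<close>

lemma Riesz_representation:
  fixes l :: "'s \<Rightarrow> real"
  assumes ne: "S \<noteq> {}"
    and complete: "\<And>v :: nat \<Rightarrow> 's. (\<And>n. v n \<in> S) \<Longrightarrow>
        (\<And>e. e > 0 \<Longrightarrow> \<exists>M. \<forall>p\<ge>M. \<forall>q\<ge>M. nrm (cmb 1 (v p) (-1) (v q)) < e) \<Longrightarrow>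
        \<exists>g\<in>S. (\<lambda>n. nrm (cmb 1 (v n) (-1) g)) \<longlonglongrightarrow> 0"
    and l_cmb: "\<And>f g s t. f \<in> S \<Longrightarrow> g \<in> S \<Longrightarrow> l (cmb s f t g) = s * l f + t * l g"
    and l_bound: "\<And>f. f \<in> S \<Longrightarrow> \<bar>l f\<bar> \<le> M * nrm f"
  shows "\<exists>g\<in>S. \<forall>v\<in>S. B g v = l v"
proof -
  define \<Phi> where "\<Phi> v = B v v - 2 * l v" for v
  have lower: "- M\<^sup>2 \<le> \<Phi> v" if "v \<in> S" for v
  proof -
    have "0 \<le> (M - nrm v)\<^sup>2" by simp
    then have "2 * (M * nrm v) \<le> (nrm v)\<^sup>2 + M\<^sup>2" unfolding power2_diff by linarith
    with l_bound[OF that] show ?thesis unfolding \<Phi>_def nrm_sq[OF that, symmetric] by linarith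
  qed
  define I where "I = Inf (\<Phi> ` S)"
  have bdd: "bdd_below (\<Phi> ` S)" using lower by (intro bdd_belowI2)
  have I_le: "I \<le> \<Phi> v" if "v \<in> S" for v
    unfolding I_def using bdd that by (simp add: cINF_lower)
  have "\<exists>v\<in>S. \<Phi> v < I + 1 / real (Suc n)" for n
  proof -
    have "Inf (\<Phi> ` S) < I + 1 / real (Suc n)" by (simp add: I_def)
    then show ?thesis using cInf_less_iff[of "\<Phi> ` S"] ne bdd by auto
  qed
  then obtain v where vS: "\<And>n. v n \<in> S" and v: "\<And>n. \<Phi> (v n) < I + 1 / real (Suc n)" by metis
  have par: "B (cmb 1 (v p) (-1) (v q)) (cmb 1 (v p) (-1) (v q)) \<le> 2 / real (Suc p) + 2 / real (Suc q)" for p q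
  proof -
    let ?h = "cmb (1/2) (v p) (1/2) (v q)"
    have "\<Phi> ?h = (1/4) * B (v p) (v p) + (1/2) * B (v p) (v q) + (1/4) * B (v q) (v q) - l (v p) - l (v q)"
      unfolding \<Phi>_def by (simp add: B_cmb_self l_cmb vS power2_eq_square)
    with I_le[of ?h] have "4 * I \<le> B (v p) (v p) + 2 * B (v p) (v q) + B (v q) (v q) - 4 * l (v p) - 4 * l (v q)"
      using cmb_closed[OF vS vS] by simp
    then show ?thesis
      using v[of p] v[of q] unfolding \<Phi>_def by (simp add: B_cmb_self vS)
  qed
  have "\<exists>g\<in>S. (\<lambda>n. nrm (cmb 1 (v n) (-1) g)) \<longlonglongrightarrow> 0"
  proof (rule complete[OF vS])
    fix e :: real assume e: "e > 0"
    then obtain N where N: "4 / e\<^sup>2 < real N" using reals_Archimedean2 by blast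
    show "\<exists>M. \<forall>p\<ge>M. \<forall>q\<ge>M. nrm (cmb 1 (v p) (-1) (v q)) < e"
    proof (intro exI[of _ N] allI impI)
      fix p q assume pq: "N \<le> p" "N \<le> q"
      have N0: "0 < real (Suc N)" by simp
      have "2 / real (Suc p) \<le> 2 / real (Suc N)" "2 / real (Suc q) \<le> 2 / real (Suc N)"
        using pq by (auto intro!: divide_left_mono)
      moreover have "4 / real (Suc N) < e\<^sup>2"
      proof -
        have "4 < real N * e\<^sup>2" using N e by (simp add: field_simps)
        also have "\<dots> \<le> real (Suc N) * e\<^sup>2" by (intro mult_right_mono) auto
        finally show ?thesis using N0 by (simp only: divide_less_eq) (simp add: mult.commute)
      qed
      ultimately have "B (cmb 1 (v p) (-1) (v q)) (cmb 1 (v p) (-1) (v q)) < e\<^sup>2"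
        using par[of p q] by linarith
      then show "nrm (cmb 1 (v p) (-1) (v q)) < e"
        unfolding nrm_def using e real_less_lsqrt by auto
    qed
  qed
  then obtain g where g: "g \<in> S" and lim: "(\<lambda>n. nrm (cmb 1 (v n) (-1) g)) \<longlonglongrightarrow> 0" by blast
  \<comment> \<open>Passes the infimum to the limit: \<Phi> at g exceeds its value at
    \<open>v n\<close> by at most a multiple of their distance.\<close>
  have diff: "\<Phi> g \<le> \<Phi> (v n) + 2 * (nrm g + M) * nrm (cmb 1 (v n) (-1) g)" for n
  proof -
    let ?d = "cmb 1 (v n) (-1) g"
    have dS: "?d \<in> S" by (simp add: cmb_closed g vS)
    have "\<Phi> (v n) - \<Phi> g = B ?d ?d + 2 * B ?d g - 2 * l ?d"
      unfolding \<Phi>_def by (simp add: B_cmb_self B_cmb l_cmb vS g)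
    moreover have "B ?d ?d \<ge> 0" by (rule B_nonneg[OF dS])
    moreover have "\<bar>B ?d g\<bar> \<le> nrm ?d * nrm g" by (rule Cauchy_Schwarz[OF dS g])
    moreover have "\<bar>l ?d\<bar> \<le> M * nrm ?d" by (rule l_bound[OF dS])
    ultimately show ?thesis by (simp add: algebra_simps)
  qed
  have "\<Phi> g \<le> I"
  proof (rule LIMSEQ_le_const)
    have "(\<lambda>n. 1 / real (Suc n)) \<longlonglongrightarrow> 0"
      using LIMSEQ_inverse_real_of_nat by (simp add: inverse_eq_divide)
    then have "(\<lambda>n. I + 1 / real (Suc n) + 2 * (nrm g + M) * nrm (cmb 1 (v n) (-1) g)) \<longlonglongrightarrow> I + 0 + 2 * (nrm g + M) * 0"
      by (intro tendsto_intros lim)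
    then show "(\<lambda>n. I + 1 / real (Suc n) + 2 * (nrm g + M) * nrm (cmb 1 (v n) (-1) g)) \<longlonglongrightarrow> I" by simp
    show "\<exists>N. \<forall>n\<ge>N. \<Phi> g \<le> I + 1 / real (Suc n) + 2 * (nrm g + M) * nrm (cmb 1 (v n) (-1) g)"
      using diff v by (intro exI[of _ 0] allI impI) (smt (verit, best))
  qed
  have "B g w = l w" if w: "w \<in> S" for w
  proof -
    let ?c = "B g w - l w"
    have q: "0 \<le> 2 * t * ?c + t\<^sup>2 * B w w" for t
      using I_le[OF cmb_closed[OF g w, of 1 t]] \<open>\<Phi> g \<le> I\<close>
      unfolding \<Phi>_def by (simp add: B_cmb_self l_cmb g w algebra_simps)
    \<comment> \<open>Adding 1 keeps the divisor positive even if w is a null vector. With t = - (B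
      g w - l w) / k the quadratic is at most - (B g w - l w)^2 / k, which forces equality.\<close>
    define k where "k = B w w + 1"
    have k: "k > 0" using B_nonneg[OF w] by (simp add: k_def)
    have "0 \<le> 2 * (- ?c / k) * ?c + (- ?c / k)\<^sup>2 * B w w" by (rule q)
    also have "\<dots> \<le> 2 * (- ?c / k) * ?c + (- ?c / k)\<^sup>2 * k"
      by (simp add: k_def mult_left_mono)
    also have "\<dots> = - (?c\<^sup>2 / k)"
      using k by (simp add: field_simps power2_eq_square)
    finally have "?c\<^sup>2 / k \<le> 0" by simp
    then have "?c\<^sup>2 \<le> 0" using k by (simp add: divide_le_0_iff)
    then show ?thesis by simp
  qed
  with g show ?thesis by blast
qed

end

section \<open>Square integrable functions on a compact interval\<close>

lemma finite_measure_lebesgue_on_Icc [intro]: "finite_measure (lebesgue_on {a..b::real})"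
  by (metis cbox_interval finite_measure_lebesgue_on lmeasurable_cbox)

abbreviation L2sq :: "real \<Rightarrow> real \<Rightarrow> (real \<Rightarrow> 'v::euclidean_space) \<Rightarrow> real" where
  "L2sq a b f \<equiv> integral {a..b} (\<lambda>y. (norm (f y))\<^sup>2)"

lemma square_integrable_integrable_norm2:
  "square_integrable a b f \<Longrightarrow> integrable (lebesgue_on {a..b}) (\<lambda>y. (norm (f y))\<^sup>2)"
  by (simp add: square_integrable_def)

lemma square_integrable_measurable:
  "square_integrable a b f \<Longrightarrow> f \<in> borel_measurable (lebesgue_on {a..b})"
  by (simp add: square_integrable_def)

lemma square_integrable_bound:
  fixes f :: "real \<Rightarrow> 'v::euclidean_space"
  assumes "f \<in> borel_measurable (lebesgue_on {a..b})" "integrable (lebesgue_on {a..b}) g"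
    "\<And>y. y \<in> {a..b} \<Longrightarrow> (norm (f y))\<^sup>2 \<le> g y"
  shows "square_integrable a b f"
  unfolding square_integrable_def
proof (intro conjI assms(1))
  show "integrable (lebesgue_on {a..b}) (\<lambda>y. (norm (f y))\<^sup>2)"
  proof (rule Bochner_Integration.integrable_bound[OF assms(2)])
    show "(\<lambda>y. (norm (f y))\<^sup>2) \<in> borel_measurable (lebesgue_on {a..b})"
      using assms(1) by measurable
    show "AE y in lebesgue_on {a..b}. norm ((norm (f y))\<^sup>2) \<le> norm (g y)"
      using assms(3) by (intro AE_I2) (force simp: space_restrict_space)
  qed
qed

lemma norm_add_sq_le: "(norm (u + v))\<^sup>2 \<le> 2 * (norm u)\<^sup>2 + 2 * (norm (v :: 'v::real_normed_vector))\<^sup>2"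
proof -
  have "(norm (u + v))\<^sup>2 \<le> (norm u + norm v)\<^sup>2" by (intro power_mono norm_triangle_ineq) auto
  also have "\<dots> \<le> 2 * (norm u)\<^sup>2 + 2 * (norm v)\<^sup>2"
    using zero_le_power2[of "norm u - norm v"] by (simp add: power2_sum power2_diff)
  finally show ?thesis .
qed

lemma square_integrable_comb:
  fixes f g :: "real \<Rightarrow> 'v::euclidean_space"
  assumes "square_integrable a b f" "square_integrable a b g"
  shows "square_integrable a b (\<lambda>y. s *\<^sub>R f y + t *\<^sub>R g y)"
proof (rule square_integrable_bound)
  note [measurable] = assms[THEN square_integrable_measurable]
  show "(\<lambda>y. s *\<^sub>R f y + t *\<^sub>R g y) \<in> borel_measurable (lebesgue_on {a..b})" by measurable
  show "integrable (lebesgue_on {a..b}) (\<lambda>y. 2 * s\<^sup>2 * (norm (f y))\<^sup>2 + 2 * t\<^sup>2 * (norm (g y))\<^sup>2)"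
    using assms by (intro Bochner_Integration.integrable_add integrable_mult_right square_integrable_integrable_norm2)
  show "(norm (s *\<^sub>R f y + t *\<^sub>R g y))\<^sup>2 \<le> 2 * s\<^sup>2 * (norm (f y))\<^sup>2 + 2 * t\<^sup>2 * (norm (g y))\<^sup>2" for y
    using norm_add_sq_le[of "s *\<^sub>R f y" "t *\<^sub>R g y"] by (simp add: power_mult_distrib)
qed

lemma square_integrable_diff:
  fixes f g :: "real \<Rightarrow> 'v::euclidean_space"
  assumes "square_integrable a b f" "square_integrable a b g"
  shows "square_integrable a b (\<lambda>y. f y - g y)"
  using square_integrable_comb[OF assms, of 1 "-1"] by simp

lemma square_integrable_inner:
  fixes f g :: "real \<Rightarrow> 'v::euclidean_space"
  assumes "square_integrable a b f" "square_integrable a b g"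
  shows "integrable (lebesgue_on {a..b}) (\<lambda>y. f y \<bullet> g y)"
proof (rule Bochner_Integration.integrable_bound)
  note [measurable] = assms[THEN square_integrable_measurable]
  show "integrable (lebesgue_on {a..b}) (\<lambda>y. (norm (f y))\<^sup>2 + (norm (g y))\<^sup>2)"
    using assms by (intro Bochner_Integration.integrable_add square_integrable_integrable_norm2)
  show "(\<lambda>y. f y \<bullet> g y) \<in> borel_measurable (lebesgue_on {a..b})" by measurable
  have "\<bar>f y \<bullet> g y\<bar> \<le> (norm (f y))\<^sup>2 + (norm (g y))\<^sup>2" for y
  proof -
    have "\<bar>f y \<bullet> g y\<bar> \<le> norm (f y) * norm (g y)" by (rule Cauchy_Schwarz_ineq2)
    also have "\<dots> \<le> (norm (f y))\<^sup>2 + (norm (g y))\<^sup>2"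
      using zero_le_power2[of "norm (f y) - norm (g y)"] mult_nonneg_nonneg[OF norm_ge_zero norm_ge_zero, of "f y" "g y"]
      unfolding power2_diff by linarith
    finally show ?thesis .
  qed
  then show "AE y in lebesgue_on {a..b}. norm (f y \<bullet> g y) \<le> norm ((norm (f y))\<^sup>2 + (norm (g y))\<^sup>2)"
    by auto
qed

lemma integrable_on_Icc:
  fixes f :: "real \<Rightarrow> 'v::euclidean_space"
  shows "integrable (lebesgue_on {a..b}) f \<Longrightarrow> f integrable_on {a..b}"
  by (intro integrable_on_lebesgue_on) auto

lemma square_integrable_integrable:
  fixes f :: "real \<Rightarrow> 'v::euclidean_space"
  assumes "square_integrable a b f"
  shows "integrable (lebesgue_on {a..b}) f"
proof (rule Bochner_Integration.integrable_bound)
  interpret finite_measure "lebesgue_on {a..b}" ..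
  show "integrable (lebesgue_on {a..b}) (\<lambda>y. 1 + (norm (f y))\<^sup>2)"
    using assms by (intro Bochner_Integration.integrable_add square_integrable_integrable_norm2 integrable_const)
  show "f \<in> borel_measurable (lebesgue_on {a..b})" using assms by (rule square_integrable_measurable)
  have "norm (f y) \<le> 1 + (norm (f y))\<^sup>2" for y
    using zero_le_power2[of "norm (f y) - 1"] zero_le_power2[of "norm (f y)"] unfolding power2_diff
    by (smt (verit) norm_ge_zero one_power2)
  then show "AE y in lebesgue_on {a..b}. norm (f y) \<le> norm (1 + (norm (f y))\<^sup>2)"
    by auto
qed

text \<open>Lebesgue measurability survives changes on null sets. This is needed because
  \<open>dy\<close> of a combination equals the combination of the \<open>dy\<close> only almost
  everywhere.\<close>

lemma square_integrable_cong_negligible: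
  fixes f g :: "real \<Rightarrow> 'v::euclidean_space"
  assumes f: "square_integrable a b f" and N: "negligible N" and eq: "\<And>y. y \<in> {a..b} - N \<Longrightarrow> g y = f y"
  shows "square_integrable a b g"
proof -
  have Icc: "{a..b} \<inter> space lebesgue \<in> sets lebesgue" by simp
  have "g absolutely_integrable_on {a..b}"
  proof (rule absolutely_integrable_spike[OF _ N])
    show "f absolutely_integrable_on {a..b}"
      unfolding set_integrable_eq[OF Icc] by (rule square_integrable_integrable[OF f])
  qed (rule eq)
  then have "g \<in> borel_measurable (lebesgue_on {a..b})"
    by (rule absolutely_integrable_imp_borel_measurable) simp
  moreover have "(\<lambda>y. (norm (g y))\<^sup>2) absolutely_integrable_on {a..b}"
  proof (rule absolutely_integrable_spike[OF _ N])
    show "(\<lambda>y. (norm (f y))\<^sup>2) absolutely_integrable_on {a..b}"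
      unfolding set_integrable_eq[OF Icc] by (rule square_integrable_integrable_norm2[OF f])
  qed (simp add: eq)
  ultimately show ?thesis
    unfolding square_integrable_def set_integrable_eq[OF Icc] by blast
qed

lemma square_integrable_norm:
  fixes f :: "real \<Rightarrow> 'v::euclidean_space"
  assumes "square_integrable a b f"
  shows "square_integrable a b (\<lambda>y. norm (f y))"
proof -
  note [measurable] = square_integrable_measurable[OF assms]
  have "(\<lambda>y. norm (f y)) \<in> borel_measurable (lebesgue_on {a..b})" by measurable
  then show ?thesis using assms by (simp add: square_integrable_def)
qed

text \<open>With I the integral of f, integrating the nonnegative function |(b - a) f(y) - I|^2 / (b
  - a) gives this Cauchy-Schwarz bound directly for vector values.\<close>

lemma norm_integral_sq_le:
  fixes f :: "real \<Rightarrow> 'v::euclidean_space"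
  assumes ab: "a < b" and f: "square_integrable a b f"
  shows "(norm (integral {a..b} f))\<^sup>2 \<le> (b - a) * L2sq a b f"
proof -
  define I where "I = integral {a..b} f"
  have fi: "f integrable_on {a..b}" "(\<lambda>y. (norm (f y))\<^sup>2) integrable_on {a..b}"
    using f by (auto intro: integrable_on_Icc square_integrable_integrable square_integrable_integrable_norm2)
  have 1: "((\<lambda>y. I \<bullet> f y) has_integral I \<bullet> I) {a..b}"
    using has_integral_linear[OF integrable_integral[OF fi(1)] bounded_linear_inner_right[of I]] by (simp add: o_def I_def)
  have 2: "((\<lambda>y. (norm I)\<^sup>2 / (b - a)) has_integral (b - a) *\<^sub>R ((norm I)\<^sup>2 / (b - a))) {a..b}"
    using has_integral_const_real[of "(norm I)\<^sup>2 / (b - a)" a b] ab by simp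
  have "((\<lambda>y. (b - a) * (norm (f y))\<^sup>2 - 2 * (I \<bullet> f y) + (norm I)\<^sup>2 / (b - a)) has_integral
        (b - a) * L2sq a b f - 2 * (I \<bullet> I) + (b - a) *\<^sub>R ((norm I)\<^sup>2 / (b - a))) {a..b}"
    by (intro has_integral_add has_integral_diff has_integral_mult_right 1 2 integrable_integral[OF fi(2)])
  moreover have "0 \<le> (b - a) * (norm (f y))\<^sup>2 - 2 * (I \<bullet> f y) + (norm I)\<^sup>2 / (b - a)" for y
  proof -
    have "0 \<le> (norm ((b - a) *\<^sub>R f y - I))\<^sup>2 / (b - a)" using ab by simp
    also have "\<dots> = (b - a) * (norm (f y))\<^sup>2 - 2 * (I \<bullet> f y) + (norm I)\<^sup>2 / (b - a)"
    proof -
      have "(norm ((b - a) *\<^sub>R f y - I))\<^sup>2 = (b - a)\<^sup>2 * (norm (f y))\<^sup>2 - 2 * (b - a) * (I \<bullet> f y) + (norm I)\<^sup>2"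
        by (simp only: power2_norm_eq_inner inner_diff_left inner_diff_right inner_scaleR_left inner_scaleR_right inner_commute[of "f y" I])
           (simp add: power2_eq_square algebra_simps)
      moreover have "(c\<^sup>2 * p - 2 * c * q + r) / c = c * p - 2 * q + r / c" if "c > 0" for c p q r :: real
        using that by (simp add: field_simps power2_eq_square)
      ultimately show ?thesis using ab by (simp only: diff_gt_0_iff_gt)
    qed
    finally show ?thesis .
  qed
  ultimately have "0 \<le> (b - a) * L2sq a b f - 2 * (I \<bullet> I) + (b - a) *\<^sub>R ((norm I)\<^sup>2 / (b - a))"
    by (rule has_integral_nonneg)
  then show ?thesis using ab by (simp add: I_def power2_norm_eq_inner)
qed

lemma integral_sq_nonneg: "0 \<le> L2sq a b f"
  by (cases "(\<lambda>y. (norm (f y))\<^sup>2) integrable_on {a..b}") (auto intro: integral_nonneg simp: not_integrable_integral)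

section \<open>The semi-discrete Sobolev space\<close>

lemma integral_subinterval_norm2:
  fixes f :: "real \<Rightarrow> 'v::euclidean_space"
  assumes ab: "a < b" and f: "square_integrable a b f" and ce: "{c..e} \<subseteq> {a..b}"
  shows "(norm (integral {c..e} f))\<^sup>2 \<le> (b - a) * L2sq a b f"
proof -
  have nf: "square_integrable a b (\<lambda>y. norm (f y))"
    by (rule square_integrable_norm[OF f])
  have fi: "f integrable_on {a..b}" "(\<lambda>y. norm (f y)) integrable_on {a..b}"
    using f nf by (auto intro: integrable_on_Icc square_integrable_integrable)
  have "norm (integral {c..e} f) \<le> integral {c..e} (\<lambda>y. norm (f y))"
    using fi ce by (intro integral_norm_bound_integral) (auto intro: integrable_on_subinterval)
  also have "\<dots> \<le> integral {a..b} (\<lambda>y. norm (f y))"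
    using fi ce by (intro integral_subset_le) (auto intro: integrable_on_subinterval)
  finally have "(norm (integral {c..e} f))\<^sup>2 \<le> (integral {a..b} (\<lambda>y. norm (f y)))\<^sup>2"
    by (intro power_mono) auto
  also have "\<dots> \<le> (b - a) * L2sq a b f"
    using norm_integral_sq_le[OF ab nf] by simp
  finally show ?thesis .
qed

lemma continuous_imp_square_integrable:
  fixes f :: "real \<Rightarrow> 'v::euclidean_space"
  assumes f: "continuous_on {a..b} f"
  shows "square_integrable a b f"
  unfolding square_integrable_def
proof
  show "f \<in> borel_measurable (lebesgue_on {a..b})"
    by (rule continuous_imp_measurable_on_sets_lebesgue[OF f]) simp
  have "continuous_on {a..b} (\<lambda>y. (norm (f y))\<^sup>2)" using f by (intro continuous_intros)
  then show "integrable (lebesgue_on {a..b}) (\<lambda>y. (norm (f y))\<^sup>2)" by (rule continuous_imp_integrable_real)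
qed

lemma LINT_Icc:
  fixes f :: "real \<Rightarrow> 'v::euclidean_space"
  shows "integrable (lebesgue_on {a..b}) f \<Longrightarrow> integral\<^sup>L (lebesgue_on {a..b}) f = integral {a..b} f"
  by (intro lebesgue_integral_eq_integral) auto

text \<open>Riesz-Fischer: on a bounded interval the L2 Cauchy condition implies the L1 condition, a
  subsequence then converges almost everywhere, and Fatou's lemma along it carries the L2 bounds
  over to the pointwise limit.\<close>

lemma L2_complete:
  fixes u :: "nat \<Rightarrow> real \<Rightarrow> 'v::euclidean_space"
  assumes ab: "a < b" and u: "\<And>n. square_integrable a b (u n)"
    and cau: "\<And>e. e > 0 \<Longrightarrow> \<exists>M. \<forall>p\<ge>M. \<forall>q\<ge>M. L2sq a b (\<lambda>y. u p y - u q y) < e"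
  obtains f where "square_integrable a b f" "(\<lambda>n. L2sq a b (\<lambda>y. u n y - f y)) \<longlonglongrightarrow> 0"
proof -
  let ?M = "lebesgue_on {a..b}"
  note um[measurable] = u[THEN square_integrable_measurable]
  have d: "square_integrable a b (\<lambda>y. u p y - u q y)" for p q by (intro square_integrable_diff u)
  obtain r where r: "strict_mono r" and rc: "AE y in ?M. Cauchy (\<lambda>i. u (r i) y)"
  proof (rule cauchy_L1_AE_cauchy_subseq[of ?M u])
    show "integrable ?M (u n)" for n by (rule square_integrable_integrable[OF u])
    fix e :: real assume e: "e > 0"
    then have "e\<^sup>2 / (b - a) > 0" using ab by simp
    from cau[OF this] obtain M where M: "\<And>p q. p \<ge> M \<Longrightarrow> q \<ge> M \<Longrightarrow>
       L2sq a b (\<lambda>y. u p y - u q y) < e\<^sup>2 / (b - a)" by blast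
    have "LINT y|?M. norm (u p y - u q y) < e" if "p \<ge> M" "q \<ge> M" for p q
    proof -
      have nf: "square_integrable a b (\<lambda>y. norm (u p y - u q y))"
        by (rule square_integrable_norm[OF d])
      have "(norm (integral {a..b} (\<lambda>y. norm (u p y - u q y))))\<^sup>2 \<le> (b - a) * L2sq a b (\<lambda>y. u p y - u q y)"
        using norm_integral_sq_le[OF ab nf] by simp
      also have "\<dots> < (b - a) * (e\<^sup>2 / (b - a))" using M[OF that] ab by (intro mult_strict_left_mono) auto
      also have "\<dots> = e\<^sup>2" using ab by simp
      finally have "\<bar>integral {a..b} (\<lambda>y. norm (u p y - u q y))\<bar> < e"
        using e by (intro power2_less_imp_less[of _ e]) auto
      then show ?thesis using LINT_Icc[OF square_integrable_integrable[OF nf]] by simp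
    qed
    then show "\<exists>N. \<forall>i\<ge>N. \<forall>j\<ge>N. LINT y|?M. norm (u i y - u j y) < e" by blast
  qed blast
  define f where "f y = lim (\<lambda>i. u (r i) y)" for y
  have fm[measurable]: "f \<in> borel_measurable ?M" unfolding f_def by measurable
  have ae: "AE y in ?M. (\<lambda>i. u (r i) y) \<longlonglongrightarrow> f y"
    using rc by eventually_elim (auto simp: f_def Cauchy_convergent_iff convergent_LIMSEQ_iff)
  have bound: "square_integrable a b (\<lambda>y. u p y - f y) \<and> L2sq a b (\<lambda>y. u p y - f y) \<le> e"
    if e: "e > 0" and M: "\<And>q. q \<ge> M \<Longrightarrow> L2sq a b (\<lambda>y. u p y - u q y) < e" for e M p
  proof -
    have "(\<integral>\<^sup>+ y. ennreal ((norm (u p y - f y))\<^sup>2) \<partial>?M)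
        = (\<integral>\<^sup>+ y. liminf (\<lambda>i. ennreal ((norm (u p y - u (r i) y))\<^sup>2)) \<partial>?M)"
    proof (rule nn_integral_cong_AE)
      show "AE y in ?M. ennreal ((norm (u p y - f y))\<^sup>2) = liminf (\<lambda>i. ennreal ((norm (u p y - u (r i) y))\<^sup>2))"
        using ae
      proof eventually_elim
        case (elim y)
        then have "(\<lambda>i. ennreal ((norm (u p y - u (r i) y))\<^sup>2)) \<longlonglongrightarrow> ennreal ((norm (u p y - f y))\<^sup>2)"
          by (intro tendsto_intros)
        then show ?case by (rule lim_imp_Liminf[symmetric, OF trivial_limit_sequentially])
      qed
    qed
    also have "\<dots> \<le> liminf (\<lambda>i. \<integral>\<^sup>+ y. ennreal ((norm (u p y - u (r i) y))\<^sup>2) \<partial>?M)"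
      by (rule nn_integral_liminf) measurable
    also have "\<dots> \<le> ennreal e"
    proof (rule Liminf_le)
      show "\<forall>\<^sub>F i in sequentially. (\<integral>\<^sup>+ y. ennreal ((norm (u p y - u (r i) y))\<^sup>2) \<partial>?M) \<le> ennreal e"
        unfolding eventually_sequentially
      proof (intro exI[of _ M] allI impI)
        fix i assume "M \<le> i"
        then have ri: "r i \<ge> M" using seq_suble[OF r, of i] by linarith
        have "(\<integral>\<^sup>+ y. ennreal ((norm (u p y - u (r i) y))\<^sup>2) \<partial>?M) = ennreal (LINT y|?M. (norm (u p y - u (r i) y))\<^sup>2)"
          by (intro nn_integral_eq_integral square_integrable_integrable_norm2[OF d]) auto
        also have "\<dots> = ennreal (L2sq a b (\<lambda>y. u p y - u (r i) y))"
          by (subst LINT_Icc[OF square_integrable_integrable_norm2[OF d]]) simp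
        also have "\<dots> \<le> ennreal e" using M[OF ri] by (intro ennreal_leI) simp
        finally show "(\<integral>\<^sup>+ y. ennreal ((norm (u p y - u (r i) y))\<^sup>2) \<partial>?M) \<le> ennreal e" .
      qed
    qed simp
    finally have le: "(\<integral>\<^sup>+ y. ennreal ((norm (u p y - f y))\<^sup>2) \<partial>?M) \<le> ennreal e" .
    have int: "integrable ?M (\<lambda>y. (norm (u p y - f y))\<^sup>2)"
    proof (rule integrableI_bounded)
      have "(\<integral>\<^sup>+ y. ennreal (norm ((norm (u p y - f y))\<^sup>2)) \<partial>?M) \<le> ennreal e" using le by simp
      then show "(\<integral>\<^sup>+ y. ennreal (norm ((norm (u p y - f y))\<^sup>2)) \<partial>?M) < \<infinity>"
        by (rule le_less_trans) simp
    qed measurable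
    have "ennreal (LINT y|?M. (norm (u p y - f y))\<^sup>2) \<le> ennreal e"
      using le by (subst (asm) nn_integral_eq_integral[OF int]) auto
    then have "L2sq a b (\<lambda>y. u p y - f y) \<le> e"
      using e by (subst (asm) LINT_Icc[OF int]) (simp add: ennreal_le_iff)
    with int show ?thesis unfolding square_integrable_def by simp
  qed
  show thesis
  proof
    obtain M where M: "\<And>p q. p \<ge> M \<Longrightarrow> q \<ge> M \<Longrightarrow> L2sq a b (\<lambda>y. u p y - u q y) < 1"
      using cau[of 1] by auto
    have "square_integrable a b (\<lambda>y. u M y - f y)" using bound[of 1 M M] M by simp
    from square_integrable_diff[OF u[of M] this] show "square_integrable a b f" by simp
    show "(\<lambda>n. L2sq a b (\<lambda>y. u n y - f y)) \<longlonglongrightarrow> 0"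
    proof (rule LIMSEQ_I)
      fix e :: real assume "e > 0"
      then have e2: "e / 2 > 0" by simp
      from cau[OF this] obtain M where M: "\<And>p q. p \<ge> M \<Longrightarrow> q \<ge> M \<Longrightarrow> L2sq a b (\<lambda>y. u p y - u q y) < e / 2"
        by blast
      have "L2sq a b (\<lambda>y. u n y - f y) \<le> e / 2" if "n \<ge> M" for n
        using bound[OF e2 M[OF that]] by blast
      then show "\<exists>no. \<forall>n\<ge>no. norm (L2sq a b (\<lambda>y. u n y - f y) - 0) < e"
        using \<open>e > 0\<close> integral_sq_nonneg[of a b "\<lambda>y. u _ y - f y"]
        by (intro exI[of _ M] allI impI) (simp add: abs_of_nonneg, smt (verit) field_sum_of_halves)
    qed
  qed
qed

text \<open>One operation serves for sums, for differences (coefficients 1 and -1) and for multiples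
  (second coefficient 0), so that all norm rules are instances of those of
  \<open>semi_inner_space\<close>.\<close>

definition lin_comb ::
  "real \<Rightarrow> ('n, 'N::finite) sdfun \<Rightarrow> real \<Rightarrow> ('n::finite, 'N) sdfun \<Rightarrow> ('n, 'N) sdfun" where
  "lin_comb s Q t V = (\<lambda>J y. s *\<^sub>R Q J y + t *\<^sub>R V J y)"

definition L2_inner :: "real \<Rightarrow> real \<Rightarrow> (real \<Rightarrow> 'v::euclidean_space) \<Rightarrow> (real \<Rightarrow> 'v) \<Rightarrow> real" where
  "L2_inner a b f g = integral {a..b} (\<lambda>y. f y \<bullet> g y)"

lemma square_integrable_inner_integrable_on:
  fixes f g :: "real \<Rightarrow> 'v::euclidean_space"
  shows "square_integrable a b f \<Longrightarrow> square_integrable a b g \<Longrightarrow> (\<lambda>y. f y \<bullet> g y) integrable_on {a..b}"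
  by (intro integrable_on_Icc square_integrable_inner)

lemma square_integrable_norm2_integrable_on:
  fixes f :: "real \<Rightarrow> 'v::euclidean_space"
  shows "square_integrable a b f \<Longrightarrow> (\<lambda>y. (norm (f y))\<^sup>2) integrable_on {a..b}"
  by (intro integrable_on_Icc square_integrable_integrable_norm2)

lemma L2_inner_comb:
  assumes "square_integrable a b f" "square_integrable a b g" "square_integrable a b h"
    and N: "negligible N" "\<And>y. y \<in> {a..b} - N \<Longrightarrow> k y = s *\<^sub>R f y + t *\<^sub>R g y"
  shows "L2_inner a b k h = s * L2_inner a b f h + t * L2_inner a b g h"
proof -
  have "L2_inner a b k h = integral {a..b} (\<lambda>y. s * (f y \<bullet> h y) + t * (g y \<bullet> h y))"
    unfolding L2_inner_def by (rule integral_spike[OF N(1)]) (simp add: N(2) inner_add_left)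
  also have "\<dots> = integral {a..b} (\<lambda>y. s * (f y \<bullet> h y)) + integral {a..b} (\<lambda>y. t * (g y \<bullet> h y))"
    using assms by (intro Henstock_Kurzweil_Integration.integral_add integrable_on_mult_right square_integrable_inner_integrable_on)
  finally show ?thesis by (simp add: L2_inner_def)
qed

section \<open>Grid nodes and the linear structure of the Sobolev space\<close>

lemma finite_grid: "finite (grid m :: (nat^'n::finite) set)"
proof -
  have "finite {f :: 'n \<Rightarrow> nat. \<forall>i. f i \<in> {..m}}"
    using finite_PiE[of "UNIV :: 'n set" "\<lambda>_. {..m}"] by (simp add: PiE_def Pi_def)
  then have "finite (vec_lambda ` {f :: 'n \<Rightarrow> nat. \<forall>i. f i \<in> {..m}})" by (rule finite_imageI)
  moreover have "(grid m :: (nat^'n) set) \<subseteq> vec_lambda ` {f :: 'n \<Rightarrow> nat. \<forall>i. f i \<in> {..m}}"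
  proof
    fix J :: "nat^'n" assume "J \<in> grid m"
    then show "J \<in> vec_lambda ` {f. \<forall>i. f i \<in> {..m}}"
      by (intro image_eqI[of _ _ "vec_nth J"]) (auto simp: grid_def vec_nth_inverse)
  qed
  ultimately show ?thesis by (rule finite_subset[rotated])
qed

lemma inner_grid_subset: "inner_grid m \<subseteq> (grid m :: (nat^'n::finite) set)"
  by (auto simp: inner_grid_def grid_def intro: order_trans[OF _ diff_le_self])

lemma finite_inner_grid: "finite (inner_grid m :: (nat^'n::finite) set)"
  using finite_subset[OF inner_grid_subset finite_grid] .

text \<open>Lets boundary values and bounds known on all grid nodes control the difference quotients
  at interior nodes, where the truncated subtraction of naturals is exact.\<close>

lemma neighbour_grid:
  assumes "J \<in> inner_grid m"
  shows "J + axis k 1 \<in> grid m" "J - axis k 1 \<in> grid m"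
proof -
  have *: "1 \<le> J $ i" "J $ i \<le> m - 1" for i using assms by (auto simp: inner_grid_def)
  have "(J + axis k 1) $ i \<le> m" "(J - axis k 1) $ i \<le> m" for i
    using *[of i] by (auto simp: axis_def)
  then show "J + axis k 1 \<in> grid m" "J - axis k 1 \<in> grid m" by (auto simp: grid_def)
qed

lemma H1_spaceD:
  assumes "Q \<in> H1_space A a b m" "J \<in> inner_grid m"
  shows "square_integrable a b (Q J)" "square_integrable a b (dx A m k Q J)" "square_integrable a b (dy Q J)"
    "y \<in> {a..b} \<Longrightarrow> (dy Q J has_integral (Q J y - Q J a)) {a..y}"
  using assms by (auto simp: H1_space_def)

lemma dx_comb: "dx A m k (lin_comb s Q t V) J y = s *\<^sub>R dx A m k Q J y + t *\<^sub>R dx A m k V J y"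
  unfolding dx_def lin_comb_def by (simp add: algebra_simps)

text \<open>\<open>vector_derivative\<close> has an unspecified value where no derivative exists.
  The integral identity in \<open>H1_space\<close> exhibits \<open>Q J\<close> as an indefinite
  integral of \<open>dy Q J\<close>, and Lebesgue differentiation makes \<open>dy Q J\<close> a
  genuine derivative off a null set.\<close>

lemma H1_has_derivative_ae:
  assumes "Q \<in> H1_space A a b m" "J \<in> inner_grid m"
  obtains N where "negligible N" "\<And>y. y \<in> {a..b} - N \<Longrightarrow> (Q J has_vector_derivative dy Q J y) (at y)"
proof -
  have "dy Q J integrable_on {a..b}"
    using H1_spaceD(3)[OF assms] by (intro integrable_on_Icc square_integrable_integrable)
  then obtain N where N: "negligible N"
    "\<And>x. x \<in> {a..b} - N \<Longrightarrow> ((\<lambda>u. integral {a..u} (dy Q J)) has_vector_derivative dy Q J x) (at x)"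
    using indefinite_integral_has_vector_derivative_ae by blast
  show thesis
  proof
    \<comment> \<open>Outside [a, b] the function is arbitrary, so a two-sided derivative at an
      endpoint carries no information.\<close>
    show "negligible (N \<union> {a,b})" using N negligible_finite[of "{a,b}"] by (intro negligible_Un) auto
    fix y assume y: "y \<in> {a..b} - (N \<union> {a,b})"
    then have "((\<lambda>u. integral {a..u} (dy Q J)) has_vector_derivative dy Q J y) (at y)" by (intro N) auto
    then have "((\<lambda>u. integral {a..u} (dy Q J) + Q J a) has_vector_derivative dy Q J y + 0) (at y)"
      by (intro derivative_intros)
    then have "((\<lambda>u. integral {a..u} (dy Q J) + Q J a) has_vector_derivative dy Q J y) (at y)" by simp
    then show "(Q J has_vector_derivative dy Q J y) (at y)"
    proof (rule has_vector_derivative_transform_within_open)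
      show "open {a<..<b}" "y \<in> {a<..<b}" using y by auto
      show "integral {a..u} (dy Q J) + Q J a = Q J u" if "u \<in> {a<..<b}" for u
        using H1_spaceD(4)[OF assms, of u] that by (auto dest: integral_unique)
    qed
  qed
qed

text \<open>Linearity of \<open>dy\<close> can fail at single points, since a combination may be
  differentiable where its terms are not; it holds wherever both terms have their
  derivatives.\<close>

lemma dy_comb_ae:
  assumes "Q \<in> H1_space A a b m" "V \<in> H1_space A a b m" "J \<in> inner_grid m"
  obtains N where "negligible N"
    "\<And>y. y \<in> {a..b} - N \<Longrightarrow> dy (lin_comb s Q t V) J y = s *\<^sub>R dy Q J y + t *\<^sub>R dy V J y"
proof -
  obtain N1 where N1: "negligible N1" "\<And>y. y \<in> {a..b} - N1 \<Longrightarrow> (Q J has_vector_derivative dy Q J y) (at y)"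
    by (rule H1_has_derivative_ae[OF assms(1,3)]) blast
  obtain N2 where N2: "negligible N2" "\<And>y. y \<in> {a..b} - N2 \<Longrightarrow> (V J has_vector_derivative dy V J y) (at y)"
    by (rule H1_has_derivative_ae[OF assms(2,3)]) blast
  show thesis
  proof
    show "negligible (N1 \<union> N2)" using N1 N2 by (intro negligible_Un)
    fix y assume y: "y \<in> {a..b} - (N1 \<union> N2)"
    have "((\<lambda>y. s *\<^sub>R Q J y + t *\<^sub>R V J y) has_vector_derivative (s *\<^sub>R dy Q J y + t *\<^sub>R dy V J y)) (at y)"
    proof -
      have "((\<lambda>y. s *\<^sub>R Q J y) has_vector_derivative s *\<^sub>R dy Q J y) (at y)"
        using bounded_linear.has_vector_derivative[OF bounded_linear_scaleR_right N1(2), of y s] y by auto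
      moreover have "((\<lambda>y. t *\<^sub>R V J y) has_vector_derivative t *\<^sub>R dy V J y) (at y)"
        using bounded_linear.has_vector_derivative[OF bounded_linear_scaleR_right N2(2), of y t] y by auto
      ultimately show ?thesis by (rule has_vector_derivative_add)
    qed
    then show "dy (lin_comb s Q t V) J y = s *\<^sub>R dy Q J y + t *\<^sub>R dy V J y"
      unfolding lin_comb_def by (subst dy_def) (rule vector_derivative_at)
  qed
qed

lemma H1_comb_closed:
  assumes Q: "Q \<in> H1_space A a b m" and V: "V \<in> H1_space A a b m"
  shows "lin_comb s Q t V \<in> H1_space A a b m"
  unfolding H1_space_def
proof (intro CollectI ballI conjI allI)
  fix J :: "nat^'a" assume J: "J \<in> inner_grid m"
  note q = H1_spaceD[OF Q J] and v = H1_spaceD[OF V J]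
  obtain N where N: "negligible N"
    "\<And>y. y \<in> {a..b} - N \<Longrightarrow> dy (lin_comb s Q t V) J y = s *\<^sub>R dy Q J y + t *\<^sub>R dy V J y"
    by (rule dy_comb_ae[OF Q V J, where s = s and t = t]) blast
  show "square_integrable a b (lin_comb s Q t V J)"
    unfolding lin_comb_def by (rule square_integrable_comb[OF q(1) v(1)])
  show "square_integrable a b (dx A m k (lin_comb s Q t V) J)" for k
    using square_integrable_comb[OF q(2) v(2), of s k t k] by (simp add: dx_comb[abs_def])
  show "square_integrable a b (dy (lin_comb s Q t V) J)"
    by (rule square_integrable_cong_negligible[OF square_integrable_comb[OF q(3) v(3)] N])
  fix y assume y: "y \<in> {a..b}"
  have "((\<lambda>y. s *\<^sub>R dy Q J y + t *\<^sub>R dy V J y) has_integral s *\<^sub>R (Q J y - Q J a) + t *\<^sub>R (V J y - V J a)) {a..y}"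
    by (intro has_integral_add has_integral_cmul q(4) v(4) y)
  then have "((\<lambda>y. s *\<^sub>R dy Q J y + t *\<^sub>R dy V J y) has_integral lin_comb s Q t V J y - lin_comb s Q t V J a) {a..y}"
    by (simp add: lin_comb_def algebra_simps)
  then show "(dy (lin_comb s Q t V) J has_integral lin_comb s Q t V J y - lin_comb s Q t V J a) {a..y}"
    by (rule has_integral_spike[OF N(1), rotated]) (use N(2) y in auto)
qed

lemma H1_inner_split:
  assumes "Q \<in> H1_space A a b m" "V \<in> H1_space A a b m"
  shows "H1_inner A a b m Q V = (\<Sum>J\<in>inner_grid m. \<Sum>k\<in>UNIV.
     L2_inner a b (Q J) (V J) + L2_inner a b (dx A m k Q J) (dx A m k V J) + L2_inner a b (dy Q J) (dy V J))"
  unfolding H1_inner_def L2_inner_def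
proof (intro sum.cong refl)
  fix J :: "nat^'a" and k assume J: "J \<in> inner_grid m"
  note q = H1_spaceD[OF assms(1) J] and v = H1_spaceD[OF assms(2) J]
  note i = square_integrable_inner_integrable_on[OF q(1) v(1)] square_integrable_inner_integrable_on[OF q(2) v(2)]
    square_integrable_inner_integrable_on[OF q(3) v(3)]
  show "integral {a..b} (\<lambda>y. Q J y \<bullet> V J y + dx A m k Q J y \<bullet> dx A m k V J y + dy Q J y \<bullet> dy V J y)
    = integral {a..b} (\<lambda>y. Q J y \<bullet> V J y) + integral {a..b} (\<lambda>y. dx A m k Q J y \<bullet> dx A m k V J y)
      + integral {a..b} (\<lambda>y. dy Q J y \<bullet> dy V J y)"
    by (simp add: Henstock_Kurzweil_Integration.integral_add i integrable_add)
qed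

lemma H1_norm_inner: "H1_norm A a b m Q = sqrt (H1_inner A a b m Q Q)"
  unfolding H1_norm_def H1_inner_def by (simp add: power2_norm_eq_inner)

lemma semi_inner_H1:
  "semi_inner_space (H1_space A a b m :: ('n::finite, 'N::finite) sdfun set) lin_comb (H1_inner A a b m)"
proof
  fix f g h :: "('n, 'N) sdfun" and s t
  assume f: "f \<in> H1_space A a b m" and g: "g \<in> H1_space A a b m"
  show c: "lin_comb s f t g \<in> H1_space A a b m" by (rule H1_comb_closed[OF f g])
  show "H1_inner A a b m f g = H1_inner A a b m g f" by (simp add: H1_inner_def inner_commute)
  show "0 \<le> H1_inner A a b m f f"
  proof -
    have "0 \<le> integral {a..b} (\<lambda>y. (norm (f J y))\<^sup>2 + (norm (dx A m k f J y))\<^sup>2 + (norm (dy f J y))\<^sup>2)" if "J \<in> inner_grid m" for J k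
      using H1_spaceD[OF f that]
      by (intro integral_nonneg integrable_add square_integrable_norm2_integrable_on) auto
    then show ?thesis unfolding H1_inner_def by (intro sum_nonneg) (auto simp: power2_norm_eq_inner)
  qed
  assume h: "h \<in> H1_space A a b m"
  show "H1_inner A a b m (lin_comb s f t g) h = s * H1_inner A a b m f h + t * H1_inner A a b m g h"
    unfolding H1_inner_split[OF c h] H1_inner_split[OF f h] H1_inner_split[OF g h] sum_distrib_left sum.distrib[symmetric]
  proof (intro sum.cong refl)
    fix J :: "nat^'n" and k assume J: "J \<in> inner_grid m"
    note f' = H1_spaceD[OF f J] and g' = H1_spaceD[OF g J] and h' = H1_spaceD[OF h J]
    obtain N where N: "negligible N"
      "\<And>y. y \<in> {a..b} - N \<Longrightarrow> dy (lin_comb s f t g) J y = s *\<^sub>R dy f J y + t *\<^sub>R dy g J y"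
      by (rule dy_comb_ae[OF f g J, where s = s and t = t]) blast
    have 1: "L2_inner a b (lin_comb s f t g J) (h J) = s * L2_inner a b (f J) (h J) + t * L2_inner a b (g J) (h J)"
      by (rule L2_inner_comb[OF f'(1) g'(1) h'(1), of "{}"]) (auto simp: lin_comb_def)
    have 2: "L2_inner a b (dx A m k (lin_comb s f t g) J) (dx A m k h J)
      = s * L2_inner a b (dx A m k f J) (dx A m k h J) + t * L2_inner a b (dx A m k g J) (dx A m k h J)"
      by (rule L2_inner_comb[OF f'(2) g'(2) h'(2), of "{}"]) (auto simp: dx_comb)
    have 3: "L2_inner a b (dy (lin_comb s f t g) J) (dy h J)
      = s * L2_inner a b (dy f J) (dy h J) + t * L2_inner a b (dy g J) (dy h J)"
      by (rule L2_inner_comb[OF f'(3) g'(3) h'(3) N])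
    show "L2_inner a b (lin_comb s f t g J) (h J) + L2_inner a b (dx A m k (lin_comb s f t g) J) (dx A m k h J) +
           L2_inner a b (dy (lin_comb s f t g) J) (dy h J) =
           s * (L2_inner a b (f J) (h J) + L2_inner a b (dx A m k f J) (dx A m k h J) + L2_inner a b (dy f J) (dy h J)) +
           t * (L2_inner a b (g J) (h J) + L2_inner a b (dx A m k g J) (dx A m k h J) + L2_inner a b (dy g J) (dy h J))"
      unfolding 1 2 3 by (simp add: algebra_simps)
  qed
qed

lemma H1_norm_sq_split:
  fixes Q :: "('n::finite, 'N::finite) sdfun"
  assumes Q: "Q \<in> H1_space A a b m"
  shows "(H1_norm A a b m Q)\<^sup>2 = (\<Sum>J\<in>inner_grid m. \<Sum>k\<in>UNIV. L2sq a b (Q J)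
     + L2sq a b (dx A m k Q J) + L2sq a b (dy Q J))"
proof -
  interpret semi_inner_space "H1_space A a b m :: ('n, 'N) sdfun set" lin_comb "H1_inner A a b m" by (rule semi_inner_H1)
  show ?thesis
    unfolding H1_norm_inner real_sqrt_pow2[OF B_nonneg[OF Q]]
    by (simp add: H1_inner_split[OF Q Q] L2_inner_def power2_norm_eq_inner)
qed

text \<open>In the norm the terms without $k$ are counted once for every coordinate, hence at least once.\<close>

lemma H1_norm_sq_ge:
  fixes Q :: "('n::finite, 'N::finite) sdfun"
  assumes Q: "Q \<in> H1_space A a b m"
  shows "(\<Sum>J\<in>inner_grid m. L2sq a b (Q J)
     + (\<Sum>k\<in>UNIV. L2sq a b (dx A m k Q J)) + L2sq a b (dy Q J))
     \<le> (H1_norm A a b m Q)\<^sup>2"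
  unfolding H1_norm_sq_split[OF Q]
proof (rule sum_mono)
  fix J :: "nat^'n"
  let ?x = "L2sq a b (Q J)" and ?z = "L2sq a b (dy Q J)"
  have c: "1 \<le> real CARD('n)" by simp
  have "1 * ?x \<le> real CARD('n) * ?x" "1 * ?z \<le> real CARD('n) * ?z"
    by (intro mult_right_mono c integral_sq_nonneg)+
  then show "?x + (\<Sum>k\<in>UNIV. L2sq a b (dx A m k Q J)) + ?z
     \<le> (\<Sum>k\<in>UNIV. ?x + L2sq a b (dx A m k Q J) + ?z)"
    by (simp add: sum.distrib)
qed

lemma H1_norm_sq_ge_J:
  fixes Q :: "('n::finite, 'N::finite) sdfun"
  assumes Q: "Q \<in> H1_space A a b m" and J: "J \<in> inner_grid m"
  shows "L2sq a b (Q J) + (\<Sum>k\<in>UNIV. L2sq a b (dx A m k Q J))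
    + L2sq a b (dy Q J) \<le> (H1_norm A a b m Q)\<^sup>2"
proof -
  have "L2sq a b (Q J) + (\<Sum>k\<in>UNIV. L2sq a b (dx A m k Q J))
    + L2sq a b (dy Q J) \<le> (\<Sum>J\<in>inner_grid m. L2sq a b (Q J)
     + (\<Sum>k\<in>UNIV. L2sq a b (dx A m k Q J)) + L2sq a b (dy Q J))"
    by (rule member_le_sum[OF J _ finite_inner_grid, where f = "\<lambda>J. L2sq a b (Q J)
     + (\<Sum>k\<in>UNIV. L2sq a b (dx A m k Q J)) + L2sq a b (dy Q J)"])
      (intro add_nonneg_nonneg sum_nonneg integral_sq_nonneg)
  also have "\<dots> \<le> (H1_norm A a b m Q)\<^sup>2" by (rule H1_norm_sq_ge[OF Q])
  finally show ?thesis .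
qed

section \<open>Sobolev embedding along a grid line\<close>

lemma H1_continuous:
  assumes "Q \<in> H1_space A a b m" "J \<in> inner_grid m"
  shows "continuous_on {a..b} (Q J)"
proof -
  have "dy Q J integrable_on {a..b}"
    using H1_spaceD(3)[OF assms] by (intro integrable_on_Icc square_integrable_integrable)
  then have "continuous_on {a..b} (\<lambda>y. integral {a..y} (dy Q J) + Q J a)"
    by (intro continuous_intros indefinite_integral_continuous_1)
  then show ?thesis
  proof (rule continuous_on_eq)
    show "integral {a..y} (dy Q J) + Q J a = Q J y" if "y \<in> {a..b}" for y
      using integral_unique[OF H1_spaceD(4)[OF assms that]] by simp
  qed
qed

lemma H1_increment:
  assumes ab: "a < b" and Q: "Q \<in> H1_space A a b m" and J: "J \<in> inner_grid m" and yz: "y \<in> {a..b}" "z \<in> {a..b}"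
  shows "(norm (Q J y - Q J z))\<^sup>2 \<le> (b - a) * L2sq a b (dy Q J)"
  using yz
proof (induction y z rule: linorder_wlog)
  case (le y z)
  have i: "dy Q J integrable_on {a..z}" using H1_spaceD(4)[OF Q J le(3)] by blast
  have "integral {a..y} (dy Q J) + integral {y..z} (dy Q J) = integral {a..z} (dy Q J)"
    by (rule Henstock_Kurzweil_Integration.integral_combine) (use le i in auto)
  then have "integral {y..z} (dy Q J) = Q J z - Q J y"
    using H1_spaceD(4)[OF Q J le(3), THEN integral_unique] H1_spaceD(4)[OF Q J le(2), THEN integral_unique]
    by (simp add: algebra_simps)
  then show ?case
    using integral_subinterval_norm2[OF ab H1_spaceD(3)[OF Q J], of y z] le by (simp add: norm_minus_commute)
qed (simp add: norm_minus_commute)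

text \<open>The first summand comes from averaging |Q(z)|^2 over [a, b], the second from the
  increment between y and z. No grid quantity enters.\<close>

definition sobolev_const :: "real \<Rightarrow> real \<Rightarrow> real" where
  "sobolev_const a b = sqrt (2 / (b - a) + 2 * (b - a))"

lemma sobolev_const_pos: "a < b \<Longrightarrow> 0 < sobolev_const a b"
  by (simp add: sobolev_const_def add_pos_pos)

text \<open>The inequality |Q(y)|^2 <= 2 |Q(z)|^2 + 2 |Q(y) - Q(z)|^2 is averaged over z, so that
  functions with nonzero boundary values are covered.\<close>

lemma H1_sup_bound:
  assumes ab: "a < b" and Q: "Q \<in> H1_space A a b m" and J: "J \<in> inner_grid m" and y: "y \<in> {a..b}"
  shows "norm (Q J y) \<le> sobolev_const a b * H1_norm A a b m Q"
proof (rule power2_le_imp_le)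
  let ?q = "L2sq a b (Q J)" and ?D = "L2sq a b (dy Q J)"
  have "(norm (Q J y))\<^sup>2 \<le> 2 * (norm (Q J z))\<^sup>2 + 2 * ((b - a) * ?D)" if "z \<in> {a..b}" for z
    using norm_add_sq_le[of "Q J z" "Q J y - Q J z"] H1_increment[OF ab Q J y that] by simp
  moreover have "integral {a..b} (\<lambda>z. c) \<le> integral {a..b} (\<lambda>z. 2 * (norm (Q J z))\<^sup>2 + 2 * ((b - a) * ?D))"
    if "\<And>z. z \<in> {a..b} \<Longrightarrow> c \<le> 2 * (norm (Q J z))\<^sup>2 + 2 * ((b - a) * ?D)" for c
    using H1_spaceD(1)[OF Q J] that
    by (intro integral_le integrable_add integrable_on_mult_right square_integrable_norm2_integrable_on integrable_const_ivl)
  ultimately have "L2sq a b (\<lambda>z. Q J y) \<le> integral {a..b} (\<lambda>z. 2 * (norm (Q J z))\<^sup>2 + 2 * ((b - a) * ?D))"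
    by blast
  also have "\<dots> = 2 * ?q + (b - a) * (2 * ((b - a) * ?D))"
    using H1_spaceD(1)[OF Q J] ab
    by (subst Henstock_Kurzweil_Integration.integral_add)
       (auto intro: integrable_on_mult_right square_integrable_norm2_integrable_on)
  finally have "(b - a) * (norm (Q J y))\<^sup>2 \<le> 2 * ?q + (b - a) * (2 * ((b - a) * ?D))" using ab by simp
  then have "(norm (Q J y))\<^sup>2 \<le> 2 / (b - a) * ?q + 2 * (b - a) * ?D"
    using ab by (simp add: field_simps)
  also have "\<dots> \<le> (2 / (b - a) + 2 * (b - a)) * (?q + ?D)"
    using ab integral_sq_nonneg[of a b "Q J"] integral_sq_nonneg[of a b "dy Q J"] by (simp add: distrib_left distrib_right)
  also have "\<dots> \<le> (2 / (b - a) + 2 * (b - a)) * (H1_norm A a b m Q)\<^sup>2"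
  proof (rule mult_left_mono)
    have "0 \<le> (\<Sum>k\<in>UNIV. L2sq a b (dx A m k Q J))" by (intro sum_nonneg integral_sq_nonneg)
    then show "?q + ?D \<le> (H1_norm A a b m Q)\<^sup>2" using H1_norm_sq_ge_J[OF Q J] by linarith
  qed (use ab in auto)
  also have "\<dots> = (sobolev_const a b * H1_norm A a b m Q)\<^sup>2"
    using ab by (simp add: sobolev_const_def power_mult_distrib)
  finally show "(norm (Q J y))\<^sup>2 \<le> (sobolev_const a b * H1_norm A a b m Q)\<^sup>2" .
  interpret semi_inner_space "H1_space A a b m :: ('a, 'b) sdfun set" lin_comb "H1_inner A a b m" by (rule semi_inner_H1)
  show "0 \<le> sobolev_const a b * H1_norm A a b m Q"
    using sobolev_const_pos[OF ab] B_nonneg[OF Q] by (simp add: H1_norm_inner)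
qed

section \<open>Zero boundary values: completeness and Riesz representation\<close>

lemma bdry_eq_comb:
  assumes "bdry_eq a b m Q P" "bdry_eq a b m V P'"
  shows "bdry_eq a b m (lin_comb s Q t V) (lin_comb s P t P')"
  using assms by (auto simp: bdry_eq_def lin_comb_def)

lemma H10_comb_closed:
  "Q \<in> H10_space A a b m \<Longrightarrow> V \<in> H10_space A a b m \<Longrightarrow> lin_comb s Q t V \<in> H10_space A a b m"
  using bdry_eq_comb[of a b m Q "\<lambda>J y. 0" V "\<lambda>J y. 0" s t] H1_comb_closed[of Q A a b m V s t]
  by (auto simp: H10_space_def lin_comb_def)

lemma H10_subset: "H10_space A a b m \<subseteq> H1_space A a b m"
  by (auto simp: H10_space_def)

lemma semi_inner_H10:
  "semi_inner_space (H10_space A a b m :: ('n::finite, 'N::finite) sdfun set) lin_comb (H1_inner A a b m)"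
  by (rule semi_inner_space.subspace_semi_inner[OF semi_inner_H1 H10_subset H10_comb_closed])

text \<open>Only the y-derivatives need an L2 limit. Zero values at y = a allow the limit function
  to be recovered by integration; convergence is then uniform on all grid lines, and the difference
  quotients, having a fixed step, converge along with it.\<close>

lemma H10_complete:
  fixes v :: "nat \<Rightarrow> ('n::finite, 'N::finite) sdfun"
  assumes ab: "a < b" and v: "\<And>n. v n \<in> H10_space A a b m"
    and cau: "\<And>e. e > 0 \<Longrightarrow> \<exists>M. \<forall>p\<ge>M. \<forall>q\<ge>M. H1_norm A a b m (lin_comb 1 (v p) (-1) (v q)) < e"
  shows "\<exists>g\<in>H10_space A a b m. (\<lambda>n. H1_norm A a b m (lin_comb 1 (v n) (-1) g)) \<longlonglongrightarrow> 0"
proof -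
  interpret semi_inner_space "H1_space A a b m :: ('n, 'N) sdfun set" lin_comb "H1_inner A a b m" by (rule semi_inner_H1)
  have vH: "v n \<in> H1_space A a b m" for n using v H10_subset by blast
  have "\<exists>u. square_integrable a b u \<and> (\<lambda>n. L2sq a b (\<lambda>y. dy (v n) J y - u y)) \<longlonglongrightarrow> 0"
    if J: "J \<in> inner_grid m" for J
  proof -
    have "\<exists>M. \<forall>p\<ge>M. \<forall>q\<ge>M. L2sq a b (\<lambda>y. dy (v p) J y - dy (v q) J y) < e" if "e > 0" for e
    proof -
      have "sqrt e > 0" using that by simp
      from cau[OF this] obtain M where M: "\<And>p q. p \<ge> M \<Longrightarrow> q \<ge> M \<Longrightarrow> H1_norm A a b m (lin_comb 1 (v p) (-1) (v q)) < sqrt e"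
        by blast
      have "L2sq a b (\<lambda>y. dy (v p) J y - dy (v q) J y) < e" if "p \<ge> M" "q \<ge> M" for p q
      proof -
        let ?w = "lin_comb 1 (v p) (-1) (v q)"
        have w: "?w \<in> H1_space A a b m" by (rule H1_comb_closed[OF vH vH])
        obtain N where N: "negligible N" "\<And>y. y \<in> {a..b} - N \<Longrightarrow> dy ?w J y = 1 *\<^sub>R dy (v p) J y + (-1) *\<^sub>R dy (v q) J y"
          by (rule dy_comb_ae[OF vH vH J, where s = 1 and t = "-1"]) blast
        have "L2sq a b (\<lambda>y. dy (v p) J y - dy (v q) J y) = L2sq a b (dy ?w J)"
          by (rule integral_spike[OF N(1)]) (simp add: N(2))
        also have "\<dots> \<le> (H1_norm A a b m ?w)\<^sup>2"
          using H1_norm_sq_ge_J[OF w J] integral_sq_nonneg[of a b "?w J"]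
            sum_nonneg[of UNIV "\<lambda>k. L2sq a b (dx A m k ?w J)", OF integral_sq_nonneg] by linarith
        also have "\<dots> < (sqrt e)\<^sup>2"
          using M[OF that] nrm_nonneg[OF w] by (intro power_strict_mono) (auto simp: nrm_def H1_norm_inner)
        finally show ?thesis using \<open>e > 0\<close> by simp
      qed
      then show ?thesis by blast
    qed
    from L2_complete[OF ab H1_spaceD(3)[OF vH J] this] show ?thesis by blast
  qed
  then have "\<exists>u. \<forall>J\<in>inner_grid m. square_integrable a b (u J) \<and> (\<lambda>n. L2sq a b (\<lambda>y. dy (v n) J y - u J y)) \<longlonglongrightarrow> 0"
    by (intro bchoice) blast
  then obtain u where u: "\<And>J. J \<in> inner_grid m \<Longrightarrow> square_integrable a b (u J)"
    and ulim: "\<And>J. J \<in> inner_grid m \<Longrightarrow> (\<lambda>n. L2sq a b (\<lambda>y. dy (v n) J y - u J y)) \<longlonglongrightarrow> 0"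
    by blast
  define d where "d n = (\<Sum>J\<in>inner_grid m. L2sq a b (\<lambda>y. dy (v n) J y - u J y))" for n
  have dlim: "d \<longlonglongrightarrow> 0"
    unfolding d_def using tendsto_sum[of "inner_grid m" _ "\<lambda>_. 0", OF ulim] by simp
  have d0: "0 \<le> d n" for n unfolding d_def by (intro sum_nonneg integral_sq_nonneg)
  have dJ: "L2sq a b (\<lambda>y. dy (v n) J y - u J y) \<le> d n" if "J \<in> inner_grid m" for n J
    unfolding d_def using that by (intro member_le_sum finite_inner_grid integral_sq_nonneg)
  \<comment> \<open>Nodes outside the interior receive 0, as the lateral boundary condition demands;
    at interior nodes the integral starts from the prescribed value 0 at y = a.\<close>
  define g :: "('n, 'N) sdfun" where "g J y = (if J \<in> inner_grid m then integral {a..y} (u J) else 0)" for J y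
  have ui: "u J integrable_on {a..b}" if "J \<in> inner_grid m" for J
    using u[OF that] by (intro integrable_on_Icc square_integrable_integrable)
  have zero: "v n J y = 0" if "J \<in> grid m" "y \<in> {a..b}" "y = a \<or> y = b \<or> J \<notin> inner_grid m" for n J y
    using v[of n] that unfolding H10_space_def bdry_eq_def by blast
  have sup: "(norm (v n J y - g J y))\<^sup>2 \<le> (b - a) * d n" if J: "J \<in> grid m" and y: "y \<in> {a..b}" for n J y
  proof (cases "J \<in> inner_grid m")
    case True
    have "v n J a = 0" using zero[OF J, of a] ab by simp
    then have "(dy (v n) J has_integral v n J y) {a..y}" using H1_spaceD(4)[OF vH True y, of n] by simp
    moreover have "(u J has_integral g J y) {a..y}"
      using integrable_integral[OF integrable_on_subinterval[OF ui[OF True]], of a y] y True by (auto simp: g_def)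
    ultimately have "((\<lambda>y. dy (v n) J y - u J y) has_integral v n J y - g J y) {a..y}" by (rule has_integral_diff)
    then have "(norm (v n J y - g J y))\<^sup>2 \<le> (b - a) * L2sq a b (\<lambda>y. dy (v n) J y - u J y)"
      using integral_subinterval_norm2[OF ab square_integrable_diff[OF H1_spaceD(3)[OF vH True] u[OF True]], of a y n] y
      by (simp add: integral_unique)
    also have "\<dots> \<le> (b - a) * d n" using dJ[OF True] ab by (intro mult_left_mono) auto
    finally show ?thesis .
  next
    case False
    then show ?thesis using zero[OF J y] d0 ab by (simp add: g_def)
  qed
  have dyg: "\<exists>N. negligible N \<and> (\<forall>y\<in>{a..b} - N. dy g J y = u J y)" if J: "J \<in> inner_grid m" for J
  proof -
    obtain N where N: "negligible N" "\<And>x. x \<in> {a..b} - N \<Longrightarrow> ((\<lambda>y. integral {a..y} (u J)) has_vector_derivative u J x) (at x)"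
      using indefinite_integral_has_vector_derivative_ae[OF ui[OF J]] by blast
    have "g J = (\<lambda>y. integral {a..y} (u J))" using J by (auto simp: g_def)
    then have "\<forall>y\<in>{a..b} - N. dy g J y = u J y" using N(2) by (simp add: dy_def vector_derivative_at)
    with N(1) show ?thesis by blast
  qed
  have gcont: "continuous_on {a..b} (g J)" if "J \<in> grid m" for J
  proof (cases "J \<in> inner_grid m")
    case True
    then have "g J = (\<lambda>y. integral {a..y} (u J))" by (auto simp: g_def)
    then show ?thesis using indefinite_integral_continuous_1[OF ui[OF True]] by simp
  qed (simp add: g_def)
  note csq = continuous_imp_square_integrable
  have gH: "g \<in> H1_space A a b m" unfolding H1_space_def
  proof (intro CollectI ballI conjI allI)
    fix J :: "nat^'n" assume J: "J \<in> inner_grid m"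
    obtain N where N: "negligible N" "\<And>y. y \<in> {a..b} - N \<Longrightarrow> dy g J y = u J y" using dyg[OF J] by blast
    show "square_integrable a b (g J)" using J inner_grid_subset by (intro csq gcont) blast
    show "square_integrable a b (dx A m k g J)" for k
      unfolding dx_def by (intro csq continuous_intros gcont neighbour_grid J)
    show "square_integrable a b (dy g J)" by (rule square_integrable_cong_negligible[OF u[OF J] N])
    fix y assume y: "y \<in> {a..b}"
    have "(u J has_integral g J y - g J a) {a..y}"
      using integrable_integral[OF integrable_on_subinterval[OF ui[OF J]], of a y] y J by (auto simp: g_def)
    then show "(dy g J has_integral g J y - g J a) {a..y}"
      by (rule has_integral_spike[OF N(1), rotated]) (use N(2) y in auto)
  qed
  \<comment> \<open>The value at y = b is not built into g; it is inherited from the sequence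
    through uniform convergence.\<close>
  have gb: "g J b = 0" if J: "J \<in> inner_grid m" for J
  proof -
    have Jg: "J \<in> grid m" using J inner_grid_subset by blast
    have "(norm (g J b))\<^sup>2 \<le> (b - a) * d n" for n using sup[OF Jg, of b n] zero[OF Jg, of b n] ab by simp
    moreover have "(\<lambda>n. (b - a) * d n) \<longlonglongrightarrow> (b - a) * 0" by (intro tendsto_intros dlim)
    ultimately have "(norm (g J b))\<^sup>2 \<le> (b - a) * 0" by (intro LIMSEQ_le_const) auto
    then show ?thesis by simp
  qed
  have g0: "g \<in> H10_space A a b m"
    unfolding H10_space_def bdry_eq_def using gH gb by (auto simp: g_def)
  moreover have "(\<lambda>n. H1_norm A a b m (lin_comb 1 (v n) (-1) g)) \<longlonglongrightarrow> 0"
  proof -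
    \<comment> \<open>The three summands bound, in units of \<open>d n\<close>, the function itself,
      one difference quotient and the y-derivative.\<close>
    define c where "c = (b - a) * (b - a) + (b - a) * ((inverse (2 * step A m))\<^sup>2 * (4 * (b - a))) + 1"
    define C where "C = (\<Sum>J\<in>(inner_grid m :: (nat^'n) set). \<Sum>k\<in>(UNIV :: 'n set). c)"
    have bound: "(H1_norm A a b m (lin_comb 1 (v n) (-1) g))\<^sup>2 \<le> C * d n" for n
    proof -
      let ?w = "lin_comb 1 (v n) (-1) g"
      have w: "?w \<in> H1_space A a b m" by (rule H1_comb_closed[OF vH gH])
      have "L2sq a b (?w J) + L2sq a b (dx A m k ?w J)
         + L2sq a b (dy ?w J) \<le> c * d n" if J: "J \<in> inner_grid m" for J k
      proof -
        have Jg: "J \<in> grid m" using J inner_grid_subset by blast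
        have const: "L2sq a b f \<le> (b - a) * r"
          if "square_integrable a b f" "\<And>y. y \<in> {a..b} \<Longrightarrow> (norm (f y))\<^sup>2 \<le> r" for f :: "real \<Rightarrow> real^'N" and r
        proof -
          have "L2sq a b f \<le> integral {a..b} (\<lambda>y. r)"
            using that by (intro integral_le square_integrable_norm2_integrable_on integrable_const_ivl)
          then show ?thesis using ab by simp
        qed
        have 1: "L2sq a b (?w J) \<le> (b - a) * ((b - a) * d n)"
          by (rule const[OF H1_spaceD(1)[OF w J]]) (use sup[OF Jg] in \<open>simp add: lin_comb_def\<close>)
        have 2: "L2sq a b (dx A m k ?w J) \<le> (b - a) * ((inverse (2 * step A m))\<^sup>2 * (4 * (b - a)) * d n)"
        proof (rule const[OF H1_spaceD(2)[OF w J]])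
          fix y assume y: "y \<in> {a..b}"
          have "(norm (dx A m k ?w J y))\<^sup>2 = (inverse (2 * step A m))\<^sup>2 * (norm (?w (J + axis k 1) y - ?w (J - axis k 1) y))\<^sup>2"
            unfolding dx_def by (simp add: power_mult_distrib power_divide divide_simps)
          also have "\<dots> \<le> (inverse (2 * step A m))\<^sup>2 * (2 * (norm (?w (J + axis k 1) y))\<^sup>2 + 2 * (norm (?w (J - axis k 1) y))\<^sup>2)"
            using norm_add_sq_le[of "?w (J + axis k 1) y" "- ?w (J - axis k 1) y"] by (intro mult_left_mono) auto
          also have "\<dots> \<le> (inverse (2 * step A m))\<^sup>2 * (2 * ((b - a) * d n) + 2 * ((b - a) * d n))"
            using sup[OF neighbour_grid(1)[OF J] y] sup[OF neighbour_grid(2)[OF J] y]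
            by (intro mult_left_mono add_mono) (auto simp: lin_comb_def)
          finally show "(norm (dx A m k ?w J y))\<^sup>2 \<le> (inverse (2 * step A m))\<^sup>2 * (4 * (b - a)) * d n"
            by (simp add: mult_ac)
        qed
        obtain N1 where N1: "negligible N1" "\<And>y. y \<in> {a..b} - N1 \<Longrightarrow> dy ?w J y = 1 *\<^sub>R dy (v n) J y + (-1) *\<^sub>R dy g J y"
          by (rule dy_comb_ae[OF vH gH J, where s = 1 and t = "-1"]) blast
        obtain N2 where N2: "negligible N2" "\<And>y. y \<in> {a..b} - N2 \<Longrightarrow> dy g J y = u J y" using dyg[OF J] by blast
        have "L2sq a b (dy ?w J) = L2sq a b (\<lambda>y. dy (v n) J y - u J y)"
          by (rule integral_spike[OF negligible_Un[OF N1(1) N2(1)]]) (simp add: N1(2) N2(2))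
        with dJ[OF J] have 3: "L2sq a b (dy ?w J) \<le> d n" by simp
        show ?thesis using 1 2 3 unfolding c_def by (simp add: algebra_simps)
      qed
      then have "(H1_norm A a b m ?w)\<^sup>2 \<le> (\<Sum>J\<in>(inner_grid m :: (nat^'n) set). \<Sum>k\<in>(UNIV :: 'n set). c * d n)"
        unfolding H1_norm_sq_split[OF w] by (intro sum_mono)
      then show ?thesis by (simp add: C_def)
    qed
    have "(\<lambda>n. sqrt (C * d n)) \<longlonglongrightarrow> sqrt (C * 0)" by (intro tendsto_intros dlim)
    then have lim: "(\<lambda>n. sqrt (C * d n)) \<longlonglongrightarrow> 0" by simp
    show ?thesis
    proof (rule tendsto_sandwich[OF _ _ tendsto_const lim])
      show "\<forall>\<^sub>F n in sequentially. 0 \<le> H1_norm A a b m (lin_comb 1 (v n) (-1) g)"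
        using nrm_nonneg[OF H1_comb_closed[OF vH gH]] by (simp add: nrm_def H1_norm_inner)
      show "\<forall>\<^sub>F n in sequentially. H1_norm A a b m (lin_comb 1 (v n) (-1) g) \<le> sqrt (C * d n)"
        using bound by (intro always_eventually allI real_le_rsqrt)
    qed
  qed
  ultimately show ?thesis by blast
qed

lemma H10_Riesz:
  fixes l :: "('n::finite, 'N::finite) sdfun \<Rightarrow> real"
  assumes ab: "a < b"
    and l_comb: "\<And>f g s t. f \<in> H10_space A a b m \<Longrightarrow> g \<in> H10_space A a b m \<Longrightarrow> l (lin_comb s f t g) = s * l f + t * l g"
    and l_bound: "\<And>f. f \<in> H10_space A a b m \<Longrightarrow> \<bar>l f\<bar> \<le> M * H1_norm A a b m f"
  shows "\<exists>g\<in>H10_space A a b m. \<forall>v\<in>H10_space A a b m. H1_inner A a b m g v = l v"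
proof -
  interpret semi_inner_space "H10_space A a b m :: ('n, 'N) sdfun set" lin_comb "H1_inner A a b m" by (rule semi_inner_H10)
  have nrm: "nrm = H1_norm A a b m" by (rule ext) (simp add: nrm_def H1_norm_inner)
  have "(\<lambda>J y. 0) \<in> H10_space A a b m"
    by (simp add: H10_space_def H1_space_def bdry_eq_def square_integrable_def dx_def[abs_def] dy_def[abs_def])
  then have "H10_space A a b m \<noteq> ({} :: ('n, 'N) sdfun set)" by blast
  then show ?thesis
  proof (rule Riesz_representation[unfolded nrm])
    show "\<exists>g\<in>H10_space A a b m. (\<lambda>n. H1_norm A a b m (lin_comb 1 (v n) (-1) g)) \<longlonglongrightarrow> 0"
      if "\<And>n. v n \<in> H10_space A a b m"
        "\<And>e. e > 0 \<Longrightarrow> \<exists>M. \<forall>p\<ge>M. \<forall>q\<ge>M. H1_norm A a b m (lin_comb 1 (v p) (-1) (v q)) < e"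
      for v :: "nat \<Rightarrow> ('n, 'N) sdfun"
      using H10_complete[OF ab that] .
  qed (use l_comb l_bound in auto)
qed

section \<open>Second-order expansion of the functional\<close>

lemma power2_add3_le: "(p + q + r)\<^sup>2 \<le> 3 * (p\<^sup>2 + q\<^sup>2 + (r::real)\<^sup>2)"
  using zero_le_power2[of "p - q"] zero_le_power2[of "q - r"] zero_le_power2[of "p - r"]
  unfolding power2_diff by (simp add: power2_eq_square algebra_simps)

text \<open>Transfers pointwise quadratic estimates to norms. The exceptional null set in the
  premise makes room for identities that come from \<open>dy_comb_ae\<close>.\<close>

lemma H1_dominated:
  fixes V :: "('n::finite, 'N::finite) sdfun" and f :: "nat^'n \<Rightarrow> real \<Rightarrow> 'v::euclidean_space"
  assumes V: "V \<in> H1_space A a b m" and C: "0 \<le> C"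
    and f: "\<And>J. J \<in> inner_grid m \<Longrightarrow> \<exists>N. negligible N \<and> (\<forall>y\<in>{a..b} - N. (norm (f J y))\<^sup>2 \<le>
       C * ((norm (V J y))\<^sup>2 + (\<Sum>k\<in>UNIV. (norm (dx A m k V J y))\<^sup>2) + (norm (dy V J y))\<^sup>2))"
  shows "(\<Sum>J\<in>inner_grid m. L2sq a b (f J)) \<le> C * (H1_norm A a b m V)\<^sup>2"
proof -
  have "L2sq a b (f J) \<le> C * (L2sq a b (V J)
     + (\<Sum>k\<in>UNIV. L2sq a b (dx A m k V J)) + L2sq a b (dy V J))"
    if J: "J \<in> inner_grid m" for J
  proof -
    note v = H1_spaceD(1-3)[OF V J, THEN square_integrable_norm2_integrable_on]
    let ?g = "\<lambda>y. C * ((norm (V J y))\<^sup>2 + (\<Sum>k\<in>UNIV. (norm (dx A m k V J y))\<^sup>2) + (norm (dy V J y))\<^sup>2)"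
    have gi: "(?g has_integral C * (L2sq a b (V J)
     + (\<Sum>k\<in>UNIV. L2sq a b (dx A m k V J)) + L2sq a b (dy V J))) {a..b}"
      by (intro has_integral_mult_right has_integral_add has_integral_sum integrable_integral v finite)
    show ?thesis
    proof (cases "(\<lambda>y. (norm (f J y))\<^sup>2) integrable_on {a..b}")
      case True
      obtain N where N: "negligible N" "\<And>y. y\<in>{a..b} - N \<Longrightarrow> (norm (f J y))\<^sup>2 \<le> ?g y" using f[OF J] by blast
      \<comment> \<open>Setting the integrand to 0 on N makes the comparison valid at every point
        without changing the integral.\<close>
      define f' where "f' y = (if y \<in> N then 0 else (norm (f J y))\<^sup>2)" for y
      have "(f' has_integral L2sq a b (f J)) {a..b}"
        by (rule has_integral_spike[OF N(1) _ integrable_integral[OF True]]) (simp add: f'_def)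
      then show ?thesis
      proof (rule has_integral_le[OF _ gi])
        fix y assume "y \<in> {a..b}"
        moreover have "0 \<le> ?g y" by (intro mult_nonneg_nonneg C add_nonneg_nonneg sum_nonneg zero_le_power2)
        ultimately show "f' y \<le> ?g y" using N(2) by (simp add: f'_def)
      qed
    next
      \<comment> \<open>A non-integrable function has integral 0 by convention, which lies below the
        nonnegative right-hand side.\<close>
      case False
      then have "L2sq a b (f J) = 0" by (rule not_integrable_integral)
      then show ?thesis
        by (simp only:) (intro mult_nonneg_nonneg C add_nonneg_nonneg sum_nonneg integral_sq_nonneg)
    qed
  qed
  then have "(\<Sum>J\<in>inner_grid m. L2sq a b (f J)) \<le>
     (\<Sum>J\<in>inner_grid m. C * (L2sq a b (V J)
     + (\<Sum>k\<in>UNIV. L2sq a b (dx A m k V J)) + L2sq a b (dy V J)))"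
    by (rule sum_mono)
  also have "\<dots> \<le> C * (H1_norm A a b m V)\<^sup>2"
    unfolding sum_distrib_left[symmetric] by (intro mult_left_mono H1_norm_sq_ge[OF V] C)
  finally show ?thesis .
qed

text \<open>The factor 3 comes from squaring a sum of three terms and \<open>CARD('n)\<close> from
  Cauchy-Schwarz over the directions; the term with u is enlarged by the same cardinality to obtain
  one common factor. Serves both the linearized residual and the reconstruction formula.\<close>

lemma norm_linear_part_le:
  fixes u w :: "'v::real_normed_vector" and v :: "'n::finite \<Rightarrow> 'v"
  assumes "norm p \<le> B * norm u" "\<And>i. norm (q i) \<le> B * norm (v i)" "norm r \<le> C * norm w" "0 \<le> B" "0 \<le> C"
  shows "(norm (p + (\<Sum>i\<in>UNIV. q i) + r))\<^sup>2 \<le>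
    3 * (B\<^sup>2 * real CARD('n) + C\<^sup>2) * ((norm w)\<^sup>2 + (\<Sum>i\<in>UNIV. (norm (v i))\<^sup>2) + (norm u)\<^sup>2)"
proof -
  let ?n = "real CARD('n)"
  have n1: "1 \<le> ?n" by simp
  have "norm (p + (\<Sum>i\<in>UNIV. q i) + r) \<le> norm p + norm (\<Sum>i\<in>UNIV. q i) + norm r"
    by (meson add_mono_thms_linordered_semiring(3) norm_triangle_ineq order_trans)
  also have "\<dots> \<le> B * norm u + B * (\<Sum>i\<in>UNIV. norm (v i)) + C * norm w"
    unfolding sum_distrib_left using assms by (intro add_mono order_trans[OF norm_sum] sum_mono) auto
  finally have "(norm (p + (\<Sum>i\<in>UNIV. q i) + r))\<^sup>2 \<le> (B * norm u + B * (\<Sum>i\<in>UNIV. norm (v i)) + C * norm w)\<^sup>2"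
    by (intro power_mono) auto
  also have "\<dots> \<le> 3 * ((B * norm u)\<^sup>2 + (B * (\<Sum>i\<in>UNIV. norm (v i)))\<^sup>2 + (C * norm w)\<^sup>2)"
    by (rule power2_add3_le)
  also have "\<dots> \<le> 3 * (B\<^sup>2 * ?n * (norm u)\<^sup>2 + B\<^sup>2 * ?n * (\<Sum>i\<in>UNIV. (norm (v i))\<^sup>2) + C\<^sup>2 * (norm w)\<^sup>2)"
  proof -
    have "(\<Sum>i\<in>UNIV. norm (v i))\<^sup>2 \<le> (\<Sum>i\<in>UNIV. (norm (v i))\<^sup>2) * ?n"
      using sum_squared_le_sum_of_squares[of "\<lambda>i. norm (v i)" "UNIV :: 'n set"] by simp
    then have "B\<^sup>2 * (\<Sum>i\<in>UNIV. norm (v i))\<^sup>2 \<le> B\<^sup>2 * ?n * (\<Sum>i\<in>UNIV. (norm (v i))\<^sup>2)"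
      using mult_left_mono[of _ _ "B\<^sup>2"] by (fastforce simp: mult_ac)
    moreover have "B\<^sup>2 * (norm u)\<^sup>2 \<le> B\<^sup>2 * ?n * (norm u)\<^sup>2"
    proof -
      have "B\<^sup>2 * 1 * (norm u)\<^sup>2 \<le> B\<^sup>2 * ?n * (norm u)\<^sup>2"
        by (intro mult_right_mono mult_left_mono n1) auto
      then show ?thesis by simp
    qed
    ultimately show ?thesis by (simp add: power_mult_distrib)
  qed
  also have "\<dots> \<le> 3 * (B\<^sup>2 * ?n + C\<^sup>2) * ((norm w)\<^sup>2 + (\<Sum>i\<in>UNIV. (norm (v i))\<^sup>2) + (norm u)\<^sup>2)"
  proof -
    define S where "S = (\<Sum>i\<in>UNIV. (norm (v i))\<^sup>2)"
    have "0 \<le> S" unfolding S_def by (intro sum_nonneg) auto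
    then have "0 \<le> C\<^sup>2 * (norm u)\<^sup>2 + C\<^sup>2 * S + B\<^sup>2 * ?n * (norm w)\<^sup>2"
      by (intro add_nonneg_nonneg mult_nonneg_nonneg) auto
    then show ?thesis unfolding S_def[symmetric] by (simp add: algebra_simps)
  qed
  finally show ?thesis .
qed

text \<open>Residuals carry no derivative of their own, so Cauchy-Schwarz for the derivative of the
  functional takes place in this second instance of \<open>semi_inner_space\<close>.\<close>

definition L2_family :: "real \<Rightarrow> real \<Rightarrow> nat \<Rightarrow> ('n::finite, 'N::finite) sdfun set" where
  "L2_family a b m = {f. \<forall>J\<in>inner_grid m. square_integrable a b (f J)}"

definition L2_family_inner :: "real \<Rightarrow> real \<Rightarrow> nat \<Rightarrow> ('n::finite, 'N::finite) sdfun \<Rightarrow> ('n, 'N) sdfun \<Rightarrow> real" where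
  "L2_family_inner a b m f g = (\<Sum>J\<in>inner_grid m. L2_inner a b (f J) (g J))"

lemma semi_inner_L2: "semi_inner_space (L2_family a b m) lin_comb (L2_family_inner a b m)"
proof
  fix f g h :: "('n::finite, 'N::finite) sdfun" and s t
  assume f: "f \<in> L2_family a b m" and g: "g \<in> L2_family a b m"
  show "lin_comb s f t g \<in> L2_family a b m"
    using f g by (auto simp: L2_family_def lin_comb_def intro: square_integrable_comb)
  show "L2_family_inner a b m f g = L2_family_inner a b m g f"
    by (simp add: L2_family_inner_def L2_inner_def inner_commute)
  show "0 \<le> L2_family_inner a b m f f"
    unfolding L2_family_inner_def L2_inner_def power2_norm_eq_inner[symmetric]
    by (intro sum_nonneg integral_sq_nonneg)
  assume h: "h \<in> L2_family a b m"
  show "L2_family_inner a b m (lin_comb s f t g) h = s * L2_family_inner a b m f h + t * L2_family_inner a b m g h"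
    unfolding L2_family_inner_def sum_distrib_left sum.distrib[symmetric]
    using f g h by (intro sum.cong refl L2_inner_comb[where N = "{}"]) (auto simp: L2_family_def lin_comb_def)
qed

lemma matrix_vector_continuous:
  "continuous_on UNIV (\<lambda>x :: (real^'n^'m) \<times> (real^'n). fst x *v snd x)"
  unfolding matrix_vector_mult_def by (intro continuous_intros)

lemma continuous_on_matrix_vector:
  assumes "continuous_on S f" "continuous_on S g"
  shows "continuous_on S (\<lambda>x. (f x :: real^'n^'m) *v g x)"
  using continuous_on_compose2[OF matrix_vector_continuous continuous_on_Pair[OF assms]] by simp

lemma square_integrable_matrix_vector:
  fixes M :: "real \<Rightarrow> real^'n^'m"
  assumes M: "continuous_on {a..b} M" and v: "square_integrable a b v"
    and bd: "\<And>y u. y \<in> {a..b} \<Longrightarrow> norm (M y *v u) \<le> C * norm u"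
  shows "square_integrable a b (\<lambda>y. M y *v v y)"
proof (rule square_integrable_bound)
  have [measurable]: "M \<in> borel_measurable (lebesgue_on {a..b})"
    by (rule continuous_imp_measurable_on_sets_lebesgue[OF M]) simp
  note [measurable] = square_integrable_measurable[OF v]
  show "(\<lambda>y. M y *v v y) \<in> borel_measurable (lebesgue_on {a..b})"
    by (rule borel_measurable_continuous_Pair[OF _ _ matrix_vector_continuous]) measurable
  show "integrable (lebesgue_on {a..b}) (\<lambda>y. C\<^sup>2 * (norm (v y))\<^sup>2)"
    by (intro integrable_mult_right square_integrable_integrable_norm2[OF v])
  show "(norm (M y *v v y))\<^sup>2 \<le> C\<^sup>2 * (norm (v y))\<^sup>2" if "y \<in> {a..b}" for y
    using power_mono[OF bd[OF that, of "v y"], of 2] by (simp add: power_mult_distrib)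
qed

lemma square_integrable_add:
  fixes f g :: "real \<Rightarrow> 'v::euclidean_space"
  assumes "square_integrable a b f" "square_integrable a b g"
  shows "square_integrable a b (\<lambda>y. f y + g y)"
  using square_integrable_comb[OF assms, of 1 1] by simp

lemma square_integrable_sum:
  fixes f :: "'i \<Rightarrow> real \<Rightarrow> 'v::euclidean_space"
  assumes "finite I" "\<And>i. i \<in> I \<Longrightarrow> square_integrable a b (f i)"
  shows "square_integrable a b (\<lambda>y. \<Sum>i\<in>I. f i y)"
  using assms
proof (induction I rule: finite_induct)
  case empty
  show ?case using continuous_imp_square_integrable[of a b "\<lambda>y. 0"] by simp
next
  case (insert i I)
  then show ?case using square_integrable_add[of a b "f i" "\<lambda>y. \<Sum>i\<in>I. f i y"] by simp
qed

lemma square_integrable_weight: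
  fixes f :: "real \<Rightarrow> 'v::euclidean_space"
  assumes w: "continuous_on {a..b} w" and f: "square_integrable a b f"
    and bd: "\<And>y. y \<in> {a..b} \<Longrightarrow> \<bar>w y\<bar> \<le> C"
  shows "square_integrable a b (\<lambda>y. w y *\<^sub>R f y)"
proof (rule square_integrable_bound)
  have [measurable]: "w \<in> borel_measurable (lebesgue_on {a..b})"
    by (rule continuous_imp_measurable_on_sets_lebesgue[OF w]) simp
  note [measurable] = square_integrable_measurable[OF f]
  show "(\<lambda>y. w y *\<^sub>R f y) \<in> borel_measurable (lebesgue_on {a..b})" by measurable
  show "integrable (lebesgue_on {a..b}) (\<lambda>y. C\<^sup>2 * (norm (f y))\<^sup>2)"
    by (intro integrable_mult_right square_integrable_integrable_norm2[OF f])
  show "(norm (w y *\<^sub>R f y))\<^sup>2 \<le> C\<^sup>2 * (norm (f y))\<^sup>2" if "y \<in> {a..b}" for y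
    using power_mono[OF bd[OF that], of 2] by (auto simp: power_mult_distrib intro: mult_right_mono)
qed

lemma L2_norm_sq:
  "(L2_norm a b m f)\<^sup>2 = (\<Sum>J\<in>inner_grid m. L2sq a b (f J))"
  unfolding L2_norm_def by (intro real_sqrt_pow2 sum_nonneg integral_sq_nonneg)

text \<open>Isolates what the gradient argument uses of the coefficients. Here \<open>\<rho>\<close>
  bounds values of W, not its H1 norm, and the expansion of \<open>Fc\<close> covers base point and
  increment both up to \<open>\<rho>\<close>. Continuity of \<open>Fc\<close> is asked along
  continuous curves, which is how H1 functions enter it.\<close>

locale sd_functional =
  fixes A a b lam B \<rho> CF :: real and m :: nat
    and Dc :: "nat^'n::finite \<Rightarrow> real \<Rightarrow> real^'N::finite^'N"
    and Ac :: "'n \<Rightarrow> nat^'n \<Rightarrow> real \<Rightarrow> real^'N^'N"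
    and Fc :: "nat^'n \<Rightarrow> real \<Rightarrow> real^'N \<Rightarrow> real^'N"
    and DFc :: "nat^'n \<Rightarrow> real \<Rightarrow> real^'N \<Rightarrow> real^'N^'N"
  assumes ab: "a < b" and lam0: "0 \<le> lam" and B0: "0 \<le> B" and CF0: "0 \<le> CF" and \<rho>0: "0 < \<rho>"
    and Dc_cont: "J \<in> inner_grid m \<Longrightarrow> continuous_on {a..b} (Dc J)"
    and Ac_cont: "J \<in> inner_grid m \<Longrightarrow> continuous_on {a..b} (Ac i J)"
    and Fc_cont: "J \<in> inner_grid m \<Longrightarrow> continuous_on {a..b} w \<Longrightarrow> continuous_on {a..b} (\<lambda>y. Fc J y (w y))"
    and DFc_cont: "J \<in> inner_grid m \<Longrightarrow> continuous_on {a..b} w \<Longrightarrow> continuous_on {a..b} (\<lambda>y. DFc J y (w y))"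
    and Dc_bound: "J \<in> inner_grid m \<Longrightarrow> y \<in> {a..b} \<Longrightarrow> norm (Dc J y *v v) \<le> B * norm v"
    and Ac_bound: "J \<in> inner_grid m \<Longrightarrow> y \<in> {a..b} \<Longrightarrow> norm (Ac i J y *v v) \<le> B * norm v"
    and Fc_bound: "J \<in> inner_grid m \<Longrightarrow> y \<in> {a..b} \<Longrightarrow> norm (Fc J y 0) \<le> B"
    and DFc_bound: "J \<in> inner_grid m \<Longrightarrow> y \<in> {a..b} \<Longrightarrow> norm u \<le> \<rho> \<Longrightarrow> norm (DFc J y u *v v) \<le> CF * norm v"
    and Fc_taylor: "J \<in> inner_grid m \<Longrightarrow> y \<in> {a..b} \<Longrightarrow> norm u \<le> \<rho> \<Longrightarrow> norm v \<le> \<rho> \<Longrightarrow>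
        norm (Fc J y (u + v) - Fc J y u - DFc J y u *v v) \<le> CF * (norm v)\<^sup>2"
begin

abbreviation hnorm :: "('n, 'N) sdfun \<Rightarrow> real" where "hnorm \<equiv> H1_norm A a b m"

abbreviation hinner :: "('n, 'N) sdfun \<Rightarrow> ('n, 'N) sdfun \<Rightarrow> real" where "hinner \<equiv> H1_inner A a b m"

abbreviation H1 :: "('n, 'N) sdfun set" where "H1 \<equiv> H1_space A a b m"

abbreviation H10 :: "('n, 'N) sdfun set" where "H10 \<equiv> H10_space A a b m"

abbreviation closed_ball :: "real \<Rightarrow> ('n, 'N) sdfun \<Rightarrow> ('n, 'N) sdfun set" where
  "closed_ball \<equiv> B_closed A a b m"

definition res :: "('n, 'N) sdfun \<Rightarrow> ('n, 'N) sdfun" where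
  "res W J y = Dc J y *v dy W J y + (\<Sum>i\<in>UNIV. Ac i J y *v dx A m i W J y) + Fc J y (W J y)"

definition lin_res :: "('n, 'N) sdfun \<Rightarrow> ('n, 'N) sdfun \<Rightarrow> ('n, 'N) sdfun" where
  "lin_res W V J y = Dc J y *v dy V J y + (\<Sum>i\<in>UNIV. Ac i J y *v dx A m i V J y) + DFc J y (W J y) *v V J y"

definition Jf :: "('n, 'N) sdfun \<Rightarrow> real" where
  "Jf W = (L2_norm a b m (\<lambda>J y. exp (lam * y) *\<^sub>R res W J y))\<^sup>2"

text \<open>The formal derivative of \<open>Jf\<close>: the weight enters squared, hence
  \<open>2 * lam\<close>, and the other factor 2 comes from the square of the residual.\<close>

definition dJ :: "('n, 'N) sdfun \<Rightarrow> ('n, 'N) sdfun \<Rightarrow> real" where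
  "dJ W V = L2_family_inner a b m (lin_res W V) (\<lambda>J y. (2 * exp (2 * lam * y)) *\<^sub>R res W J y)"

text \<open>The H1 radius whose ball the Sobolev embedding sends into values of norm at most
  \<open>\<rho>\<close>.\<close>

definition rad :: real where "rad = \<rho> / sobolev_const a b"

definition CT :: real where "CT = 3 * (B\<^sup>2 * real CARD('n) + CF\<^sup>2)"

text \<open>Bounds the squared residual: linear part plus nonlinear part. The
  \<open>0\<^sup>2\<close> is the zeroth-order slot of \<open>norm_linear_part_le\<close>, empty
  here; the node count arises because the bound on \<open>Fc\<close> is a constant integrated over
  every grid line.\<close>

definition CR :: real where
  "CR = 2 * (3 * (B\<^sup>2 * real CARD('n) + 0\<^sup>2)) * rad\<^sup>2
     + 2 * (real (card (inner_grid m :: (nat^'n) set)) * ((b - a) * (B + CF * \<rho> + CF * \<rho>\<^sup>2)\<^sup>2))"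

text \<open>The three groups stem from the product of residual and Taylor remainder, from the
  linearized residual and from the squared remainder. It contains the node count and may therefore
  influence only the step size.\<close>

definition CQ :: real where
  "CQ = exp (2 * lam * b) * (CF * (sobolev_const a b)\<^sup>2 * (real (card (inner_grid m :: (nat^'n) set)) * (b - a) + CR)
     + 2 * CT + 2 * CF\<^sup>2 * \<rho>\<^sup>2)"

definition CG :: real where "CG = sqrt CT * (2 * exp (2 * lam * b) * sqrt CR)"

lemma rad_pos: "0 < rad" using \<rho>0 sobolev_const_pos[OF ab] by (simp add: rad_def)

lemma CT_nonneg: "0 \<le> CT" by (simp add: CT_def)

lemma CR_nonneg: "0 \<le> CR" using ab by (simp add: CR_def)

lemma CQ_nonneg: "0 \<le> CQ"
  unfolding CQ_def using ab CF0 CR_nonneg CT_nonneg by (intro mult_nonneg_nonneg add_nonneg_nonneg) auto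

lemma CG_nonneg: "0 \<le> CG" unfolding CG_def using CT_nonneg CR_nonneg by simp

lemma weight_le: "y \<in> {a..b} \<Longrightarrow> exp (2 * lam * y) \<le> exp (2 * lam * b)"
  using lam0 by (simp add: mult_left_mono)

interpretation H: semi_inner_space "H1 :: ('n, 'N) sdfun set" lin_comb "hinner"
  by (rule semi_inner_H1)

interpretation L: semi_inner_space "L2_family a b m :: ('n, 'N) sdfun set" lin_comb "L2_family_inner a b m"
  by (rule semi_inner_L2)

lemma H1_norm_nonneg: "Q \<in> H1 \<Longrightarrow> 0 \<le> hnorm (Q :: ('n, 'N) sdfun)"
  using H.nrm_nonneg by (simp add: H.nrm_def H1_norm_inner)

lemma sup_le:
  assumes Q: "Q \<in> H1" "hnorm Q \<le> rad" "J \<in> inner_grid m" "y \<in> {a..b}"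
  shows "norm (Q J y :: real^'N) \<le> \<rho>"
proof -
  have "norm (Q J y) \<le> sobolev_const a b * hnorm Q" by (rule H1_sup_bound[OF ab Q(1,3,4)])
  also have "\<dots> \<le> sobolev_const a b * rad" using Q(2) sobolev_const_pos[OF ab] by (intro mult_left_mono) auto
  also have "\<dots> = \<rho>" using sobolev_const_pos[OF ab] by (simp add: rad_def)
  finally show ?thesis .
qed

lemma principal_square_integrable:
  assumes V: "V \<in> H1" and J: "J \<in> inner_grid m"
  shows "square_integrable a b (\<lambda>y. Dc J y *v dy V J y + (\<Sum>i\<in>UNIV. Ac i J y *v dx A m i V J y))"
  by (intro square_integrable_add square_integrable_sum finite
      square_integrable_matrix_vector[OF Dc_cont[OF J] H1_spaceD(3)[OF V J] Dc_bound[OF J]]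
      square_integrable_matrix_vector[OF Ac_cont[OF J] H1_spaceD(2)[OF V J] Ac_bound[OF J]])

lemma res_square_integrable:
  assumes W: "W \<in> H1" and J: "J \<in> inner_grid m"
  shows "square_integrable a b (res W J)"
  unfolding res_def[abs_def]
  by (intro square_integrable_add principal_square_integrable W J
      continuous_imp_square_integrable Fc_cont H1_continuous[OF W J])

lemma lin_res_square_integrable:
  assumes W: "W \<in> H1" and V: "V \<in> H1" and J: "J \<in> inner_grid m"
  shows "square_integrable a b (lin_res W V J)"
  unfolding lin_res_def[abs_def]
  by (intro square_integrable_add principal_square_integrable V J
      continuous_imp_square_integrable continuous_on_matrix_vector DFc_cont H1_continuous[OF W J] H1_continuous[OF V J])

lemma lin_res_norm_le:
  assumes W: "W \<in> H1" "hnorm W \<le> rad" and J: "J \<in> inner_grid m" and y: "y \<in> {a..b}"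
  shows "(norm (lin_res W V J y))\<^sup>2 \<le> CT * ((norm (V J y))\<^sup>2 + (\<Sum>k\<in>UNIV. (norm (dx A m k V J y))\<^sup>2) + (norm (dy V J y))\<^sup>2)"
  unfolding lin_res_def CT_def
  by (intro norm_linear_part_le Dc_bound Ac_bound DFc_bound sup_le W J y B0 CF0)

lemma Fc_norm_le:
  assumes J: "J \<in> inner_grid m" and y: "y \<in> {a..b}" and w: "norm w \<le> \<rho>"
  shows "norm (Fc J y w) \<le> B + CF * \<rho> + CF * \<rho>\<^sup>2"
proof -
  have "norm (Fc J y w) \<le> norm (Fc J y 0) + norm (DFc J y 0 *v w) + norm (Fc J y (0 + w) - Fc J y 0 - DFc J y 0 *v w)"
    using norm_triangle_ineq[of "Fc J y 0 + DFc J y 0 *v w" "Fc J y (0 + w) - Fc J y 0 - DFc J y 0 *v w"]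
      norm_triangle_ineq[of "Fc J y 0" "DFc J y 0 *v w"] by simp
  also have "\<dots> \<le> B + CF * norm w + CF * (norm w)\<^sup>2"
    using \<rho>0 by (intro add_mono Fc_bound DFc_bound Fc_taylor J y w) auto
  also have "\<dots> \<le> B + CF * \<rho> + CF * \<rho>\<^sup>2"
    using w CF0 by (intro add_mono mult_left_mono power_mono) auto
  finally show ?thesis .
qed

lemma res_norm_le:
  assumes W: "W \<in> H1" "hnorm W \<le> rad"
  shows "(\<Sum>J\<in>inner_grid m. L2sq a b (res W J)) \<le> CR"
proof -
  let ?p = "\<lambda>J y. Dc J y *v dy W J y + (\<Sum>i\<in>UNIV. Ac i J y *v dx A m i W J y)"
  let ?c = "(B + CF * \<rho> + CF * \<rho>\<^sup>2)\<^sup>2"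
  let ?C = "3 * (B\<^sup>2 * real CARD('n) + 0\<^sup>2)"
  have "L2sq a b (res W J) \<le> 2 * L2sq a b (?p J) + 2 * ((b - a) * ?c)"
    if J: "J \<in> inner_grid m" for J
  proof -
    have i: "((\<lambda>y. 2 * (norm (?p J y))\<^sup>2 + 2 * ?c) has_integral
       2 * L2sq a b (?p J) + (b - a) *\<^sub>R (2 * ?c)) {a..b}"
      using has_integral_const_real[of "2 * ?c" a b] ab
      by (intro has_integral_add has_integral_mult_right integrable_integral
          square_integrable_norm2_integrable_on principal_square_integrable W J) auto
    have "L2sq a b (res W J) \<le> 2 * L2sq a b (?p J) + (b - a) *\<^sub>R (2 * ?c)"
    proof (rule has_integral_le[OF integrable_integral[OF square_integrable_norm2_integrable_on[OF res_square_integrable[OF W(1) J]]] i])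
      fix y assume y: "y \<in> {a..b}"
      have "(norm (res W J y))\<^sup>2 \<le> 2 * (norm (?p J y))\<^sup>2 + 2 * (norm (Fc J y (W J y)))\<^sup>2"
        unfolding res_def by (rule norm_add_sq_le)
      moreover have "(norm (Fc J y (W J y)))\<^sup>2 \<le> ?c"
        by (intro power_mono Fc_norm_le J y sup_le W) auto
      ultimately show "(norm (res W J y))\<^sup>2 \<le> 2 * (norm (?p J y))\<^sup>2 + 2 * ?c" by linarith
    qed
    then show ?thesis by simp
  qed
  then have "(\<Sum>J\<in>inner_grid m. L2sq a b (res W J)) \<le>
    (\<Sum>J\<in>inner_grid m. 2 * L2sq a b (?p J) + 2 * ((b - a) * ?c))"
    by (rule sum_mono)
  also have "\<dots> = 2 * (\<Sum>J\<in>inner_grid m. L2sq a b (?p J))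
      + 2 * (real (card (inner_grid m :: (nat^'n) set)) * ((b - a) * ?c))"
    by (simp add: sum.distrib sum_distrib_left)
  also have "(\<Sum>J\<in>inner_grid m. L2sq a b (?p J)) \<le> ?C * (hnorm W)\<^sup>2"
  proof (rule H1_dominated[OF W(1)])
    fix J :: "nat^'n" assume J: "J \<in> inner_grid m"
    have "(norm (?p J y + 0))\<^sup>2 \<le> ?C * ((norm (W J y))\<^sup>2 + (\<Sum>k\<in>UNIV. (norm (dx A m k W J y))\<^sup>2) + (norm (dy W J y))\<^sup>2)"
      if y: "y \<in> {a..b}" for y
      by (rule norm_linear_part_le) (use Dc_bound[OF J y] Ac_bound[OF J y] B0 in auto)
    then show "\<exists>N. negligible N \<and> (\<forall>y\<in>{a..b} - N. (norm (?p J y))\<^sup>2 \<le>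
        ?C * ((norm (W J y))\<^sup>2 + (\<Sum>k\<in>UNIV. (norm (dx A m k W J y))\<^sup>2) + (norm (dy W J y))\<^sup>2))"
      by (intro exI[of _ "{}"]) simp
  qed simp
  also have "?C * (hnorm W)\<^sup>2 \<le> ?C * rad\<^sup>2"
    using W H1_norm_nonneg[OF W(1)] by (intro mult_left_mono power_mono) auto
  finally show ?thesis unfolding CR_def by simp
qed

lemma dJ_comb:
  assumes W: "W \<in> H1" and f: "f \<in> H1" and g: "g \<in> H1"
  shows "dJ W (lin_comb s f t g) = s * dJ W f + t * dJ W g"
  unfolding dJ_def L2_family_inner_def sum_distrib_left sum.distrib[symmetric]
proof (rule sum.cong[OF refl])
  fix J :: "nat^'n" assume J: "J \<in> inner_grid m"
  obtain N where N: "negligible N" "\<And>y. y \<in> {a..b} - N \<Longrightarrow> dy (lin_comb s f t g) J y = s *\<^sub>R dy f J y + t *\<^sub>R dy g J y"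
    by (rule dy_comb_ae[OF f g J, where s = s and t = t]) blast
  have "lin_res W (lin_comb s f t g) J y = s *\<^sub>R lin_res W f J y + t *\<^sub>R lin_res W g J y" if "y \<in> {a..b} - N" for y
    unfolding lin_res_def N(2)[OF that] dx_comb
    by (simp add: lin_comb_def matrix_vector_right_distrib matrix_vector_mult_scaleR sum.distrib scaleR_sum_right algebra_simps)
  moreover have "square_integrable a b (\<lambda>y. (2 * exp (2 * lam * y)) *\<^sub>R res W J y)"
    by (rule square_integrable_weight[OF _ res_square_integrable[OF W J], where C = "2 * exp (2 * lam * b)"])
       (use weight_le in \<open>auto intro!: continuous_intros\<close>)
  ultimately show "L2_inner a b (lin_res W (lin_comb s f t g) J) (\<lambda>y. (2 * exp (2 * lam * y)) *\<^sub>R res W J y) =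
     s * L2_inner a b (lin_res W f J) (\<lambda>y. (2 * exp (2 * lam * y)) *\<^sub>R res W J y) +
     t * L2_inner a b (lin_res W g J) (\<lambda>y. (2 * exp (2 * lam * y)) *\<^sub>R res W J y)"
    by (intro L2_inner_comb[OF lin_res_square_integrable[OF W f J] lin_res_square_integrable[OF W g J] _ N(1)])
qed

lemma dJ_bound:
  assumes W: "W \<in> H1" "hnorm W \<le> rad" and V: "V \<in> H1"
  shows "\<bar>dJ W V\<bar> \<le> CG * hnorm V"
proof -
  let ?g = "\<lambda>J y. (2 * exp (2 * lam * y)) *\<^sub>R res W J y"
  have T: "lin_res W V \<in> L2_family a b m"
    using lin_res_square_integrable[OF W(1) V] by (simp add: L2_family_def)
  have gs: "square_integrable a b (?g J)" if "J \<in> inner_grid m" for J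
    by (rule square_integrable_weight[OF _ res_square_integrable[OF W(1) that], where C = "2 * exp (2 * lam * b)"])
       (use weight_le in \<open>auto intro!: continuous_intros\<close>)
  then have g: "?g \<in> L2_family a b m" by (simp add: L2_family_def)
  have "L.nrm (lin_res W V) \<le> sqrt (CT * (hnorm V)\<^sup>2)"
    unfolding L.nrm_def L2_family_inner_def L2_inner_def power2_norm_eq_inner[symmetric]
    using lin_res_norm_le[OF W]
    by (intro real_sqrt_le_mono H1_dominated[OF V CT_nonneg] exI[of _ "{}"]) auto
  also have "\<dots> = sqrt CT * hnorm V" using H1_norm_nonneg[OF V] by (simp add: real_sqrt_mult)
  finally have 1: "L.nrm (lin_res W V) \<le> sqrt CT * hnorm V" .
  have "L2_family_inner a b m ?g ?g \<le> (2 * exp (2 * lam * b))\<^sup>2 * CR"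
  proof -
    have "L2sq a b (?g J) \<le> (2 * exp (2 * lam * b))\<^sup>2 * L2sq a b (res W J)"
      if J: "J \<in> inner_grid m" for J
      unfolding integral_mult_right[symmetric]
    proof (intro integral_le integrable_on_mult_right square_integrable_norm2_integrable_on gs res_square_integrable W J)
      fix y assume "y \<in> {a..b}"
      then have "(2 * exp (2 * lam * y))\<^sup>2 \<le> (2 * exp (2 * lam * b))\<^sup>2" using weight_le by (intro power_mono) auto
      then show "(norm (?g J y))\<^sup>2 \<le> (2 * exp (2 * lam * b))\<^sup>2 * (norm (res W J y))\<^sup>2"
        unfolding norm_scaleR power_mult_distrib power2_abs by (intro mult_right_mono) auto
    qed
    then have "L2_family_inner a b m ?g ?g \<le> (\<Sum>J\<in>inner_grid m. (2 * exp (2 * lam * b))\<^sup>2 * L2sq a b (res W J))"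
      unfolding L2_family_inner_def L2_inner_def power2_norm_eq_inner[symmetric] by (rule sum_mono)
    also have "\<dots> \<le> (2 * exp (2 * lam * b))\<^sup>2 * CR"
      unfolding sum_distrib_left[symmetric] by (intro mult_left_mono res_norm_le W) auto
    finally show ?thesis .
  qed
  then have "L.nrm ?g \<le> sqrt ((2 * exp (2 * lam * b))\<^sup>2 * CR)"
    unfolding L.nrm_def by (rule real_sqrt_le_mono)
  then have 2: "L.nrm ?g \<le> 2 * exp (2 * lam * b) * sqrt CR" by (simp add: real_sqrt_mult)
  have "\<bar>dJ W V\<bar> \<le> L.nrm (lin_res W V) * L.nrm ?g" unfolding dJ_def by (rule L.Cauchy_Schwarz[OF T g])
  also have "\<dots> \<le> (sqrt CT * hnorm V) * (2 * exp (2 * lam * b) * sqrt CR)"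
    using 1 2 L.nrm_nonneg[OF g] CT_nonneg H1_norm_nonneg[OF V] by (intro mult_mono) auto
  finally show ?thesis by (simp add: CG_def mult_ac)
qed

lemma Jf_eq: "Jf W = (\<Sum>J\<in>inner_grid m. integral {a..b} (\<lambda>y. exp (2 * lam * y) * (norm (res W J y))\<^sup>2))"
  unfolding Jf_def L2_norm_sq by (simp add: power_mult_distrib exp_double[symmetric] mult.assoc)

text \<open>The differential operators are linear off a null set, so r is the Taylor remainder of
  \<open>Fc\<close> alone and is bounded without derivatives of V.\<close>

lemma res_taylor:
  assumes W: "W \<in> H1" "hnorm W \<le> rad"
    and V: "V \<in> H1" "hnorm V \<le> rad" and J: "J \<in> inner_grid m"
  obtains N where "negligible N" "\<And>y. y \<in> {a..b} - N \<Longrightarrow>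
    \<exists>r. norm r \<le> CF * (norm (V J y))\<^sup>2 \<and> res (lin_comb 1 W 1 V) J y = res W J y + (lin_res W V J y + r)"
proof -
  let ?U = "lin_comb 1 W 1 V"
  obtain N where N: "negligible N" "\<And>y. y \<in> {a..b} - N \<Longrightarrow> dy ?U J y = 1 *\<^sub>R dy W J y + 1 *\<^sub>R dy V J y"
    by (rule dy_comb_ae[OF W(1) V(1) J, where s = 1 and t = 1]) blast
  show thesis
  proof (rule that[OF N(1)])
    fix y assume y: "y \<in> {a..b} - N"
    then have y': "y \<in> {a..b}" by simp
    define r where "r = Fc J y (W J y + V J y) - Fc J y (W J y) - DFc J y (W J y) *v V J y"
    have "norm r \<le> CF * (norm (V J y))\<^sup>2"
      unfolding r_def by (intro Fc_taylor J y' sup_le W V)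
    moreover have "res ?U J y = res W J y + (lin_res W V J y + r)"
      unfolding res_def lin_res_def N(2)[OF y] dx_comb r_def
      by (simp add: lin_comb_def matrix_vector_right_distrib sum.distrib)
    ultimately show "\<exists>r. norm r \<le> CF * (norm (V J y))\<^sup>2 \<and> res ?U J y = res W J y + (lin_res W V J y + r)" by blast
  qed
qed

text \<open>One factor |v| of the quadratic remainder is traded for \<rho>, so that its square is
  bounded by |v|^2 and fits \<open>H1_dominated\<close>.\<close>

lemma lin_res_remainder_le:
  assumes "norm r \<le> CF * (norm v)\<^sup>2" "norm v \<le> \<rho>"
  shows "(norm (u + r))\<^sup>2 \<le> 2 * (norm u)\<^sup>2 + 2 * CF\<^sup>2 * \<rho>\<^sup>2 * (norm v)\<^sup>2"
proof -
  have "norm r \<le> CF * (\<rho> * norm v)"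
    using assms(1) mult_left_mono[OF mult_right_mono[OF assms(2), of "norm v"] CF0] by (simp add: power2_eq_square)
  then have "(norm r)\<^sup>2 \<le> (CF * (\<rho> * norm v))\<^sup>2" by (intro power_mono) auto
  then have "(norm r)\<^sup>2 \<le> CF\<^sup>2 * \<rho>\<^sup>2 * (norm v)\<^sup>2" by (simp add: power_mult_distrib)
  then show ?thesis using norm_add_sq_le[of u r] by linarith
qed

text \<open>With the Taylor remainder r of \<open>res_taylor\<close>, the error has the integrand
  \<open>exp (2 * lam * y)\<close> times 2 \<open>res\<close> \<bullet> r + |\<open>lin_res\<close>
  + r|^2. The residual is merely square integrable, so the first term is controlled by the supremum
  of |V|^2 together with 2 |\<open>res\<close>| <= 1 + |\<open>res\<close>|^2; the second is
  quadratic in V in mean square.\<close>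

lemma Jf_taylor:
  assumes W: "W \<in> H1" "hnorm W \<le> rad"
    and V: "V \<in> H1" "hnorm V \<le> rad"
  shows "\<bar>Jf (lin_comb 1 W 1 V) - Jf W - dJ W V\<bar> \<le> CQ * (hnorm V)\<^sup>2"
proof -
  let ?U = "lin_comb 1 W 1 V" and ?nV = "hnorm V" and ?Q = "exp (2 * lam * b)"
  let ?e = "\<lambda>y. exp (2 * lam * y)" and ?S = "sobolev_const a b"
  have U: "?U \<in> H1" by (rule H1_comb_closed[OF W(1) V(1)])
  have wt: "(\<lambda>y. ?e y * (norm (f y))\<^sup>2) integrable_on {a..b}" if f: "square_integrable a b f" for f :: "real \<Rightarrow> real^'N"
  proof -
    have "square_integrable a b (\<lambda>y. exp (lam * y) *\<^sub>R f y)"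
      using lam0 by (intro square_integrable_weight[OF _ f, where C = "exp (lam * b)"] continuous_intros) (auto simp: mult_left_mono)
    from square_integrable_norm2_integrable_on[OF this] show ?thesis
      by (simp add: power_mult_distrib exp_double[symmetric] mult.assoc)
  qed
  have J_est: "\<bar>integral {a..b} (\<lambda>y. ?e y * (norm (res ?U J y))\<^sup>2) - integral {a..b} (\<lambda>y. ?e y * (norm (res W J y))\<^sup>2)
      - L2_inner a b (lin_res W V J) (\<lambda>y. (2 * ?e y) *\<^sub>R res W J y)\<bar>
      \<le> ?Q * (CF * ?S\<^sup>2 * ?nV\<^sup>2 * ((b - a) + L2sq a b (res W J))
         + 2 * L2sq a b (lin_res W V J) + 2 * CF\<^sup>2 * \<rho>\<^sup>2 * L2sq a b (V J))"
    (is "\<bar>?l\<bar> \<le> ?r") if J: "J \<in> inner_grid m" for J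
  proof -
    note rU = res_square_integrable[OF U J] and rW = res_square_integrable[OF W(1) J]
      and tV = lin_res_square_integrable[OF W(1) V(1) J]
    have "square_integrable a b (\<lambda>y. (2 * ?e y) *\<^sub>R res W J y)"
      by (rule square_integrable_weight[OF _ rW, where C = "2 * exp (2 * lam * b)"])
         (use weight_le in \<open>auto intro!: continuous_intros\<close>)
    note ip = square_integrable_inner_integrable_on[OF tV this]
    obtain N where N: "negligible N" "\<And>y. y \<in> {a..b} - N \<Longrightarrow>
        \<exists>r. norm r \<le> CF * (norm (V J y))\<^sup>2 \<and> res ?U J y = res W J y + (lin_res W V J y + r)"
      by (rule res_taylor[OF W V J]) blast
    let ?X = "\<lambda>y. ?e y * (norm (res ?U J y))\<^sup>2 - ?e y * (norm (res W J y))\<^sup>2 - lin_res W V J y \<bullet> ((2 * ?e y) *\<^sub>R res W J y)"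
    let ?Y = "\<lambda>y. ?Q * (CF * ?S\<^sup>2 * ?nV\<^sup>2 * (1 + (norm (res W J y))\<^sup>2) + 2 * (norm (lin_res W V J y))\<^sup>2 + 2 * CF\<^sup>2 * \<rho>\<^sup>2 * (norm (V J y))\<^sup>2)"
    have X: "(?X has_integral ?l) {a..b}"
      unfolding L2_inner_def by (intro has_integral_diff integrable_integral wt rU rW ip)
    have one: "((\<lambda>y. 1::real) has_integral (b - a)) {a..b}"
      using has_integral_const_real[of "1::real" a b] ab by simp
    have Y: "(?Y has_integral ?r) {a..b}"
      by (intro has_integral_mult_right has_integral_add one integrable_integral square_integrable_norm2_integrable_on
            rW tV H1_spaceD(1)[OF V(1) J])
    have le: "\<bar>?X y\<bar> \<le> ?Y y" if y: "y \<in> {a..b} - N" for y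
    proof -
      have y': "y \<in> {a..b}" using y by simp
      obtain r where rb: "norm r \<le> CF * (norm (V J y))\<^sup>2" and eq: "res ?U J y = res W J y + (lin_res W V J y + r)"
        using N(2)[OF y] by blast
      have Xe: "?X y = ?e y * (2 * (res W J y \<bullet> r) + (norm (lin_res W V J y + r))\<^sup>2)"
        unfolding eq power2_norm_eq_inner by (simp add: inner_add_left inner_add_right inner_commute algebra_simps)
      have v1: "norm (V J y) \<le> ?S * ?nV" by (rule H1_sup_bound[OF ab V(1) J y'])
      have v2: "norm (V J y) \<le> \<rho>" by (rule sup_le[OF V J y'])
      have v1': "(norm (V J y))\<^sup>2 \<le> ?S\<^sup>2 * ?nV\<^sup>2"
        using power_mono[OF v1, of 2] by (simp add: power_mult_distrib)
      have a1: "\<bar>2 * (res W J y \<bullet> r)\<bar> \<le> CF * ?S\<^sup>2 * ?nV\<^sup>2 * (1 + (norm (res W J y))\<^sup>2)"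
      proof -
        have "\<bar>res W J y \<bullet> r\<bar> \<le> norm (res W J y) * norm r" by (rule Cauchy_Schwarz_ineq2)
        also have "\<dots> \<le> norm (res W J y) * (CF * (?S\<^sup>2 * ?nV\<^sup>2))"
          by (intro mult_left_mono order_trans[OF rb] v1' CF0) auto
        finally have "\<bar>2 * (res W J y \<bullet> r)\<bar> \<le> (CF * (?S\<^sup>2 * ?nV\<^sup>2)) * (2 * norm (res W J y))" by (simp add: mult_ac)
        also have "\<dots> \<le> (CF * (?S\<^sup>2 * ?nV\<^sup>2)) * (1 + (norm (res W J y))\<^sup>2)"
        proof (rule mult_left_mono)
          show "2 * norm (res W J y) \<le> 1 + (norm (res W J y))\<^sup>2"
            using zero_le_power2[of "norm (res W J y) - 1"] unfolding power2_diff by simp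
          show "0 \<le> CF * (?S\<^sup>2 * ?nV\<^sup>2)" using CF0 by simp
        qed
        finally show ?thesis by (simp add: mult_ac)
      qed
      have a2: "(norm (lin_res W V J y + r))\<^sup>2 \<le> 2 * (norm (lin_res W V J y))\<^sup>2 + 2 * CF\<^sup>2 * \<rho>\<^sup>2 * (norm (V J y))\<^sup>2"
        by (rule lin_res_remainder_le[OF rb v2])
      have "\<bar>?X y\<bar> \<le> ?e y * (\<bar>2 * (res W J y \<bullet> r)\<bar> + (norm (lin_res W V J y + r))\<^sup>2)"
        unfolding Xe abs_mult abs_exp_cancel by (intro mult_left_mono order_trans[OF abs_triangle_ineq]) auto
      also have "\<dots> \<le> ?Q * (CF * ?S\<^sup>2 * ?nV\<^sup>2 * (1 + (norm (res W J y))\<^sup>2) + (2 * (norm (lin_res W V J y))\<^sup>2 + 2 * CF\<^sup>2 * \<rho>\<^sup>2 * (norm (V J y))\<^sup>2))"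
        by (intro mult_mono add_mono a1 a2 weight_le[OF y']) auto
      finally show ?thesis by (simp add: add.assoc)
    qed
    define X' where "X' y = (if y \<in> N then 0 else ?X y)" for y
    have X': "(X' has_integral ?l) {a..b}"
      by (rule has_integral_spike[OF N(1) _ X]) (simp add: X'_def)
    have Y0: "0 \<le> ?Y y" for y
      using CF0 by (intro mult_nonneg_nonneg add_nonneg_nonneg) auto
    have "\<bar>X' y\<bar> \<le> ?Y y" if "y \<in> {a..b}" for y
      using le[of y] Y0[of y] that by (auto simp: X'_def simp del: mult_nonneg_nonneg)
    then have "norm (integral {a..b} X') \<le> integral {a..b} ?Y"
      using X' Y by (intro integral_norm_bound_integral) auto
    then show ?thesis unfolding integral_unique[OF X'] integral_unique[OF Y] by simp
  qed
  have "\<bar>Jf ?U - Jf W - dJ W V\<bar> \<le> (\<Sum>J\<in>inner_grid m. ?Q * (CF * ?S\<^sup>2 * ?nV\<^sup>2 * ((b - a) + L2sq a b (res W J))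
         + 2 * L2sq a b (lin_res W V J) + 2 * CF\<^sup>2 * \<rho>\<^sup>2 * L2sq a b (V J)))"
    unfolding Jf_eq dJ_def L2_family_inner_def sum_subtractf[symmetric]
    by (rule order_trans[OF sum_abs]) (intro sum_mono J_est)
  also have "\<dots> = ?Q * (CF * ?S\<^sup>2 * ?nV\<^sup>2 * (real (card (inner_grid m :: (nat^'n) set)) * (b - a) + (\<Sum>J\<in>inner_grid m. L2sq a b (res W J)))
         + 2 * (\<Sum>J\<in>inner_grid m. L2sq a b (lin_res W V J)) + 2 * CF\<^sup>2 * \<rho>\<^sup>2 * (\<Sum>J\<in>inner_grid m. L2sq a b (V J)))"
    by (simp only: sum_distrib_left[symmetric] sum.distrib sum_constant)
  also have "\<dots> \<le> ?Q * (CF * ?S\<^sup>2 * ?nV\<^sup>2 * (real (card (inner_grid m :: (nat^'n) set)) * (b - a) + CR)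
         + 2 * (CT * ?nV\<^sup>2) + 2 * CF\<^sup>2 * \<rho>\<^sup>2 * (1 * ?nV\<^sup>2))"
  proof -
    have "(\<Sum>J\<in>inner_grid m. L2sq a b (lin_res W V J)) \<le> CT * ?nV\<^sup>2"
      using lin_res_norm_le[OF W] by (intro H1_dominated[OF V(1) CT_nonneg] exI[of _ "{}"]) auto
    moreover have "(\<Sum>J\<in>inner_grid m. L2sq a b (V J)) \<le> 1 * ?nV\<^sup>2"
      by (intro H1_dominated[OF V(1)] exI[of _ "{}"]) (auto intro!: sum_nonneg add_nonneg_nonneg)
    ultimately show ?thesis
      using CF0 by (intro mult_left_mono add_mono res_norm_le W order_refl) auto
  qed
  also have "\<dots> = CQ * ?nV\<^sup>2" by (simp add: CQ_def algebra_simps)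
  finally show ?thesis .
qed

lemma gradient_exists:
  assumes W: "W \<in> H1" "hnorm W \<le> rad"
  shows "\<exists>G. is_gradient A a b m Jf W G"
proof -
  have "\<exists>g\<in>H10. \<forall>v\<in>H10. hinner g v = dJ W v"
    using H10_subset by (intro H10_Riesz[OF ab, of _ _ _ CG] dJ_comb dJ_bound W) blast+
  then obtain G where G: "G \<in> H10" "\<And>v. v \<in> H10 \<Longrightarrow> hinner G v = dJ W v" by blast
  have "is_gradient A a b m Jf W G" unfolding is_gradient_def
  proof (intro conjI G(1) allI impI)
    fix \<epsilon> :: real assume \<epsilon>: "\<epsilon> > 0"
    show "\<exists>\<eta>>0. \<forall>V\<in>H10. hnorm V < \<eta> \<longrightarrow>
        \<bar>Jf (\<lambda>J y. W J y + V J y) - Jf W - hinner G V\<bar> \<le> \<epsilon> * hnorm V"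
    \<comment> \<open>The bound \<open>rad\<close> keeps V in the range of \<open>Jf_taylor\<close>;
      the other bound turns \<open>CQ * (hnorm V)\<^sup>2\<close> into at most
      \<open>\<epsilon> * hnorm V\<close>.\<close>
    proof (intro exI[of _ "min rad (\<epsilon> / (CQ + 1))"] conjI ballI impI)
      show "0 < min rad (\<epsilon> / (CQ + 1))" using rad_pos CQ_nonneg \<epsilon> by simp
      fix V :: "('n, 'N) sdfun" assume V: "V \<in> H10" and n: "hnorm V < min rad (\<epsilon> / (CQ + 1))"
      have V1: "V \<in> H1" using V H10_subset by blast
      have "\<bar>Jf (lin_comb 1 W 1 V) - Jf W - dJ W V\<bar> \<le> CQ * (hnorm V)\<^sup>2"
        using n by (intro Jf_taylor W V1) simp
      also have "\<dots> = (CQ * hnorm V) * hnorm V" by (simp add: power2_eq_square)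
      also have "\<dots> \<le> \<epsilon> * hnorm V"
      proof (rule mult_right_mono[OF _ H1_norm_nonneg[OF V1]])
        have "(CQ + 1) * hnorm V \<le> \<epsilon>"
          using n CQ_nonneg by (simp add: field_simps)
        then show "CQ * hnorm V \<le> \<epsilon>" using H1_norm_nonneg[OF V1] by (simp add: algebra_simps)
      qed
      finally show "\<bar>Jf (\<lambda>J y. W J y + V J y) - Jf W - hinner G V\<bar> \<le> \<epsilon> * hnorm V"
        by (simp add: G(2)[OF V] lin_comb_def)
    qed
  qed
  then show ?thesis by blast
qed

text \<open>The gradient in the descent is picked by \<open>SOME\<close>, so the estimates for
  \<open>dJ\<close> have to be carried over to an arbitrary gradient. Both describe the first-order
  change of \<open>Jf\<close> in direction V, and small multiples of V force them to agree.\<close>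

lemma gradient_unique:
  assumes W: "W \<in> H1" "hnorm W \<le> rad"
    and G: "is_gradient A a b m Jf W G" and V: "V \<in> H10"
  shows "hinner G V = dJ W V"
proof -
  have V1: "V \<in> H1" using V H10_subset by blast
  have G1: "G \<in> H1" using G H10_subset unfolding is_gradient_def by blast
  define n where "n = hnorm V"
  have n0: "0 \<le> n" unfolding n_def by (rule H1_norm_nonneg[OF V1])
  define \<delta> where "\<delta> = \<bar>dJ W V - hinner G V\<bar>"
  have "\<delta> \<le> \<epsilon> * (n + 1)" if \<epsilon>: "\<epsilon> > 0" for \<epsilon>
  proof -
    obtain \<eta> where \<eta>: "\<eta> > 0" "\<And>V. V \<in> H10 \<Longrightarrow> hnorm V < \<eta> \<Longrightarrow>
        \<bar>Jf (\<lambda>J y. W J y + V J y) - Jf W - hinner G V\<bar> \<le> \<epsilon> * hnorm V"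
      using G \<epsilon> unfolding is_gradient_def by blast
    \<comment> \<open>The first bound keeps t V within both admissible radii, the second makes
      \<open>CQ * t * n\<^sup>2\<close> at most \<epsilon>. The added 1 keeps the divisors positive
      if n or \<open>CQ\<close> vanishes.\<close>
    define t where "t = min (min \<eta> rad / (2 * (n + 1))) (\<epsilon> / (CQ * n\<^sup>2 + 1))"
    have "0 < CQ * n\<^sup>2 + 1" using CQ_nonneg by (intro add_nonneg_pos) auto
    note pos = this
    then have t0: "t > 0" unfolding t_def using \<eta>(1) rad_pos \<epsilon> n0 by simp
    have tn: "t * n < min \<eta> rad"
    proof -
      have "t * n \<le> min \<eta> rad / (2 * (n + 1)) * n" using n0 by (intro mult_right_mono) (auto simp: t_def)
      also have "\<dots> = min \<eta> rad * (n / (2 * (n + 1)))" by simp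
      also have "\<dots> < min \<eta> rad * 1" using n0 \<eta>(1) rad_pos by (intro mult_strict_left_mono) (auto simp: field_simps)
      finally show ?thesis by simp
    qed
    have te: "CQ * t * n\<^sup>2 \<le> \<epsilon>"
    proof -
      have "CQ * t * n\<^sup>2 = t * (CQ * n\<^sup>2)" by simp
      also have "\<dots> \<le> \<epsilon> / (CQ * n\<^sup>2 + 1) * (CQ * n\<^sup>2)"
        using CQ_nonneg by (intro mult_right_mono) (auto simp: t_def)
      also have "\<dots> = \<epsilon> * (CQ * n\<^sup>2 / (CQ * n\<^sup>2 + 1))" by simp
      also have "\<dots> \<le> \<epsilon> * 1" using \<epsilon> pos by (intro mult_left_mono) (auto simp: divide_le_eq_1)
      finally show ?thesis by simp
    qed
    let ?V = "lin_comb t V 0 V"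
    have tV: "?V \<in> H10" by (rule H10_comb_closed[OF V V])
    then have tV1: "?V \<in> H1" using H10_subset by blast
    have nt: "hnorm ?V = t * n"
      using t0 by (simp add: H1_norm_inner H.B_cmb_self[OF V1 V1] n_def real_sqrt_mult)
    have "\<bar>Jf (lin_comb 1 W 1 ?V) - Jf W - dJ W ?V\<bar> \<le> CQ * (t * n)\<^sup>2"
      using Jf_taylor[OF W tV1] tn nt by simp
    moreover have "\<bar>Jf (lin_comb 1 W 1 ?V) - Jf W - hinner G ?V\<bar> \<le> \<epsilon> * (t * n)"
      using \<eta>(2)[OF tV] tn nt by (simp add: lin_comb_def)
    ultimately have "\<bar>dJ W ?V - hinner G ?V\<bar> \<le> CQ * (t * n)\<^sup>2 + \<epsilon> * (t * n)" by linarith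
    moreover have e: "dJ W ?V - hinner G ?V = t * (dJ W V - hinner G V)"
      by (simp add: dJ_comb[OF W(1) V1 V1] H.B_cmb_right[OF V1 V1 G1] algebra_simps)
    ultimately have "\<bar>t\<bar> * \<delta> \<le> CQ * (t * n)\<^sup>2 + \<epsilon> * (t * n)"
      unfolding \<delta>_def abs_mult[symmetric] e[symmetric] by simp
    also have "\<dots> = t * (CQ * t * n\<^sup>2 + \<epsilon> * n)" by (simp add: power2_eq_square algebra_simps)
    finally have "t * \<delta> \<le> t * (CQ * t * n\<^sup>2 + \<epsilon> * n)" using t0 by simp
    then have "\<delta> \<le> CQ * t * n\<^sup>2 + \<epsilon> * n" using t0 by simp
    then show ?thesis using te by (simp add: algebra_simps)
  qed
  then have "\<delta> \<le> 0 + e" if "e > 0" for e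
    using that n0 spec[of "\<lambda>\<epsilon>. \<epsilon> > 0 \<longrightarrow> \<delta> \<le> \<epsilon> * (n + 1)" "e / (n + 1)"] by simp
  then have "\<delta> \<le> 0" by (rule field_le_epsilon)
  then show ?thesis by (simp add: \<delta>_def)
qed

definition grad :: "('n, 'N) sdfun \<Rightarrow> ('n, 'N) sdfun" where
  "grad W = (SOME G. is_gradient A a b m Jf W G)"

text \<open>The norm bound results from testing the gradient against itself in
  \<open>dJ_bound\<close>.\<close>

lemma
  assumes W: "W \<in> H1" "hnorm W \<le> rad"
  shows grad_H10: "grad W \<in> H10"
    and grad_taylor: "V \<in> H10 \<Longrightarrow> hnorm V \<le> rad \<Longrightarrow>
      \<bar>Jf (lin_comb 1 W 1 V) - Jf W - hinner (grad W) V\<bar> \<le> CQ * (hnorm V)\<^sup>2"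
    and grad_norm_le: "hnorm (grad W) \<le> CG"
proof -
  have G: "is_gradient A a b m Jf W (grad W)"
    unfolding grad_def by (rule someI_ex[OF gradient_exists[OF W]])
  then show G0: "grad W \<in> H10" unfolding is_gradient_def by blast
  then have G1: "grad W \<in> H1" using H10_subset by blast
  show "\<bar>Jf (lin_comb 1 W 1 V) - Jf W - hinner (grad W) V\<bar> \<le> CQ * (hnorm V)\<^sup>2"
    if "V \<in> H10" "hnorm V \<le> rad"
    using Jf_taylor[OF W subsetD[OF H10_subset that(1)] that(2)] gradient_unique[OF W G that(1)] by simp
  let ?n = "hnorm (grad W)"
  have "?n * ?n = dJ W (grad W)"
    using gradient_unique[OF W G G0] H.nrm_sq[OF G1] by (simp add: H.nrm_def H1_norm_inner power2_eq_square)
  also have "\<dots> \<le> CG * ?n" using dJ_bound[OF W G1] by linarith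
  finally show "?n \<le> CG"
    using H1_norm_nonneg[OF G1] CG_nonneg by (cases "?n = 0") auto
qed

end

section \<open>Geometry and the exponential kernel\<close>

type_synonym 'N rvec = "real^'N"

type_synonym 'N rmat = "real^'N^'N"

text \<open>Projection coefficients and normalizer are hidden as constants; for smoothness in t only
  the shape of the recursion matters.\<close>

lemma Psi_recursion:
  "\<exists>c n. \<forall>t. Psi d r t = (t ^ r * exp t - (\<Sum>s<r. c s * Psi d s t)) / n"
  by (subst Psi.simps) (auto simp: Let_def)

lemma Psi_C1: "\<exists>g. continuous_on UNIV g \<and> (\<forall>t. (Psi d r has_real_derivative g t) (at t))"
proof (induction r rule: less_induct)
  case (less r)
  then have "\<forall>s\<in>{..<r}. \<exists>g. continuous_on UNIV g \<and> (\<forall>t. (Psi d s has_real_derivative g t) (at t))" by auto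
  then obtain g where g: "\<forall>s\<in>{..<r}. continuous_on UNIV (g s) \<and> (\<forall>t. (Psi d s has_real_derivative g s t) (at t))"
    by (rule bchoice[THEN exE])
  obtain c n where cn: "Psi d r = (\<lambda>t. (t ^ r * exp t - (\<Sum>s<r. c s * Psi d s t)) / n)"
    using Psi_recursion[of d r] by auto
  let ?G = "\<lambda>t. (real r * t ^ (r - 1) * exp t + t ^ r * exp t - (\<Sum>s<r. c s * g s t)) * inverse n"
  have "continuous_on UNIV ?G" using g by (intro continuous_intros) auto
  moreover have "(Psi d r has_real_derivative ?G t) (at t)" for t
    unfolding cn divide_inverse
    by (intro DERIV_cmult_right DERIV_diff DERIV_sum DERIV_cmult)
       (use g in \<open>auto intro!: derivative_eq_intros\<close>)
  ultimately show ?case by (intro exI[of _ ?G]) simp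
qed

lemma Psi_has_derivative: "(Psi d r has_real_derivative deriv (Psi d r) t) (at t)"
  using Psi_C1[of d r] by (metis DERIV_imp_deriv)

lemma continuous_on_deriv_Psi: "continuous_on S (deriv (Psi d r))"
proof -
  obtain g where g: "continuous_on UNIV g" "\<And>t. (Psi d r has_real_derivative g t) (at t)" using Psi_C1 by metis
  then have "deriv (Psi d r) = g" by (auto intro: DERIV_imp_deriv)
  then show ?thesis using g(1) continuous_on_subset by blast
qed

lemma continuous_on_Psi: "continuous_on S (Psi d r)"
  by (rule DERIV_continuous_on) (rule DERIV_subset[OF Psi_has_derivative subset_UNIV])

text \<open>Collected in a vector, the basis turns the expansion of w into
  \<open>W \<bullet> psi d t\<close>, linear in W, so that F can be expanded in W by vector
  calculus.\<close>

definition psi :: "real \<Rightarrow> real \<Rightarrow> 'N::{finite,linorder} rvec" where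
  "psi d t = (\<chi> r. Psi d (idx r) t)"

definition dpsi :: "real \<Rightarrow> real \<Rightarrow> 'N::{finite,linorder} rvec" where
  "dpsi d t = (\<chi> r. deriv (Psi d (idx r)) t)"

lemma expand_eq: "expand d W t = W \<bullet> psi d t"
  by (simp add: expand_def psi_def inner_vec_def)

lemma continuous_on_psi: "continuous_on S f \<Longrightarrow> continuous_on S (\<lambda>x. psi d (f x))"
  unfolding psi_def by (intro continuous_on_vec_lambda continuous_on_compose2[OF continuous_on_Psi[of UNIV]]) auto

lemma continuous_on_dpsi: "continuous_on S f \<Longrightarrow> continuous_on S (\<lambda>x. dpsi d (f x))"
  unfolding dpsi_def by (intro continuous_on_vec_lambda continuous_on_compose2[OF continuous_on_deriv_Psi[of UNIV]]) auto

lemma continuous_on_Psi': "continuous_on S f \<Longrightarrow> continuous_on S (\<lambda>x. Psi d r (f x))"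
  by (rule continuous_on_compose2[OF continuous_on_Psi[of UNIV]]) auto

lemma continuous_on_deriv_Psi': "continuous_on S f \<Longrightarrow> continuous_on S (\<lambda>x. deriv (Psi d r) (f x))"
  by (rule continuous_on_compose2[OF continuous_on_deriv_Psi[of UNIV]]) auto

lemma expand_has_derivative: "(expand d W has_real_derivative W \<bullet> dpsi d t) (at t)"
  unfolding expand_def[abs_def] dpsi_def inner_vec_def
  by (auto intro!: DERIV_sum DERIV_cmult Psi_has_derivative)

section \<open>Geometry of the directions and continuity of the coefficient matrices\<close>

lemma closure_Omega:
  assumes "0 < A" "a < b"
  shows "closure (Omega A a b :: 'n::finite point set) = cbox (\<chi> i. - A) (\<chi> i. A) \<times> {a..b}"
proof -
  have "(Omega A a b :: 'n point set) = box (\<chi> i. - A) (\<chi> i. A) \<times> {a<..<b}"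
    by (auto simp: Omega_def mem_box_cart)
  moreover have "box (\<chi> i. - A) (\<chi> i. A :: real^'n) \<noteq> {}"
  proof -
    have "(0 :: real^'n) \<in> box (\<chi> i. - A) (\<chi> i. A)" using assms by (simp add: mem_box_cart)
    then show ?thesis by blast
  qed
  ultimately show ?thesis using assms by (simp add: closure_Times closure_box)
qed

definition unit_x :: "'n::{finite,linorder} point" where "unit_x = (axis (Min UNIV) 1, 0)"

lemma source_eq: "source t = t *\<^sub>R (unit_x :: 'n::{finite,linorder} point)"
proof -
  have "axis k t = t *\<^sub>R axis k (1::real)" for k :: 'n by (simp add: axis_def vec_eq_iff)
  then show ?thesis by (simp add: source_def unit_x_def)
qed

definition dist2 :: "'n::{finite,linorder} point \<Rightarrow> real \<Rightarrow> real" where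
  "dist2 x t = (x - t *\<^sub>R unit_x) \<bullet> (x - t *\<^sub>R unit_x)"

text \<open>All sources lie in the hyperplane y = 0, so a point with positive last coordinate never
  meets one. This is what makes \<open>nu\<close> smooth in \<alpha>.\<close>

lemma dist2_pos: "0 < snd x \<Longrightarrow> 0 < dist2 x t"
proof -
  assume "0 < snd x"
  then have "snd (x - t *\<^sub>R unit_x) \<noteq> 0" by (simp add: unit_x_def)
  then have "x - t *\<^sub>R unit_x \<noteq> 0" by (metis snd_zero)
  then show ?thesis by (simp add: dist2_def)
qed

lemma nu_eq: "nu x t = (inverse (sqrt (dist2 x t))) *\<^sub>R (x - t *\<^sub>R unit_x)"
  by (simp add: nu_def source_eq dist2_def norm_eq_sqrt_inner)

text \<open>The \<alpha>-derivative of \<open>nu\<close> in closed form, from which joint continuity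
  in both arguments can be read off.\<close>

definition dnu :: "'n::{finite,linorder} point \<Rightarrow> real \<Rightarrow> 'n point" where
  "dnu x t = (((x - t *\<^sub>R unit_x) \<bullet> unit_x) * inverse (sqrt (dist2 x t)) * inverse (dist2 x t)) *\<^sub>R (x - t *\<^sub>R unit_x)
      - inverse (sqrt (dist2 x t)) *\<^sub>R unit_x"

lemma nu_has_derivative:
  fixes x :: "'n::{finite,linorder} point"
  assumes "0 < snd x"
  shows "(nu x has_vector_derivative dnu x t) (at t)"
proof -
  note p = dist2_pos[OF assms, of t]
  have q: "dist2 x = (\<lambda>t. x \<bullet> x - 2 * t * (x \<bullet> unit_x) + t\<^sup>2 * (unit_x \<bullet> (unit_x :: 'n point)))"
    by (rule ext) (simp add: dist2_def inner_diff_left inner_diff_right inner_commute power2_eq_square algebra_simps)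
  have "(dist2 x has_real_derivative - 2 * ((x - t *\<^sub>R unit_x) \<bullet> unit_x)) (at t)"
    unfolding q by (auto intro!: derivative_eq_intros simp: inner_diff_left algebra_simps)
  from DERIV_inverse_fun[OF DERIV_chain2[OF DERIV_real_sqrt[OF p] this]]
  have 1: "((\<lambda>t. inverse (sqrt (dist2 x t))) has_real_derivative
     ((x - t *\<^sub>R unit_x) \<bullet> unit_x) * inverse (sqrt (dist2 x t)) * inverse (dist2 x t)) (at t)"
    using p by (simp add: field_simps power2_eq_square)
  have 2: "((\<lambda>t. x - t *\<^sub>R unit_x) has_vector_derivative - unit_x) (at t)"
    by (auto intro!: derivative_eq_intros)
  show ?thesis
    unfolding nu_eq[abs_def] dnu_def
    using has_vector_derivative_scaleR[OF 1 2] by (simp add: add.commute)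
qed

lemma deriv_snd_nu: "0 < snd x \<Longrightarrow> deriv (\<lambda>t. snd (nu x t)) t = snd (dnu x t)"
  using bounded_linear.has_vector_derivative[OF bounded_linear_snd nu_has_derivative, of x t]
  by (intro DERIV_imp_deriv) (simp add: has_real_derivative_iff_has_vector_derivative)

lemma deriv_fst_nu: "0 < snd x \<Longrightarrow> deriv (\<lambda>t. fst (nu x t) $ i) t = fst (dnu x t) $ i"
  using bounded_linear.has_vector_derivative[OF bounded_linear_compose[OF bounded_linear_vec_nth bounded_linear_fst] nu_has_derivative, of x i t]
  by (intro DERIV_imp_deriv) (simp add: has_real_derivative_iff_has_vector_derivative)

lemma continuous_on_dist2:
  "continuous_on S f \<Longrightarrow> continuous_on S g \<Longrightarrow> continuous_on S (\<lambda>z. dist2 (f z) (g z))"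
  unfolding dist2_def by (intro continuous_intros)

lemma continuous_on_nu:
  assumes "continuous_on S f" "continuous_on S g" "\<And>z. z \<in> S \<Longrightarrow> 0 < snd (f z)"
  shows "continuous_on S (\<lambda>z. nu (f z) (g z))"
  unfolding nu_eq
  by (intro continuous_intros assms continuous_on_dist2) (use dist2_pos[OF assms(3)] in \<open>auto simp: less_imp_neq[THEN not_sym]\<close>)

lemma continuous_on_dnu:
  assumes "continuous_on S f" "continuous_on S g" "\<And>z. z \<in> S \<Longrightarrow> 0 < snd (f z)"
  shows "continuous_on S (\<lambda>z. dnu (f z) (g z))"
  unfolding dnu_def
  by (intro continuous_intros assms continuous_on_dist2) (use dist2_pos[OF assms(3)] in \<open>auto simp: less_imp_neq[THEN not_sym]\<close>)

lemma snd_nu_pos: "0 < snd x \<Longrightarrow> 0 < snd (nu x t)"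
  using dist2_pos[of x t] by (simp add: nu_eq unit_x_def)

lemma norm_nu_le: "norm (nu x t) \<le> 1"
  by (cases "norm (x - source t) = 0") (simp_all add: nu_def)

lemma matrix_vector_norm_le:
  "norm (M *v v) \<le> real CARD('m) * norm M * norm (v :: real^'n)" for M :: "real^'n^'m"
proof -
  have "norm (M *v v) \<le> (\<Sum>i\<in>UNIV. \<bar>(M *v v) $ i\<bar>)" by (rule norm_le_l1_cart)
  also have "\<dots> \<le> (\<Sum>i\<in>(UNIV :: 'm set). norm M * norm v)"
  proof (rule sum_mono)
    fix i
    have "(M *v v) $ i = M $ i \<bullet> v" by (simp add: matrix_vector_mult_def inner_vec_def)
    then have "\<bar>(M *v v) $ i\<bar> \<le> norm (M $ i) * norm v" by (simp add: Cauchy_Schwarz_ineq2)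
    also have "\<dots> \<le> norm M * norm v" by (intro mult_right_mono Finite_Cartesian_Product.norm_nth_le) auto
    finally show "\<bar>(M *v v) $ i\<bar> \<le> norm M * norm v" .
  qed
  finally show ?thesis by simp
qed

text \<open>The integrand is jointly continuous once \<open>deriv\<close> is replaced by
  \<open>dnu\<close>; positivity of the last coordinate also keeps the divisor away from 0.\<close>

lemma continuous_on_Ay_mat:
  assumes S: "\<And>x. x \<in> S \<Longrightarrow> 0 < snd x"
  shows "continuous_on S (Ay_mat d :: 'n::{finite,linorder} point \<Rightarrow> 'N::{finite,linorder} rmat)"
proof -
  have eq: "Ay_mat d x = (\<chi> k r. integral (cbox (-d) d) (\<lambda>\<alpha>. snd (dnu x \<alpha>) / snd (nu x \<alpha>) * Psi d (idx r) \<alpha> * Psi d (idx k) \<alpha>))"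
    if "x \<in> S" for x
    unfolding Ay_mat_def cbox_interval by (simp add: deriv_snd_nu[OF S[OF that]])
  have "continuous_on S (\<lambda>x. (\<chi> k r. integral (cbox (-d) d) (\<lambda>\<alpha>. snd (dnu x \<alpha>) / snd (nu x \<alpha>) * Psi d (idx r) \<alpha> * Psi d (idx k) \<alpha>)) :: 'N::{finite,linorder} rmat)"
  proof (intro continuous_on_vec_lambda integral_continuous_on_param)
    fix k r :: 'N
    have "snd (nu (fst z) (snd z)) \<noteq> 0" if "z \<in> S \<times> cbox (-d) d" for z
      using snd_nu_pos[OF S, of "fst z" "snd z"] that by (auto simp: less_imp_neq[THEN not_sym])
    then show "continuous_on (S \<times> cbox (-d) d) (\<lambda>(x, \<alpha>). snd (dnu x \<alpha>) / snd (nu x \<alpha>) * Psi d (idx r) \<alpha> * Psi d (idx k) \<alpha>)"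
      unfolding case_prod_beta
      by (intro continuous_intros continuous_on_nu continuous_on_dnu continuous_on_Psi') (auto intro: S)
  qed
  then show ?thesis by (rule continuous_on_eq) (simp add: eq)
qed

lemma continuous_on_D_mat:
  assumes "\<And>x. x \<in> S \<Longrightarrow> 0 < snd x"
  shows "continuous_on S (D_mat d :: 'n::{finite,linorder} point \<Rightarrow> 'N::{finite,linorder} rmat)"
  unfolding D_mat_def[abs_def] by (intro continuous_intros continuous_on_Ay_mat assms)

lemma continuous_on_Ax_mat:
  assumes S: "\<And>x. x \<in> S \<Longrightarrow> 0 < snd x"
  shows "continuous_on S (Ax_mat d i :: 'n::{finite,linorder} point \<Rightarrow> 'N::{finite,linorder} rmat)"
proof -
  have eq: "Ax_mat d i x = (\<chi> k r. integral (cbox (-d) d) (\<lambda>\<alpha>. (fst (nu x \<alpha>) $ i / snd (nu x \<alpha>) * deriv (Psi d (idx r)) \<alpha>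
      + fst (dnu x \<alpha>) $ i / snd (nu x \<alpha>) * Psi d (idx r) \<alpha>) * Psi d (idx k) \<alpha>))"
    if "x \<in> S" for x
    unfolding Ax_mat_def cbox_interval by (simp add: deriv_fst_nu[OF S[OF that]])
  have "continuous_on S (\<lambda>x. (\<chi> k r. integral (cbox (-d) d) (\<lambda>\<alpha>. (fst (nu x \<alpha>) $ i / snd (nu x \<alpha>) * deriv (Psi d (idx r)) \<alpha>
      + fst (dnu x \<alpha>) $ i / snd (nu x \<alpha>) * Psi d (idx r) \<alpha>) * Psi d (idx k) \<alpha>)) :: 'N::{finite,linorder} rmat)"
  proof (intro continuous_on_vec_lambda integral_continuous_on_param)
    fix k r :: 'N
    have "snd (nu (fst z) (snd z)) \<noteq> 0" if "z \<in> S \<times> cbox (-d) d" for z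
      using snd_nu_pos[OF S, of "fst z" "snd z"] that by (auto simp: less_imp_neq[THEN not_sym])
    then show "continuous_on (S \<times> cbox (-d) d) (\<lambda>(x, \<alpha>). (fst (nu x \<alpha>) $ i / snd (nu x \<alpha>) * deriv (Psi d (idx r)) \<alpha>
      + fst (dnu x \<alpha>) $ i / snd (nu x \<alpha>) * Psi d (idx r) \<alpha>) * Psi d (idx k) \<alpha>)"
      unfolding case_prod_beta
      by (intro continuous_intros continuous_on_nu continuous_on_dnu continuous_on_Psi' continuous_on_deriv_Psi') (auto intro: S)
  qed
  then show ?thesis by (rule continuous_on_eq) (simp add: eq)
qed

section \<open>Second-order expansion of the exponential kernel\<close>

lemma abs_exp_minus_one_le: "\<bar>exp t - 1\<bar> \<le> \<bar>t\<bar> * exp \<bar>t :: real\<bar>"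
proof (cases "t \<ge> 0")
  case True
  have "1 - t \<le> exp (- t)" using exp_ge_add_one_self[of "- t"] by simp
  then have "exp t * (1 - t) \<le> exp t * exp (- t)" by (intro mult_left_mono) auto
  then show ?thesis using True by (simp add: exp_minus algebra_simps)
next
  case False
  have "1 + t \<le> exp t" by (rule exp_ge_add_one_self)
  moreover have "\<bar>t\<bar> * 1 \<le> \<bar>t\<bar> * exp \<bar>t\<bar>" by (intro mult_left_mono) auto
  moreover have "exp t \<le> 1" using False by simp
  ultimately show ?thesis using False by linarith
qed

text \<open>For t >= 0 the first-order bound is used twice, through exp t - 1 - t <= t (exp t - 1).
  For t < 0 the exponential is compared with 1 / (1 - t).\<close>

lemma abs_exp_minus_linear_le: "\<bar>exp t - 1 - t\<bar> \<le> t\<^sup>2 * exp \<bar>t :: real\<bar>"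
proof (cases "t \<ge> 0")
  case True
  have 1: "1 + t \<le> exp t" by (rule exp_ge_add_one_self)
  have 2: "exp t - 1 \<le> t * exp t" using abs_exp_minus_one_le[of t] True by simp
  have "t * (exp t - 1) \<le> t * (t * exp t)" using 2 True by (intro mult_left_mono)
  then show ?thesis using 1 2 True by (simp add: power2_eq_square algebra_simps)
next
  case False
  then have t: "0 < - t" by simp
  have 1: "1 + t \<le> exp t" by (rule exp_ge_add_one_self)
  have "1 - t \<le> exp (- t)" using exp_ge_add_one_self[of "- t"] by simp
  then have "exp t \<le> inverse (1 - t)" using t by (simp add: exp_minus le_imp_inverse_le inverse_le_imp_le)
  also have "inverse (1 - t) \<le> 1 + t + t\<^sup>2"
  proof -
    \<comment> \<open>The product equals 1 - t^3, and t is negative.\<close>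
    have "1 \<le> (1 + t + t\<^sup>2) * (1 - t)"
    proof -
      have "(1 + t + t\<^sup>2) * (1 - t) = 1 + (- t) ^ 3" by (simp add: power2_eq_square power3_eq_cube algebra_simps)
      then show ?thesis using t by simp
    qed
    then show ?thesis using t by (simp add: field_simps)
  qed
  finally have "exp t - 1 - t \<le> t\<^sup>2 * 1" by simp
  also have "\<dots> \<le> t\<^sup>2 * exp \<bar>t\<bar>" by (intro mult_left_mono) auto
  finally show ?thesis using 1 by linarith
qed

text \<open>Carrying out $\partial_\alpha$ under the integral turns $F$ into a double integral of
  $(w'(\alpha) K - \partial_\alpha K)\, e^{w(\beta) - w(\alpha)}$.  This is \<open>kval\<close> with $\xi = \Psi'(\alpha)$,
  $k = K$, $l = \partial_\alpha K$, $\eta = \Psi(\beta) - \Psi(\alpha)$; \<open>kgrad\<close> is its gradient in $W$.\<close>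

definition kval :: "real^'N \<Rightarrow> real^'N \<Rightarrow> real \<Rightarrow> real \<Rightarrow> real^'N \<Rightarrow> real" where
  "kval W \<xi> k l \<eta> = ((W \<bullet> \<xi>) * k - l) * exp (W \<bullet> \<eta>)"

definition kgrad :: "real^'N \<Rightarrow> real^'N \<Rightarrow> real \<Rightarrow> real \<Rightarrow> real^'N \<Rightarrow> real^'N" where
  "kgrad W \<xi> k l \<eta> = exp (W \<bullet> \<eta>) *\<^sub>R (k *\<^sub>R \<xi> + ((W \<bullet> \<xi>) * k - l) *\<^sub>R \<eta>)"

text \<open>One constant for two bounds: the first two summands in the bracket belong to the Taylor
  remainder of \<open>kval\<close>, the last one to \<open>kgrad\<close>. In the Taylor bound, one
  half of the exponent \<open>2 * \<rho> * B\<close> pays for the exponential at W and the other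
  half for that of the increment.\<close>

definition kconst :: "real \<Rightarrow> real \<Rightarrow> real" where
  "kconst B \<rho> = exp (2 * \<rho> * B) * ((\<rho> * B\<^sup>2 + B) * B\<^sup>2 + B ^ 3 + (B\<^sup>2 + (\<rho> * B\<^sup>2 + B) * B))"

lemma kconst_nonneg: "0 \<le> B \<Longrightarrow> 0 \<le> \<rho> \<Longrightarrow> 0 \<le> kconst B \<rho>"
  unfolding kconst_def by (intro mult_nonneg_nonneg add_nonneg_nonneg) auto

context
  fixes B \<rho> k l :: real and W \<xi> \<eta> :: "real^'N"
  assumes b: "0 \<le> B" "0 \<le> \<rho>" "norm \<xi> \<le> B" "norm \<eta> \<le> B" "\<bar>k\<bar> \<le> B" "\<bar>l\<bar> \<le> B" "norm W \<le> \<rho>"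
begin

lemma inner_le: "norm u \<le> r \<Longrightarrow> norm v \<le> B \<Longrightarrow> \<bar>u \<bullet> v\<bar> \<le> r * B" for u v :: "real^'N"
  using b(1) by (intro order_trans[OF Cauchy_Schwarz_ineq2] mult_mono) (auto intro: order_trans[OF norm_ge_zero])

lemma coefficient_le: "\<bar>(W \<bullet> \<xi>) * k - l\<bar> \<le> \<rho> * B\<^sup>2 + B"
proof -
  have "\<bar>(W \<bullet> \<xi>) * k\<bar> \<le> (\<rho> * B) * B"
    unfolding abs_mult using b by (intro mult_mono inner_le) auto
  then show ?thesis using b(6) by (simp add: power2_eq_square)
qed

lemma kgrad_norm_le: "norm (kgrad W \<xi> k l \<eta>) \<le> kconst B \<rho>"
proof -
  have "norm (k *\<^sub>R \<xi> + ((W \<bullet> \<xi>) * k - l) *\<^sub>R \<eta>) \<le> B * B + (\<rho> * B\<^sup>2 + B) * B"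
    unfolding norm_scaleR
    by (intro norm_triangle_le add_mono) (use b coefficient_le in \<open>auto intro!: mult_mono\<close>)
  then have "norm (kgrad W \<xi> k l \<eta>) \<le> exp (W \<bullet> \<eta>) * (B\<^sup>2 + (\<rho> * B\<^sup>2 + B) * B)"
    unfolding kgrad_def norm_scaleR abs_exp_cancel by (intro mult_left_mono) (auto simp: power2_eq_square)
  also have "\<dots> \<le> exp (2 * \<rho> * B) * ((\<rho> * B\<^sup>2 + B) * B\<^sup>2 + B ^ 3 + (B\<^sup>2 + (\<rho> * B\<^sup>2 + B) * B))"
  proof (rule mult_mono)
    have "W \<bullet> \<eta> \<le> \<rho> * B" using inner_le[OF b(7) b(4)] by simp
    also have "\<dots> \<le> 2 * \<rho> * B" using mult_nonneg_nonneg[OF b(2) b(1)] by linarith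
    finally show "exp (W \<bullet> \<eta>) \<le> exp (2 * \<rho> * B)" by simp
    have "0 \<le> (\<rho> * B\<^sup>2 + B) * B\<^sup>2 + B ^ 3" using b by (intro mult_nonneg_nonneg add_nonneg_nonneg) auto
    then show "B\<^sup>2 + (\<rho> * B\<^sup>2 + B) * B \<le> (\<rho> * B\<^sup>2 + B) * B\<^sup>2 + B ^ 3 + (B\<^sup>2 + (\<rho> * B\<^sup>2 + B) * B)" by simp
    show "0 \<le> B\<^sup>2 + (\<rho> * B\<^sup>2 + B) * B" using b by (intro mult_nonneg_nonneg add_nonneg_nonneg) auto
  qed simp
  finally show ?thesis by (simp add: kconst_def)
qed

lemma kval_taylor:
  assumes V: "norm V \<le> \<rho>"
  shows "\<bar>kval (W + V) \<xi> k l \<eta> - kval W \<xi> k l \<eta> - V \<bullet> kgrad W \<xi> k l \<eta>\<bar> \<le> kconst B \<rho> * (norm V)\<^sup>2"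
proof -
  define u where "u = W \<bullet> \<eta>"
  define t where "t = V \<bullet> \<eta>"
  have u: "u \<le> \<rho> * B" using inner_le[OF b(7) b(4)] by (simp add: u_def)
  have t: "\<bar>t\<bar> \<le> norm V * B" unfolding t_def by (rule inner_le[OF order_refl b(4)])
  have t\<rho>: "\<bar>t\<bar> \<le> \<rho> * B" unfolding t_def by (rule inner_le[OF V b(4)])
  have vx: "\<bar>V \<bullet> \<xi>\<bar> \<le> norm V * B" by (rule inner_le[OF order_refl b(3)])
  \<comment> \<open>An exact splitting: the part linear in V cancels, which leaves a second-order
    remainder of exp and a product of two first-order factors.\<close>
  have eq: "kval (W + V) \<xi> k l \<eta> - kval W \<xi> k l \<eta> - V \<bullet> kgrad W \<xi> k l \<eta>
    = exp u * (((W \<bullet> \<xi>) * k - l) * (exp t - 1 - t) + (V \<bullet> \<xi>) * k * (exp t - 1))"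
    unfolding kval_def kgrad_def u_def t_def
    by (simp add: inner_add_left inner_add_right exp_add algebra_simps)
  have "\<bar>((W \<bullet> \<xi>) * k - l) * (exp t - 1 - t)\<bar> \<le> (\<rho> * B\<^sup>2 + B) * ((norm V * B)\<^sup>2 * exp (\<rho> * B))"
    unfolding abs_mult
  proof (intro mult_mono coefficient_le)
    have "\<bar>exp t - 1 - t\<bar> \<le> t\<^sup>2 * exp \<bar>t\<bar>" by (rule abs_exp_minus_linear_le)
    also have "\<dots> \<le> (norm V * B)\<^sup>2 * exp (\<rho> * B)"
      using t t\<rho> power_mono[OF t, of 2] by (intro mult_mono) auto
    finally show "\<bar>exp t - 1 - t\<bar> \<le> (norm V * B)\<^sup>2 * exp (\<rho> * B)" .
  qed (use b in \<open>auto intro!: add_nonneg_nonneg\<close>)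
  moreover have "\<bar>(V \<bullet> \<xi>) * k * (exp t - 1)\<bar> \<le> (norm V * B) * B * ((norm V * B) * exp (\<rho> * B))"
    unfolding abs_mult
  proof (intro mult_mono vx b)
    have "\<bar>exp t - 1\<bar> \<le> \<bar>t\<bar> * exp \<bar>t\<bar>" by (rule abs_exp_minus_one_le)
    also have "\<dots> \<le> (norm V * B) * exp (\<rho> * B)" using t t\<rho> by (intro mult_mono) auto
    finally show "\<bar>exp t - 1\<bar> \<le> (norm V * B) * exp (\<rho> * B)" .
  qed (use b in auto)
  ultimately have "\<bar>((W \<bullet> \<xi>) * k - l) * (exp t - 1 - t) + (V \<bullet> \<xi>) * k * (exp t - 1)\<bar>
     \<le> exp (\<rho> * B) * ((\<rho> * B\<^sup>2 + B) * B\<^sup>2 + B ^ 3) * (norm V)\<^sup>2"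
    by (simp add: power_mult_distrib power2_eq_square power3_eq_cube algebra_simps)
  then have "\<bar>kval (W + V) \<xi> k l \<eta> - kval W \<xi> k l \<eta> - V \<bullet> kgrad W \<xi> k l \<eta>\<bar>
     \<le> exp (\<rho> * B) * (exp (\<rho> * B) * ((\<rho> * B\<^sup>2 + B) * B\<^sup>2 + B ^ 3) * (norm V)\<^sup>2)"
    unfolding eq abs_mult abs_exp_cancel using u b by (intro mult_mono) auto
  also have "\<dots> = exp (2 * \<rho> * B) * ((\<rho> * B\<^sup>2 + B) * B\<^sup>2 + B ^ 3) * (norm V)\<^sup>2"
    by (simp add: exp_add[symmetric] mult.assoc[symmetric])
  also have "\<dots> \<le> kconst B \<rho> * (norm V)\<^sup>2"
    unfolding kconst_def using b by (intro mult_right_mono mult_left_mono) (auto intro!: add_nonneg_nonneg mult_nonneg_nonneg)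
  finally show ?thesis .
qed

text \<open>The quadratic remainder is absorbed into a linear bound at the price of a factor
  \<rho>.\<close>

lemma kval_lipschitz:
  assumes V: "norm V \<le> \<rho>"
  shows "\<bar>kval (W + V) \<xi> k l \<eta> - kval W \<xi> k l \<eta>\<bar> \<le> kconst B \<rho> * (1 + \<rho>) * norm V"
proof -
  have "\<bar>V \<bullet> kgrad W \<xi> k l \<eta>\<bar> \<le> norm V * kconst B \<rho>"
    by (intro order_trans[OF Cauchy_Schwarz_ineq2] mult_left_mono kgrad_norm_le) auto
  moreover have "kconst B \<rho> * (norm V)\<^sup>2 \<le> kconst B \<rho> * (\<rho> * norm V)"
    using V kconst_nonneg[OF b(1,2)] by (intro mult_left_mono) (auto simp: power2_eq_square intro: mult_right_mono)
  ultimately show ?thesis using kval_taylor[OF V] by (simp add: algebra_simps)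
qed

end

lemma continuous_on_kval:
  assumes "continuous_on S W" "continuous_on S \<xi>" "continuous_on S k" "continuous_on S l" "continuous_on S \<eta>"
  shows "continuous_on S (\<lambda>z. kval (W z) (\<xi> z) (k z) (l z) (\<eta> z))"
  unfolding kval_def by (intro continuous_intros assms)

lemma continuous_on_kgrad:
  assumes "continuous_on S W" "continuous_on S \<xi>" "continuous_on S k" "continuous_on S l" "continuous_on S \<eta>"
  shows "continuous_on S (\<lambda>z. kgrad (W z) (\<xi> z) (k z) (l z) (\<eta> z))"
  unfolding kgrad_def by (intro continuous_intros assms)

section \<open>The integral operator\<close>

text \<open>In \<open>cbox\<close> form, compactness and the uniqueness of derivatives within a
  nondegenerate closed box become available.\<close>

lemma K_domain_eq:
  assumes "0 < A" "a < b"
  shows "(K_domain A d a b :: ('n::finite point \<times> real \<times> real) set)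
    = cbox (((\<chi> i. - A), a), (- d, - d)) (((\<chi> i. A), b), (d, d))"
  unfolding K_domain_def closure_Omega[OF assms] interval_cbox cbox_Pair_eq by (rule refl)

lemma compact_closure_Omega: "0 < A \<Longrightarrow> a < b \<Longrightarrow> compact (closure (Omega A a b :: 'n::finite point set))"
  by (simp add: closure_Omega compact_Times)

lemma continuous_compact_bound:
  fixes f :: "'a::topological_space \<Rightarrow> 'b::real_normed_vector"
  assumes "compact S" "continuous_on S f"
  obtains B where "0 \<le> B" "\<And>x. x \<in> S \<Longrightarrow> norm (f x) \<le> B"
proof -
  have "bounded (f ` S)" using compact_imp_bounded compact_continuous_image assms by blast
  then obtain B where "\<And>x. x \<in> S \<Longrightarrow> norm (f x) \<le> B" unfolding bounded_iff by auto
  then show thesis using that[of "max B 0"] by (auto simp: le_max_iff_disj)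
qed

text \<open>\<open>Ka\<close> is the partial derivative in \<alpha>. \<open>C1_norm\<close> is
  phrased with \<open>frechet_derivative\<close>, which agrees with the derivative supplied by
  \<open>C2_on\<close> through uniqueness on the box; all suprema in the norm are nonnegative, so
  each single one is at most \<open>\<kappa>\<close>.\<close>

lemma C2_kernel_data:
  fixes K :: "'n::finite point \<times> real \<times> real \<Rightarrow> real"
  assumes A: "0 < A" and ab: "a < b" and d: "0 < d" and K: "C2_on (K_domain A d a b) K"
    and \<kappa>: "C1_norm (K_domain A d a b) K = \<kappa>"
  obtains Ka where "continuous_on (K_domain A d a b) K" "continuous_on (K_domain A d a b) Ka"
    "\<And>z. z \<in> K_domain A d a b \<Longrightarrow> \<bar>K z\<bar> \<le> \<kappa>" "\<And>z. z \<in> K_domain A d a b \<Longrightarrow> \<bar>Ka z\<bar> \<le> \<kappa>"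
    "\<And>x \<alpha> \<beta>. x \<in> closure (Omega A a b) \<Longrightarrow> \<alpha> \<in> {-d..d} \<Longrightarrow> \<beta> \<in> {-d..d} \<Longrightarrow>
       ((\<lambda>t. K (x, t, \<beta>)) has_real_derivative Ka (x, \<alpha>, \<beta>)) (at \<alpha> within {-d..d})"
proof -
  let ?S = "K_domain A d a b :: ('n point \<times> real \<times> real) set"
  obtain f' :: "'n point \<times> real \<times> real \<Rightarrow> ('n point \<times> real \<times> real) \<Rightarrow>\<^sub>L real"
    and f'' :: "'n point \<times> real \<times> real \<Rightarrow> ('n point \<times> real \<times> real) \<Rightarrow>\<^sub>L (('n point \<times> real \<times> real) \<Rightarrow>\<^sub>L real)"
    where f': "\<And>z. z \<in> ?S \<Longrightarrow> (K has_derivative blinfun_apply (f' z)) (at z within ?S)"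
      and f'': "\<And>z. z \<in> ?S \<Longrightarrow> (f' has_derivative blinfun_apply (f'' z)) (at z within ?S)"
    using K unfolding C2_on_def by blast
  have comp: "compact ?S" unfolding K_domain_eq[OF A ab] by (rule compact_cbox)
  have Kc: "continuous_on ?S K" using f' has_derivative_continuous by (force simp: continuous_on_eq_continuous_within)
  have f'c: "continuous_on ?S f'" using f'' has_derivative_continuous by (force simp: continuous_on_eq_continuous_within)
  have S_ne: "?S \<noteq> {}"
  proof -
    have "((0, a), (0, 0)) \<in> ?S"
      unfolding K_domain_def closure_Omega[OF A ab] using A ab d by (simp add: mem_box_cart)
    then show ?thesis by blast
  qed
  have fd: "frechet_derivative K (at z within ?S) = blinfun_apply (f' z)" if z: "z \<in> ?S" for z
  proof -
    have dfb: "K differentiable (at z within ?S)" using f'[OF z] by (rule differentiableI)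
    then have "(K has_derivative frechet_derivative K (at z within ?S)) (at z within ?S)"
      using frechet_derivative_works by blast
    then show ?thesis
      using f'[OF z] z unfolding K_domain_eq[OF A ab]
    proof (intro frechet_derivative_unique_within_closed_interval[where f = K])
      show "(((\<chi> i. - A), a), - d, - d) \<bullet> i < (((\<chi> i. A), b), d, d) \<bullet> i"
        if "i \<in> Basis" for i :: "'n point \<times> real \<times> real"
        using that A ab d by (auto simp: Basis_prod_def Basis_vec_def inner_axis)
    qed
  qed
  define ea :: "'n point \<times> real \<times> real" where "ea = (0, 1, 0)"
  have ea: "ea \<in> Basis" by (simp add: ea_def Basis_prod_def)
  \<comment> \<open>A real \<open>SUP\<close> is informative only over a bounded set; compactness of
    the box supplies boundedness.\<close>
  have bdd: "bdd_above ((\<lambda>z. \<bar>g z\<bar>) ` ?S)" if g: "continuous_on ?S g" for g :: "'n point \<times> real \<times> real \<Rightarrow> real"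
  proof -
    obtain B where "\<And>z. z \<in> ?S \<Longrightarrow> norm (g z) \<le> B" by (rule continuous_compact_bound[OF comp g]) blast
    then show ?thesis by (intro bdd_aboveI2) simp
  qed
  have fdc: "continuous_on ?S (\<lambda>z. blinfun_apply (f' z) e)" for e
    using f'c by (intro continuous_intros)
  have sup_ge: "\<bar>g z\<bar> \<le> (SUP z\<in>?S. \<bar>g z\<bar>)" if "continuous_on ?S g" "z \<in> ?S" for g :: "'n point \<times> real \<times> real \<Rightarrow> real" and z
    using bdd[OF that(1)] that(2) by (rule cSUP_upper2[where x = z]) auto
  have sup0: "0 \<le> (SUP z\<in>?S. \<bar>g z\<bar>)" if "continuous_on ?S g" for g :: "'n point \<times> real \<times> real \<Rightarrow> real"
    using sup_ge[OF that] S_ne by (meson abs_ge_zero ex_in_conv order_trans)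
  let ?s = "\<lambda>e. SUP z\<in>?S. \<bar>blinfun_apply (f' z) e\<bar>"
  have norm_eq: "\<kappa> = (SUP z\<in>?S. \<bar>K z\<bar>) + (\<Sum>e\<in>Basis. ?s e)"
    unfolding \<kappa>[symmetric] C1_norm_def using fd by (auto intro!: sum.cong SUP_cong)
  have "?s ea \<le> (\<Sum>e\<in>Basis. ?s e)"
    by (rule member_le_sum[OF ea]) (use sup0[OF fdc] in auto)
  then have k1: "?s ea \<le> \<kappa>" using sup0[OF Kc] norm_eq by linarith
  have k0: "(SUP z\<in>?S. \<bar>K z\<bar>) \<le> \<kappa>" using norm_eq sum_nonneg[of Basis ?s] sup0[OF fdc] by simp
  show thesis
  proof
    show "continuous_on ?S K" by fact
    show "continuous_on ?S (\<lambda>z. blinfun_apply (f' z) ea)" by (rule fdc)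
    show "\<bar>K z\<bar> \<le> \<kappa>" if "z \<in> ?S" for z using sup_ge[OF Kc that] k0 by linarith
    show "\<bar>blinfun_apply (f' z) ea\<bar> \<le> \<kappa>" if "z \<in> ?S" for z using sup_ge[OF fdc that, of ea] k1 by linarith
    fix x :: "'n point" and \<alpha> \<beta> :: real assume x: "x \<in> closure (Omega A a b)" and \<alpha>: "\<alpha> \<in> {-d..d}" and \<beta>: "\<beta> \<in> {-d..d}"
    let ?g = "\<lambda>t. (x, t, \<beta>)"
    have g: "(?g has_derivative (\<lambda>h. (0, h, 0))) (at \<alpha> within {-d..d})"
      by (intro derivative_intros)
    have sub: "?g ` {-d..d} \<subseteq> ?S" using x \<beta> by (auto simp: K_domain_def)
    have "(K has_derivative blinfun_apply (f' (?g \<alpha>))) (at (?g \<alpha>) within ?g ` {-d..d})"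
      by (rule has_derivative_subset[OF f' sub]) (use sub \<alpha> in blast)
    from has_derivative_in_compose[OF g this]
    have "((\<lambda>t. K (?g t)) has_derivative (\<lambda>h. blinfun_apply (f' (?g \<alpha>)) (0, h, 0))) (at \<alpha> within {-d..d})" .
    moreover have "blinfun_apply (f' (?g \<alpha>)) (0, h, 0) = blinfun_apply (f' (?g \<alpha>)) ea * h" for h
    proof -
      have "(0, h, 0) = h *\<^sub>R ea" by (simp add: ea_def)
      then show ?thesis by (simp add: blinfun.scaleR_right)
    qed
    ultimately show "((\<lambda>t. K (x, t, \<beta>)) has_real_derivative blinfun_apply (f' (x, \<alpha>, \<beta>)) ea) (at \<alpha> within {-d..d})"
      by (simp add: has_field_derivative_def mult_commute_abs)
  qed
qed

text \<open>A single \<open>B\<close> dominates kernel, weights and basis, so all later constants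
  are expressions in \<open>B\<close>, d and \<rho> that can be written down before K is given. The
  parameter \<open>NT\<close> fixes the type \<open>'N\<close>, which no other parameter
  mentions.\<close>

locale kernel_data =
  fixes A d a b B :: real and \<mu> :: "'n::{finite,linorder} point \<Rightarrow> real"
    and K Ka :: "'n point \<times> real \<times> real \<Rightarrow> real" and NT :: "'N::{finite,linorder} itself"
  assumes A0: "0 < A" and d0: "0 < d" and a0: "0 < a" and ab: "a < b" and B0: "0 \<le> B"
    and \<mu>_cont: "continuous_on UNIV \<mu>"
    and K_cont: "continuous_on (K_domain A d a b) K" and Ka_cont: "continuous_on (K_domain A d a b) Ka"
    and K_bound: "z \<in> K_domain A d a b \<Longrightarrow> \<bar>K z\<bar> \<le> B" and Ka_bound: "z \<in> K_domain A d a b \<Longrightarrow> \<bar>Ka z\<bar> \<le> B"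
    and K_deriv: "x \<in> closure (Omega A a b) \<Longrightarrow> \<alpha> \<in> {-d..d} \<Longrightarrow> \<beta> \<in> {-d..d} \<Longrightarrow>
       ((\<lambda>t. K (x, t, \<beta>)) has_real_derivative Ka (x, \<alpha>, \<beta>)) (at \<alpha> within {-d..d})"
    and psi_bound: "t \<in> {-d..d} \<Longrightarrow> norm (psi d t :: 'N::{finite,linorder} rvec) \<le> B"
    and dpsi_bound: "t \<in> {-d..d} \<Longrightarrow> norm (dpsi d t :: 'N::{finite,linorder} rvec) \<le> B"
    and psi_diff_bound: "s \<in> {-d..d} \<Longrightarrow> t \<in> {-d..d} \<Longrightarrow> norm (psi d t - psi d s :: 'N::{finite,linorder} rvec) \<le> B"
    and \<mu>_bound: "x \<in> closure (Omega A a b) \<Longrightarrow> \<bar>\<mu> x\<bar> \<le> B"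
    and weight_bound: "x \<in> closure (Omega A a b) \<Longrightarrow> t \<in> {-d..d} \<Longrightarrow>
       norm ((\<mu> x / snd (nu x t)) *\<^sub>R (psi d t :: 'N::{finite,linorder} rvec)) \<le> B"
begin

abbreviation \<Omega> :: "'n point set" where "\<Omega> \<equiv> closure (Omega A a b)"

abbreviation sq :: "(real \<times> real) set" where "sq \<equiv> cbox (- d, - d) (d, d)"

definition wvec :: "'n point \<Rightarrow> real \<Rightarrow> 'N rvec" where
  "wvec x t = (\<mu> x / snd (nu x t)) *\<^sub>R psi d t"

definition kv :: "'N rvec \<Rightarrow> 'n point \<Rightarrow> real \<times> real \<Rightarrow> real" where
  "kv W x p = kval W (dpsi d (fst p)) (K (x, p)) (Ka (x, p)) (psi d (snd p) - psi d (fst p))"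

definition kg :: "'N rvec \<Rightarrow> 'n point \<Rightarrow> real \<times> real \<Rightarrow> 'N rvec" where
  "kg W x p = kgrad W (dpsi d (fst p)) (K (x, p)) (Ka (x, p)) (psi d (snd p) - psi d (fst p))"

text \<open>Row k is the W-gradient of component k of F, obtained by differentiating the kernel
  under the integral.\<close>

definition DF_mat :: "'n point \<Rightarrow> 'N rvec \<Rightarrow> 'N rmat" where
  "DF_mat x W = (\<chi> k. integral sq (\<lambda>p. (wvec x (fst p) $ k) *\<^sub>R kg W x p))"

text \<open>Area of the square times kernel bound times weight bound.\<close>

definition CF :: "real \<Rightarrow> real" where "CF \<rho> = (2 * d)\<^sup>2 * (kconst B \<rho> * B)"

lemma snd_pos: "x \<in> \<Omega> \<Longrightarrow> 0 < snd x"
  using a0 by (auto simp: closure_Omega[OF A0 ab])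

lemma sq_eq: "sq = {-d..d} \<times> {-d..d}"
  unfolding interval_cbox cbox_Pair_eq by (rule refl)

lemma sq_memD: "p \<in> sq \<Longrightarrow> fst p \<in> {-d..d}" "p \<in> sq \<Longrightarrow> snd p \<in> {-d..d}"
  unfolding sq_eq by (auto simp: mem_Times_iff)

lemma K_memI: "x \<in> \<Omega> \<Longrightarrow> p \<in> sq \<Longrightarrow> (x, p) \<in> K_domain A d a b"
  using sq_memD[of p] by (cases p) (auto simp: K_domain_def)

lemma content_sq: "measure lborel sq = (2 * d)\<^sup>2"
  using d0 by (simp add: content_Pair power2_eq_square)

lemma integral_sq_bound:
  fixes f :: "real \<times> real \<Rightarrow> 'v::euclidean_space"
  assumes f: "continuous_on sq f" and C: "0 \<le> C" "\<And>p. p \<in> sq \<Longrightarrow> norm (f p) \<le> C"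
  shows "norm (integral sq f) \<le> (2 * d)\<^sup>2 * C"
  using has_integral_bound[OF C(1) integrable_integral[OF integrable_continuous[OF f]] C(2)]
  by (simp add: content_sq mult.commute)

lemma continuous_on_wvec:
  assumes "continuous_on S f" "continuous_on S g" "\<And>z. z \<in> S \<Longrightarrow> f z \<in> \<Omega>"
  shows "continuous_on S (\<lambda>z. wvec (f z) (g z))"
proof -
  have "continuous_on S (\<lambda>z. \<mu> (f z))" by (rule continuous_on_compose2[OF \<mu>_cont assms(1)]) auto
  then show ?thesis
    unfolding wvec_def
    by (intro continuous_intros continuous_on_nu continuous_on_psi assms)
       (use snd_pos[OF assms(3)] snd_nu_pos[OF snd_pos[OF assms(3)]] in \<open>auto simp: less_imp_neq[THEN not_sym]\<close>)
qed

lemma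
  assumes "continuous_on S w" "continuous_on S f" "continuous_on S g" "\<And>z. z \<in> S \<Longrightarrow> f z \<in> \<Omega>" "\<And>z. z \<in> S \<Longrightarrow> g z \<in> sq"
  shows continuous_on_kv: "continuous_on S (\<lambda>z. kv (w z) (f z) (g z))"
    and continuous_on_kg: "continuous_on S (\<lambda>z. kg (w z) (f z) (g z))"
proof -
  have c: "continuous_on S (\<lambda>z. (f z, g z))" by (intro continuous_intros assms)
  have sub: "(\<lambda>z. (f z, g z)) ` S \<subseteq> K_domain A d a b"
    by (rule image_subsetI) (intro K_memI assms(4,5))
  have "continuous_on S (\<lambda>z. K (f z, g z))" "continuous_on S (\<lambda>z. Ka (f z, g z))"
    by (rule continuous_on_compose2[OF K_cont c sub] continuous_on_compose2[OF Ka_cont c sub])+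
  note k = this
  show "continuous_on S (\<lambda>z. kv (w z) (f z) (g z))"
    unfolding kv_def by (intro continuous_on_kval continuous_on_diff continuous_on_psi continuous_on_dpsi continuous_intros assms(1-3) k)
  show "continuous_on S (\<lambda>z. kg (w z) (f z) (g z))"
    unfolding kg_def by (intro continuous_on_kgrad continuous_on_diff continuous_on_psi continuous_on_dpsi continuous_intros assms(1-3) k)
qed

lemma
  assumes x: "x \<in> \<Omega>"
  shows kv_cont: "continuous_on sq (kv W x)" and kg_cont: "continuous_on sq (kg W x)"
    and wvec_cont: "continuous_on sq (\<lambda>p. wvec x (fst p))"
  using x by (auto intro!: continuous_on_kv[of _ "\<lambda>_. W" "\<lambda>_. x" "\<lambda>p. p"] continuous_on_kg[of _ "\<lambda>_. W" "\<lambda>_. x" "\<lambda>p. p"]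
      continuous_on_wvec[of _ "\<lambda>_. x" fst] continuous_intros)

lemma wvec_norm_le: "x \<in> \<Omega> \<Longrightarrow> p \<in> sq \<Longrightarrow> norm (wvec x (fst p)) \<le> B"
  unfolding wvec_def by (rule weight_bound[OF _ sq_memD(1)])

lemma kernel_section_continuous:
  assumes "x \<in> \<Omega>" "\<alpha> \<in> {-d..d}"
  shows "continuous_on {-d..d} (\<lambda>\<beta>. K (x, \<alpha>, \<beta>))" "continuous_on {-d..d} (\<lambda>\<beta>. Ka (x, \<alpha>, \<beta>))"
  using assms by (auto intro!: continuous_on_compose2[OF Ka_cont] continuous_on_compose2[OF K_cont] continuous_intros simp: K_domain_def)

text \<open>Stated for interior \<alpha> because K is controlled only on the closed box; at \<alpha>
  = -d and \<alpha> = d a two-sided derivative need not exist.\<close>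

lemma deriv_exp_kernel:
  assumes x: "x \<in> \<Omega>" and \<alpha>: "\<alpha> \<in> {-d<..<d}"
  shows "deriv (\<lambda>t. exp (- expand d W t) * integral {-d..d} (\<lambda>\<beta>. K (x, t, \<beta>) * exp (expand d W \<beta>))) \<alpha>
    = exp (- expand d W \<alpha>) * integral {-d..d} (\<lambda>\<beta>. Ka (x, \<alpha>, \<beta>) * exp (expand d W \<beta>))
      - (W \<bullet> dpsi d \<alpha>) * exp (- expand d W \<alpha>) * integral {-d..d} (\<lambda>\<beta>. K (x, \<alpha>, \<beta>) * exp (expand d (W :: 'N rvec) \<beta>))"
proof -
  have \<alpha>': "\<alpha> \<in> {-d..d}" using \<alpha> by auto
  have c: "continuous_on ({-d..d} \<times> {-d..d}) (\<lambda>p. Ka (x, p))" "continuous_on ({-d..d} \<times> {-d..d}) (\<lambda>p. K (x, p))"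
    using x by (auto intro!: continuous_on_compose2[OF Ka_cont] continuous_on_compose2[OF K_cont] continuous_intros simp: K_domain_def)
  have e: "continuous_on S f \<Longrightarrow> continuous_on S (\<lambda>z. exp (expand d W (f z)))" for S and f :: "'q::topological_space \<Rightarrow> real"
    unfolding expand_eq by (intro continuous_intros continuous_on_psi)
  have "((\<lambda>t. integral (cbox (-d) d) (\<lambda>\<beta>. K (x, t, \<beta>) * exp (expand d W \<beta>))) has_field_derivative
      integral (cbox (-d) d) (\<lambda>\<beta>. Ka (x, \<alpha>, \<beta>) * exp (expand d W \<beta>))) (at \<alpha> within {-d..d})"
  proof (rule leibniz_rule_field_derivative[OF _ _ _ \<alpha>'])
    fix t \<beta> assume t: "t \<in> {-d..d}" and \<beta>: "\<beta> \<in> cbox (-d) d"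
    show "((\<lambda>t. K (x, t, \<beta>) * exp (expand d W \<beta>)) has_real_derivative Ka (x, t, \<beta>) * exp (expand d W \<beta>)) (at t within {-d..d})"
      using K_deriv[OF x t, of \<beta>] \<beta> by (intro DERIV_cmult_right) auto
  next
    fix t assume t: "t \<in> {-d..d}"
    have "continuous_on (cbox (-d) d) (\<lambda>\<beta>. K (x, t, \<beta>))"
      using kernel_section_continuous(1)[OF x t] unfolding interval_cbox .
    then show "(\<lambda>\<beta>. K (x, t, \<beta>) * exp (expand d W \<beta>)) integrable_on cbox (-d) d"
      by (intro integrable_continuous continuous_intros e)
  next
    show "continuous_on ({-d..d} \<times> cbox (-d) d) (\<lambda>(t, \<beta>). Ka (x, t, \<beta>) * exp (expand d W \<beta>))"
      using c(1) unfolding cbox_interval case_prod_beta prod.collapse by (intro continuous_intros e) auto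
  qed simp
  then have I: "((\<lambda>t. integral {-d..d} (\<lambda>\<beta>. K (x, t, \<beta>) * exp (expand d W \<beta>))) has_real_derivative
      integral {-d..d} (\<lambda>\<beta>. Ka (x, \<alpha>, \<beta>) * exp (expand d W \<beta>))) (at \<alpha>)"
    using at_within_interior[of \<alpha> "{-d..d}"] \<alpha> by (simp add: interior_atLeastAtMost_real)
  have E: "((\<lambda>t. exp (- expand d W t)) has_real_derivative exp (- expand d W \<alpha>) * (- (W \<bullet> dpsi d \<alpha>))) (at \<alpha>)"
    by (intro DERIV_chain2[OF DERIV_exp] DERIV_minus expand_has_derivative)
  show ?thesis
    using DERIV_imp_deriv[OF DERIV_mult[OF E I]] by (simp add: algebra_simps)
qed

lemma kernel_section_integrable:
  assumes "x \<in> \<Omega>" "\<alpha> \<in> {-d..d}"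
  shows "(\<lambda>\<beta>. K (x, \<alpha>, \<beta>) * exp (expand d W \<beta>)) integrable_on {-d..d}"
    "(\<lambda>\<beta>. Ka (x, \<alpha>, \<beta>) * exp (expand d (W :: 'N rvec) \<beta>)) integrable_on {-d..d}"
proof -
  have e: "continuous_on {-d..d} (\<lambda>\<beta>. exp (expand d W \<beta>))"
    unfolding expand_eq by (intro continuous_intros continuous_on_psi)
  show "(\<lambda>\<beta>. K (x, \<alpha>, \<beta>) * exp (expand d W \<beta>)) integrable_on {-d..d}"
    by (intro integrable_continuous_interval continuous_on_mult e kernel_section_continuous assms)
  show "(\<lambda>\<beta>. Ka (x, \<alpha>, \<beta>) * exp (expand d W \<beta>)) integrable_on {-d..d}"
    by (intro integrable_continuous_interval continuous_on_mult e kernel_section_continuous assms)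
qed

text \<open>Product rule and Leibniz rule give two inner integrals over \<beta>; with the leading
  minus sign of F they merge into one integral of \<open>kval\<close>, and continuity on the square
  turns the iterated integral into a double one.\<close>

lemma F_fun_eq:
  assumes x: "x \<in> \<Omega>"
  shows "F_fun d K \<mu> W x = integral sq (\<lambda>p. kv W x p *\<^sub>R wvec x (fst p))"
proof (rule vec_eq_iff[THEN iffD2], rule allI)
  fix k :: 'N
  have c: "continuous_on sq (\<lambda>p. kv W x p *\<^sub>R wvec x (fst p))" by (intro continuous_intros kv_cont[OF x] wvec_cont[OF x])
  have ck: "continuous_on sq (\<lambda>p. kv W x p * wvec x (fst p) $ k)"
    by (intro continuous_intros kv_cont[OF x] wvec_cont[OF x])
  have "integral sq (\<lambda>p. kv W x p *\<^sub>R wvec x (fst p)) $ k = integral sq (\<lambda>p. kv W x p * wvec x (fst p) $ k)"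
    using integral_component_eq_cart[OF integrable_continuous[OF c]] by simp
  also have "\<dots> = integral {-d..d} (\<lambda>\<alpha>. integral {-d..d} (\<lambda>\<beta>. kv W x (\<alpha>, \<beta>) * wvec x \<alpha> $ k))"
    using integral_prod_continuous[OF ck] by (simp add: cbox_interval)
  also have "\<dots> = integral {-d..d} (\<lambda>\<alpha>. - (\<mu> x / snd (nu x \<alpha>)
     * deriv (\<lambda>t. exp (- expand d W t) * integral {-d..d} (\<lambda>\<beta>. K (x, t, \<beta>) * exp (expand d W \<beta>))) \<alpha> * Psi d (idx k) \<alpha>))"
  \<comment> \<open>The two endpoints, where \<open>deriv\<close> is uncontrolled, form a null
    set.\<close>
  proof (rule integral_spike[of "{-d, d}"])
    fix \<alpha> assume "\<alpha> \<in> {-d..d} - {-d, d}"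
    then have \<alpha>: "\<alpha> \<in> {-d<..<d}" and \<alpha>': "\<alpha> \<in> {-d..d}" by auto
    let ?e = "exp (- expand d W \<alpha>)" and ?c = "wvec x \<alpha> $ k"
    let ?I = "integral {-d..d} (\<lambda>\<beta>. K (x, \<alpha>, \<beta>) * exp (expand d W \<beta>))"
      and ?I' = "integral {-d..d} (\<lambda>\<beta>. Ka (x, \<alpha>, \<beta>) * exp (expand d W \<beta>))"
    have "integral {-d..d} (\<lambda>\<beta>. kv W x (\<alpha>, \<beta>) * ?c)
       = integral {-d..d} (\<lambda>\<beta>. (?c * (W \<bullet> dpsi d \<alpha>) * ?e) * (K (x, \<alpha>, \<beta>) * exp (expand d W \<beta>)) - (?c * ?e) * (Ka (x, \<alpha>, \<beta>) * exp (expand d W \<beta>)))"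
      by (intro integral_cong)
         (simp add: kv_def kval_def expand_eq inner_diff_right exp_diff exp_minus field_simps)
    also have "\<dots> = (?c * (W \<bullet> dpsi d \<alpha>) * ?e) * ?I - (?c * ?e) * ?I'"
      using kernel_section_integrable[OF x \<alpha>', of W]
      by (subst Henstock_Kurzweil_Integration.integral_diff) (auto intro: integrable_on_mult_right)
    also have "\<dots> = - (?c * (?e * ?I' - (W \<bullet> dpsi d \<alpha>) * ?e * ?I))" by (simp add: algebra_simps)
    finally have "integral {-d..d} (\<lambda>\<beta>. kv W x (\<alpha>, \<beta>) * ?c) = - (?c * (?e * ?I' - (W \<bullet> dpsi d \<alpha>) * ?e * ?I))" .
    then show "- (\<mu> x / snd (nu x \<alpha>) * deriv (\<lambda>t. exp (- expand d W t) * integral {-d..d} (\<lambda>\<beta>. K (x, t, \<beta>) * exp (expand d W \<beta>))) \<alpha>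
       * Psi d (idx k) \<alpha>) = integral {-d..d} (\<lambda>\<beta>. kv W x (\<alpha>, \<beta>) * wvec x \<alpha> $ k)"
      unfolding deriv_exp_kernel[OF x \<alpha>] by (simp add: wvec_def psi_def)
  qed (simp add: negligible_finite)
  also have "\<dots> = F_fun d K \<mu> W x $ k" unfolding F_fun_def by simp
  finally show "F_fun d K \<mu> W x $ k = integral sq (\<lambda>p. kv W x p *\<^sub>R wvec x (fst p)) $ k" ..
qed

lemma DF_mat_mult:
  assumes x: "x \<in> \<Omega>"
  shows "DF_mat x W *v V = integral sq (\<lambda>p. (V \<bullet> kg W x p) *\<^sub>R wvec x (fst p))"
proof (rule vec_eq_iff[THEN iffD2], rule allI)
  fix k :: 'N
  have c: "continuous_on sq (\<lambda>p. (V \<bullet> kg W x p) *\<^sub>R wvec x (fst p))"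
    by (intro continuous_intros kg_cont[OF x] wvec_cont[OF x])
  have ck: "continuous_on sq (\<lambda>p. (wvec x (fst p) $ k) *\<^sub>R kg W x p)"
    by (intro continuous_intros kg_cont[OF x] wvec_cont[OF x])
  have "(DF_mat x W *v V) $ k = V \<bullet> integral sq (\<lambda>p. (wvec x (fst p) $ k) *\<^sub>R kg W x p)"
    by (simp add: DF_mat_def matrix_vector_mult_def inner_vec_def mult.commute)
  also have "\<dots> = integral sq (\<lambda>p. V \<bullet> ((wvec x (fst p) $ k) *\<^sub>R kg W x p))"
    using integral_linear[OF integrable_continuous[OF ck] bounded_linear_inner_right[of V]] by (simp add: o_def)
  also have "\<dots> = integral sq (\<lambda>p. (V \<bullet> kg W x p) *\<^sub>R wvec x (fst p)) $ k"
    using integral_component_eq_cart[OF integrable_continuous[OF c]] by (simp add: mult.commute)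
  finally show "(DF_mat x W *v V) $ k = integral sq (\<lambda>p. (V \<bullet> kg W x p) *\<^sub>R wvec x (fst p)) $ k" .
qed

lemma F_fun_continuous:
  assumes "continuous_on T w" "continuous_on T f" "\<And>y. y \<in> T \<Longrightarrow> f y \<in> \<Omega>"
  shows "continuous_on T (\<lambda>y. F_fun d K \<mu> (w y :: 'N rvec) (f y))"
proof -
  have "continuous_on T (\<lambda>y. integral sq (\<lambda>p. kv (w y) (f y) p *\<^sub>R wvec (f y) (fst p)))"
    unfolding cbox_Pair_eq[symmetric]
  proof (rule integral_continuous_on_param)
    have w: "continuous_on (T \<times> sq) (\<lambda>z. w (fst z))" "continuous_on (T \<times> sq) (\<lambda>z. f (fst z))"
      by (auto intro!: continuous_on_compose2[OF assms(1)] continuous_on_compose2[OF assms(2)] continuous_intros)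
    show "continuous_on (T \<times> sq) (\<lambda>(y, p). kv (w y) (f y) p *\<^sub>R wvec (f y) (fst p))"
      unfolding case_prod_beta
      by (intro continuous_on_scaleR continuous_on_kv continuous_on_wvec w continuous_intros) (use assms(3) in auto)
  qed
  then show ?thesis by (rule continuous_on_eq) (simp add: F_fun_eq assms(3))
qed

lemma DF_mat_continuous:
  assumes "continuous_on T w" "continuous_on T f" "\<And>y. y \<in> T \<Longrightarrow> f y \<in> \<Omega>"
  shows "continuous_on T (\<lambda>y. DF_mat (f y) (w y))"
  unfolding DF_mat_def
proof (intro continuous_on_vec_lambda integral_continuous_on_param)
  fix k :: 'N
  have w: "continuous_on (T \<times> sq) (\<lambda>z. w (fst z))" "continuous_on (T \<times> sq) (\<lambda>z. f (fst z))"
    by (auto intro!: continuous_on_compose2[OF assms(1)] continuous_on_compose2[OF assms(2)] continuous_intros)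
  show "continuous_on (T \<times> sq) (\<lambda>(y, p). (wvec (f y) (fst p) $ k) *\<^sub>R kg (w y) (f y) p)"
    unfolding case_prod_beta
    by (intro continuous_on_scaleR continuous_on_kg continuous_on_component continuous_on_wvec w continuous_intros) (use assms(3) in auto)
qed

lemma kernel_bounds:
  assumes "x \<in> \<Omega>" "p \<in> sq"
  shows "norm (dpsi d (fst p) :: 'N rvec) \<le> B" "norm (psi d (snd p) - psi d (fst p) :: 'N rvec) \<le> B"
    "\<bar>K (x, p)\<bar> \<le> B" "\<bar>Ka (x, p)\<bar> \<le> B"
  using dpsi_bound[OF sq_memD(1)[OF assms(2)]] psi_diff_bound[OF sq_memD[OF assms(2)]]
    K_bound[OF K_memI[OF assms]] Ka_bound[OF K_memI[OF assms]] by auto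

lemma DF_mat_bound:
  assumes x: "x \<in> \<Omega>" and W: "norm W \<le> \<rho>"
  shows "norm (DF_mat x W *v V) \<le> CF \<rho> * norm V"
proof -
  have \<rho>: "0 \<le> \<rho>" using W norm_ge_zero[of W] by linarith
  have "norm (integral sq (\<lambda>p. (V \<bullet> kg W x p) *\<^sub>R wvec x (fst p))) \<le> (2 * d)\<^sup>2 * ((norm V * kconst B \<rho>) * B)"
  proof (rule integral_sq_bound)
    show "continuous_on sq (\<lambda>p. (V \<bullet> kg W x p) *\<^sub>R wvec x (fst p))"
      by (intro continuous_intros kg_cont[OF x] wvec_cont[OF x])
    show "0 \<le> norm V * kconst B \<rho> * B" using kconst_nonneg[OF B0 \<rho>] B0 by simp
    fix p assume p: "p \<in> sq"
    have "\<bar>V \<bullet> kg W x p\<bar> \<le> norm V * kconst B \<rho>"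
      unfolding kg_def
      by (intro order_trans[OF Cauchy_Schwarz_ineq2] mult_left_mono kgrad_norm_le kernel_bounds[OF x p] W B0 \<rho>) auto
    then show "norm ((V \<bullet> kg W x p) *\<^sub>R wvec x (fst p)) \<le> norm V * kconst B \<rho> * B"
      unfolding norm_scaleR using kconst_nonneg[OF B0 \<rho>] by (intro mult_mono wvec_norm_le x p) auto
  qed
  then show ?thesis unfolding DF_mat_mult[OF x] CF_def by (simp add: mult_ac)
qed

text \<open>The Taylor remainder of the kernel is quadratic in V uniformly on the square, hence so
  is its integral against the bounded weight.\<close>

lemma F_fun_taylor:
  assumes x: "x \<in> \<Omega>" and W: "norm W \<le> \<rho>" and V: "norm V \<le> \<rho>"
  shows "norm (F_fun d K \<mu> (W + V) x - F_fun d K \<mu> W x - DF_mat x W *v V) \<le> CF \<rho> * (norm V)\<^sup>2"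
proof -
  have \<rho>: "0 \<le> \<rho>" using W norm_ge_zero[of W] by linarith
  have c: "continuous_on sq (\<lambda>p. kv U x p *\<^sub>R wvec x (fst p))" "continuous_on sq (\<lambda>p. (U \<bullet> kg W x p) *\<^sub>R wvec x (fst p))" for U
    by (intro continuous_on_scaleR continuous_on_inner continuous_on_const kv_cont[OF x] kg_cont[OF x] wvec_cont[OF x])+
  have "F_fun d K \<mu> (W + V) x - F_fun d K \<mu> W x - DF_mat x W *v V
    = integral sq (\<lambda>p. kv (W + V) x p *\<^sub>R wvec x (fst p) - kv W x p *\<^sub>R wvec x (fst p) - (V \<bullet> kg W x p) *\<^sub>R wvec x (fst p))"
    unfolding F_fun_eq[OF x] DF_mat_mult[OF x]
    by (subst Henstock_Kurzweil_Integration.integral_diff, intro integrable_diff integrable_continuous c, rule integrable_continuous, rule c,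
        subst Henstock_Kurzweil_Integration.integral_diff, rule integrable_continuous, rule c, rule integrable_continuous, rule c, rule refl)
  also have "\<dots> = integral sq (\<lambda>p. (kv (W + V) x p - kv W x p - V \<bullet> kg W x p) *\<^sub>R wvec x (fst p))"
    by (simp add: scaleR_diff_left)
  also have "norm \<dots> \<le> (2 * d)\<^sup>2 * ((kconst B \<rho> * (norm V)\<^sup>2) * B)"
  proof (rule integral_sq_bound)
    show "continuous_on sq (\<lambda>p. (kv (W + V) x p - kv W x p - V \<bullet> kg W x p) *\<^sub>R wvec x (fst p))"
      by (intro continuous_intros kv_cont[OF x] kg_cont[OF x] wvec_cont[OF x])
    show "0 \<le> kconst B \<rho> * (norm V)\<^sup>2 * B" using kconst_nonneg[OF B0 \<rho>] B0 by simp
    fix p assume p: "p \<in> sq"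
    have "\<bar>kv (W + V) x p - kv W x p - V \<bullet> kg W x p\<bar> \<le> kconst B \<rho> * (norm V)\<^sup>2"
      unfolding kv_def kg_def by (intro kval_taylor kernel_bounds[OF x p] W V B0 \<rho>)
    then show "norm ((kv (W + V) x p - kv W x p - V \<bullet> kg W x p) *\<^sub>R wvec x (fst p)) \<le> kconst B \<rho> * (norm V)\<^sup>2 * B"
      unfolding norm_scaleR using kconst_nonneg[OF B0 \<rho>] by (intro mult_mono wvec_norm_le x p) auto
  qed
  finally show ?thesis by (simp add: CF_def mult_ac)
qed

lemma F_fun_zero_bound:
  assumes x: "x \<in> \<Omega>"
  shows "norm (F_fun d K \<mu> (0 :: 'N rvec) x) \<le> (2 * d)\<^sup>2 * (B * B)"
  unfolding F_fun_eq[OF x]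
proof (rule integral_sq_bound)
  show "continuous_on sq (\<lambda>p. kv 0 x p *\<^sub>R wvec x (fst p))"
    by (intro continuous_intros kv_cont[OF x] wvec_cont[OF x])
  fix p assume p: "p \<in> sq"
  have "\<bar>kv 0 x p\<bar> \<le> B" using kernel_bounds[OF x p] by (simp add: kv_def kval_def)
  then show "norm (kv 0 x p *\<^sub>R wvec x (fst p)) \<le> B * B"
    unfolding norm_scaleR using B0 by (intro mult_mono wvec_norm_le x p) auto
qed (use B0 in simp)

text \<open>The nonlinear part of the reconstruction formula is the integral of the same kernel
  with \<open>\<xi> = 0\<close>, \<open>k = 0\<close> and \<open>l = - K\<close>.\<close>

lemma reconstruct_nonlinear_eq:
  assumes x: "x \<in> \<Omega>"
  shows "integral {-d..d} (\<lambda>\<alpha>. exp (- expand d W \<alpha>) * \<mu> x * integral {-d..d} (\<lambda>\<beta>. K (x, \<alpha>, \<beta>) * exp (expand d W \<beta>)))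
    = integral sq (\<lambda>p. \<mu> x * kval (W :: 'N rvec) 0 0 (- K (x, p)) (psi d (snd p) - psi d (fst p)))"
proof -
  have c: "continuous_on sq (\<lambda>p. \<mu> x * kval W 0 0 (- K (x, p)) (psi d (snd p) - psi d (fst p)))"
    using x K_memI
    by (intro continuous_on_mult continuous_on_kval continuous_intros continuous_on_psi continuous_on_compose2[OF K_cont]) auto
  have "integral {-d..d} (\<lambda>\<beta>. \<mu> x * kval W 0 0 (- K (x, \<alpha>, \<beta>)) (psi d \<beta> - psi d \<alpha>))
    = exp (- expand d W \<alpha>) * \<mu> x * integral {-d..d} (\<lambda>\<beta>. K (x, \<alpha>, \<beta>) * exp (expand d W \<beta>))" for \<alpha>
    unfolding integral_mult_right[symmetric]
    by (intro integral_cong) (simp add: kval_def expand_eq inner_diff_right exp_diff exp_minus field_simps)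
  moreover have "integral sq (\<lambda>p. \<mu> x * kval W 0 0 (- K (x, p)) (psi d (snd p) - psi d (fst p)))
    = integral {-d..d} (\<lambda>\<alpha>. integral {-d..d} (\<lambda>\<beta>. \<mu> x * kval W 0 0 (- K (x, \<alpha>, \<beta>)) (psi d \<beta> - psi d \<alpha>)))"
    unfolding interval_cbox using integral_prod_continuous[OF c] by (simp only: fst_conv snd_conv)
  ultimately show ?thesis by (simp only:)
qed

lemma reconstruct_nonlinear_lipschitz:
  assumes x: "x \<in> \<Omega>" and W: "norm W \<le> \<rho>" and V: "norm (W' - W) \<le> \<rho>"
  shows "\<bar>integral sq (\<lambda>p. \<mu> x * kval (W' :: 'N rvec) 0 0 (- K (x, p)) (psi d (snd p) - psi d (fst p)))
     - integral sq (\<lambda>p. \<mu> x * kval W 0 0 (- K (x, p)) (psi d (snd p) - psi d (fst p)))\<bar>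
     \<le> (2 * d)\<^sup>2 * (B * (kconst B \<rho> * (1 + \<rho>) * norm (W' - W)))"
proof -
  have \<rho>: "0 \<le> \<rho>" using W norm_ge_zero[of W] by linarith
  have c: "continuous_on sq (\<lambda>p. \<mu> x * kval W 0 0 (- K (x, p)) (psi d (snd p) - psi d (fst p)))" for W :: "'N rvec"
    using x K_memI
    by (intro continuous_on_mult continuous_on_kval continuous_intros continuous_on_psi continuous_on_compose2[OF K_cont]) auto
  have "norm (integral sq (\<lambda>p. \<mu> x * kval W' 0 0 (- K (x, p)) (psi d (snd p) - psi d (fst p))
     - \<mu> x * kval W 0 0 (- K (x, p)) (psi d (snd p) - psi d (fst p))))
     \<le> (2 * d)\<^sup>2 * (B * (kconst B \<rho> * (1 + \<rho>) * norm (W' - W)))"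
  proof (rule integral_sq_bound)
    fix p assume p: "p \<in> sq"
    have "\<bar>kval (W + (W' - W)) 0 0 (- K (x, p)) (psi d (snd p) - psi d (fst p)) - kval W 0 0 (- K (x, p)) (psi d (snd p) - psi d (fst p))\<bar>
      \<le> kconst B \<rho> * (1 + \<rho>) * norm (W' - W)"
      by (rule kval_lipschitz) (use kernel_bounds[OF x p] B0 \<rho> W V in auto)
    then show "norm (\<mu> x * kval W' 0 0 (- K (x, p)) (psi d (snd p) - psi d (fst p))
      - \<mu> x * kval W 0 0 (- K (x, p)) (psi d (snd p) - psi d (fst p))) \<le> B * (kconst B \<rho> * (1 + \<rho>) * norm (W' - W))"
      unfolding right_diff_distrib[symmetric] real_norm_def abs_mult
      using \<mu>_bound[OF x] B0 by (intro mult_mono) auto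
  qed (use c kconst_nonneg[OF B0 \<rho>] \<rho> B0 in \<open>auto intro!: continuous_on_diff\<close>)
  then show ?thesis
    by (subst Henstock_Kurzweil_Integration.integral_diff[symmetric]) (auto intro: integrable_continuous c)
qed

text \<open>Directions have norm at most 1 and the expansion is linear in its coefficients, so only
  the bound on the basis and the length 2 d of the interval remain.\<close>

lemma reconstruct_linear_lipschitz:
  fixes p q :: "'n \<Rightarrow> 'N rvec" and u v :: "'N rvec"
  assumes x: "x \<in> \<Omega>"
  shows "\<bar>integral {-d..d} (\<lambda>\<alpha>. nu x \<alpha> \<bullet> ((\<chi> i. expand d (p i) \<alpha>), expand d u \<alpha>))
    - integral {-d..d} (\<lambda>\<alpha>. nu x \<alpha> \<bullet> ((\<chi> i. expand d (q i) \<alpha>), expand d v \<alpha>))\<bar>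
    \<le> 2 * d * (B * ((\<Sum>i\<in>UNIV. norm (p i - q i)) + norm (u - v)))"
proof -
  let ?g = "\<lambda>(p :: 'n \<Rightarrow> 'N rvec) (u :: 'N rvec) \<alpha>. nu x \<alpha> \<bullet> ((\<chi> i. expand d (p i) \<alpha>), expand d u \<alpha>)"
  have c: "continuous_on {-d..d} (?g p u)" for p u
    unfolding expand_eq
    by (intro continuous_intros continuous_on_nu continuous_on_psi continuous_on_vec_lambda) (use snd_pos[OF x] in auto)
  have i: "?g p u integrable_on {-d..d}" for p u by (intro integrable_continuous_interval c)
  have "integral {-d..d} (?g p u) - integral {-d..d} (?g q v) = integral {-d..d} (\<lambda>\<alpha>. ?g p u \<alpha> - ?g q v \<alpha>)"
    by (rule Henstock_Kurzweil_Integration.integral_diff[symmetric, OF i i])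
  also have "norm \<dots> \<le> integral {-d..d} (\<lambda>\<alpha>. B * ((\<Sum>i\<in>UNIV. norm (p i - q i)) + norm (u - v)))"
  proof (rule integral_norm_bound_integral)
    fix \<alpha> assume \<alpha>: "\<alpha> \<in> {-d..d}"
    have eB: "\<bar>expand d w \<alpha>\<bar> \<le> B * norm w" for w :: "'N rvec"
      unfolding expand_eq using psi_bound[OF \<alpha>]
      by (intro order_trans[OF Cauchy_Schwarz_ineq2]) (simp add: mult.commute[of B] mult_left_mono)
    have lin: "expand d w \<alpha> - expand d w' \<alpha> = expand d (w - w') \<alpha>" for w w' :: "'N rvec"
      by (simp add: expand_eq inner_diff_left)
    have "norm (((\<chi> i. expand d (p i) \<alpha>), expand d u \<alpha>) - ((\<chi> i. expand d (q i) \<alpha>), expand d v \<alpha>))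
      \<le> norm ((\<chi> i. expand d (p i - q i) \<alpha>) :: real^'n::{finite,linorder}) + \<bar>expand d (u - v) \<alpha>\<bar>"
    proof -
      have "((\<chi> i. expand d (p i) \<alpha>), expand d u \<alpha>) - ((\<chi> i. expand d (q i) \<alpha>), expand d v \<alpha>)
         = ((\<chi> i. expand d (p i - q i) \<alpha>) :: real^'n::{finite,linorder}, expand d (u - v) \<alpha>)"
        by (simp add: lin[symmetric] vec_eq_iff)
      then show ?thesis using norm_Pair_le[of "(\<chi> i. expand d (p i - q i) \<alpha>) :: real^'n::{finite,linorder}" "expand d (u - v) \<alpha>"] by simp
    qed
    also have "norm ((\<chi> i. expand d (p i - q i) \<alpha>) :: real^'n::{finite,linorder}) \<le> (\<Sum>i\<in>UNIV. B * norm (p i - q i))"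
      by (rule order_trans[OF norm_le_l1_cart]) (simp add: eB sum_mono)
    also have "\<bar>expand d (u - v) \<alpha>\<bar> \<le> B * norm (u - v)" by (rule eB)
    finally have "norm (((\<chi> i. expand d (p i) \<alpha>), expand d u \<alpha>) - ((\<chi> i. expand d (q i) \<alpha>), expand d v \<alpha>))
      \<le> B * ((\<Sum>i\<in>UNIV. norm (p i - q i)) + norm (u - v))" by (simp add: sum_distrib_left distrib_left)
    then have "norm (nu x \<alpha>) * norm (((\<chi> i. expand d (p i) \<alpha>), expand d u \<alpha>) - ((\<chi> i. expand d (q i) \<alpha>), expand d v \<alpha>))
      \<le> 1 * (B * ((\<Sum>i\<in>UNIV. norm (p i - q i)) + norm (u - v)))"
      by (intro mult_mono norm_nu_le) auto
    then show "norm (?g p u \<alpha> - ?g q v \<alpha>) \<le> B * ((\<Sum>i\<in>UNIV. norm (p i - q i)) + norm (u - v))"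
      unfolding inner_diff_right[symmetric] real_norm_def
      by (intro order_trans[OF Cauchy_Schwarz_ineq2]) simp
  qed (intro integrable_diff i integrable_const_ivl)+
  also have "\<dots> = 2 * d * (B * ((\<Sum>i\<in>UNIV. norm (p i - q i)) + norm (u - v)))" using d0 by simp
  finally show ?thesis by simp
qed

text \<open>After division by 2 d, the first summand bounds the transport part; the second bounds
  the scattering part, whose square has area (2 d)^2.\<close>

definition CL :: "real \<Rightarrow> real" where "CL \<rho> = B + 2 * d * (B * (kconst B \<rho> * (1 + \<rho>)))"

lemma reconstruct_lipschitz:
  fixes W W' :: "('n, 'N) sdfun"
  assumes x: "grid_pt A m J y \<in> \<Omega>" and W: "norm (W J y) \<le> \<rho>" and V: "norm (W' J y - W J y) \<le> \<rho>"
  shows "\<bar>reconstruct A d m K \<mu> W' J y - reconstruct A d m K \<mu> W J y\<bar>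
    \<le> CL \<rho> * (norm (W' J y - W J y) + (\<Sum>i\<in>UNIV. norm (dx A m i W' J y - dx A m i W J y)) + norm (dy W' J y - dy W J y))"
proof -
  have \<rho>: "0 \<le> \<rho>" using W norm_ge_zero[of "W J y"] by linarith
  let ?x = "grid_pt A m J y" and ?S = "\<Sum>i\<in>UNIV. norm (dx A m i W' J y - dx A m i W J y)"
  let ?L = "\<lambda>W :: ('n, 'N) sdfun. integral {-d..d} (\<lambda>\<alpha>. nu ?x \<alpha> \<bullet> ((\<chi> i. expand d (dx A m i W J y) \<alpha>), expand d (dy W J y) \<alpha>))"
  let ?N = "\<lambda>W :: ('n, 'N) sdfun. integral sq (\<lambda>p. \<mu> ?x * kval (W J y) 0 0 (- K (?x, p)) (psi d (snd p) - psi d (fst p)))"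
  have r: "reconstruct A d m K \<mu> W J y = (1 / (2 * d)) * (?N W - ?L W)" for W :: "('n, 'N) sdfun"
    unfolding reconstruct_def Let_def reconstruct_nonlinear_eq[OF x] by (simp add: right_diff_distrib)
  have l: "\<bar>?L W' - ?L W\<bar> \<le> 2 * d * (B * (?S + norm (dy W' J y - dy W J y)))"
    by (rule reconstruct_linear_lipschitz[OF x])
  have n: "\<bar>?N W' - ?N W\<bar> \<le> (2 * d)\<^sup>2 * (B * (kconst B \<rho> * (1 + \<rho>) * norm (W' J y - W J y)))"
    by (rule reconstruct_nonlinear_lipschitz[OF x W V])
  have "\<bar>reconstruct A d m K \<mu> W' J y - reconstruct A d m K \<mu> W J y\<bar> = (1 / (2 * d)) * \<bar>(?N W' - ?N W) - (?L W' - ?L W)\<bar>"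
    unfolding r right_diff_distrib[symmetric] abs_mult using d0 by (simp add: algebra_simps)
  also have "\<dots> \<le> (1 / (2 * d)) * ((2 * d)\<^sup>2 * (B * (kconst B \<rho> * (1 + \<rho>) * norm (W' J y - W J y)))
     + 2 * d * (B * (?S + norm (dy W' J y - dy W J y))))"
    using l n d0 by (intro mult_left_mono) auto
  also have "\<dots> = 2 * d * (B * (kconst B \<rho> * (1 + \<rho>))) * norm (W' J y - W J y) + B * (?S + norm (dy W' J y - dy W J y))"
    using d0 by (simp add: field_simps power2_eq_square)
  also have "\<dots> \<le> CL \<rho> * (norm (W' J y - W J y) + ?S + norm (dy W' J y - dy W J y))"
  proof -
    define q where "q = 2 * d * (B * (kconst B \<rho> * (1 + \<rho>)))"
    have q: "0 \<le> q" unfolding q_def using d0 B0 \<rho> kconst_nonneg[OF B0 \<rho>] by simp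
    have S: "0 \<le> ?S" by (intro sum_nonneg) auto
    have "0 \<le> B * norm (W' J y - W J y) + q * (?S + norm (dy W' J y - dy W J y))"
      using q S B0 by (intro add_nonneg_nonneg mult_nonneg_nonneg) auto
    then show ?thesis unfolding CL_def q_def[symmetric] by (simp add: algebra_simps)
  qed
  finally show ?thesis .
qed

lemma CF_nonneg: "0 \<le> \<rho> \<Longrightarrow> 0 \<le> CF \<rho>"
  unfolding CF_def using kconst_nonneg[OF B0] B0 by simp

lemma CL_nonneg: "0 \<le> \<rho> \<Longrightarrow> 0 \<le> CL \<rho>"
  unfolding CL_def using kconst_nonneg[OF B0, of \<rho>] B0 d0 by simp

end

section \<open>Convergence of gradient descent\<close>

lemma diff_lin_comb: "(\<lambda>J y. Q J y - V J y) = lin_comb 1 Q (-1) V"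
  by (simp add: lin_comb_def)

lemma lin_comb_H1_bdry:
  assumes "W \<in> H1_space A a b m" "bdry_eq a b m W P" "V \<in> H10_space A a b m"
  shows "lin_comb 1 W t V \<in> H1_space A a b m" "bdry_eq a b m (lin_comb 1 W t V) P"
  using assms H1_comb_closed[of W A a b m V 1 t] bdry_eq_comb[of a b m W P V "\<lambda>J y. 0" 1 t]
  by (auto simp: H10_space_def lin_comb_def)

lemma diff_H10:
  assumes "W \<in> H1_space A a b m" "bdry_eq a b m W P" "W' \<in> H1_space A a b m" "bdry_eq a b m W' P"
  shows "lin_comb 1 W (-1) W' \<in> H10_space A a b m"
  using assms H1_comb_closed[of W A a b m W' 1 "-1"] by (auto simp: H10_space_def bdry_eq_def lin_comb_def)

context sd_functional
begin

interpretation H: semi_inner_space "H1 :: ('n, 'N) sdfun set" lin_comb "hinner"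
  by (rule semi_inner_H1)

lemma H_nrm: "H.nrm = hnorm"
  by (rule ext) (simp add: H.nrm_def H1_norm_inner)

lemmas H1_norm_comb_le = H.nrm_cmb_le[unfolded H_nrm]
lemmas H1_norm_sq = H.nrm_sq[unfolded H_nrm]

lemma Jf_nonneg: "0 \<le> Jf W"
  by (simp add: Jf_def)

text \<open>As the residual of W vanishes, every term containing it drops out, and what is left is
  quadratic with a constant free of the node count. The constant is spelled out instead of using
  \<open>CT\<close>, since it has to be named before the locale is instantiated.\<close>

lemma Jf_near_zero:
  assumes W: "W \<in> H1" "hnorm W \<le> rad"
    and V: "V \<in> H1" "hnorm V \<le> rad"
    and zero: "\<And>J. J \<in> inner_grid m \<Longrightarrow> \<exists>N. negligible N \<and> (\<forall>y\<in>{a..b} - N. res W J y = 0)"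
  shows "Jf (lin_comb 1 W 1 V) \<le>
    exp (2 * lam * b) * (2 * (3 * (B\<^sup>2 * real CARD('n) + CF\<^sup>2)) + 2 * CF\<^sup>2 * \<rho>\<^sup>2) * (hnorm V)\<^sup>2"
  unfolding Jf_def L2_norm_sq
proof (rule H1_dominated[OF V(1)])
  show "0 \<le> exp (2 * lam * b) * (2 * (3 * (B\<^sup>2 * real CARD('n) + CF\<^sup>2)) + 2 * CF\<^sup>2 * \<rho>\<^sup>2)" by simp
  fix J :: "nat^'n" assume J: "J \<in> inner_grid m"
  obtain N1 where N1: "negligible N1" "\<And>y. y \<in> {a..b} - N1 \<Longrightarrow>
      \<exists>r. norm r \<le> CF * (norm (V J y))\<^sup>2 \<and> res (lin_comb 1 W 1 V) J y = res W J y + (lin_res W V J y + r)"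
    by (rule res_taylor[OF W V J]) blast
  obtain N2 where N2: "negligible N2" "\<And>y. y \<in> {a..b} - N2 \<Longrightarrow> res W J y = 0" using zero[OF J] by blast
  let ?D = "\<lambda>y. (norm (V J y))\<^sup>2 + (\<Sum>k\<in>UNIV. (norm (dx A m k V J y))\<^sup>2) + (norm (dy V J y))\<^sup>2"
  have "(norm (exp (lam * y) *\<^sub>R res (lin_comb 1 W 1 V) J y))\<^sup>2
     \<le> exp (2 * lam * b) * (2 * (3 * (B\<^sup>2 * real CARD('n) + CF\<^sup>2)) + 2 * CF\<^sup>2 * \<rho>\<^sup>2) * ?D y"
    if y: "y \<in> {a..b} - (N1 \<union> N2)" for y
  proof -
    have y': "y \<in> {a..b}" using y by simp
    obtain r where r: "norm r \<le> CF * (norm (V J y))\<^sup>2" and eq: "res (lin_comb 1 W 1 V) J y = lin_res W V J y + r"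
      using N1(2)[of y] N2(2)[of y] y by auto
    have D: "(norm (V J y))\<^sup>2 \<le> ?D y" by (simp add: sum_nonneg add_nonneg_nonneg)
    have "(norm (res (lin_comb 1 W 1 V) J y))\<^sup>2 \<le> 2 * (norm (lin_res W V J y))\<^sup>2 + 2 * CF\<^sup>2 * \<rho>\<^sup>2 * (norm (V J y))\<^sup>2"
      unfolding eq by (rule lin_res_remainder_le[OF r sup_le[OF V J y']])
    also have "\<dots> \<le> 2 * (CT * ?D y) + 2 * CF\<^sup>2 * \<rho>\<^sup>2 * ?D y"
      by (intro add_mono mult_left_mono lin_res_norm_le W J y' D) auto
    finally have "(norm (res (lin_comb 1 W 1 V) J y))\<^sup>2 \<le> (2 * CT + 2 * CF\<^sup>2 * \<rho>\<^sup>2) * ?D y" by (simp add: algebra_simps)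
    then have "exp (2 * lam * y) * (norm (res (lin_comb 1 W 1 V) J y))\<^sup>2 \<le> exp (2 * lam * b) * ((2 * CT + 2 * CF\<^sup>2 * \<rho>\<^sup>2) * ?D y)"
      by (intro mult_mono weight_le y') auto
    then show ?thesis by (simp add: power_mult_distrib exp_double[symmetric] CT_def mult.assoc)
  qed
  then show "\<exists>N. negligible N \<and> (\<forall>y\<in>{a..b} - N. (norm (exp (lam * y) *\<^sub>R res (lin_comb 1 W 1 V) J y))\<^sup>2
     \<le> exp (2 * lam * b) * (2 * (3 * (B\<^sup>2 * real CARD('n) + CF\<^sup>2)) + 2 * CF\<^sup>2 * \<rho>\<^sup>2) * ?D y)"
    using negligible_Un[OF N1(1) N2(1)] by blast
qed

text \<open>Convexity is available on the ball of radius 2 R, minimality only on that of radius R.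
  The bound \<open>2 * R \<le> rad\<close> places both balls, and differences of elements of the
  smaller one, in the range of the expansion.\<close>

context
  fixes R c :: real and P Wmin :: "('n, 'N) sdfun"
  assumes R: "0 < R" "2 * R \<le> rad" and c: "0 < c"
    and convex: "\<And>W1 W2. W1 \<in> closed_ball (2 * R) P \<Longrightarrow> W2 \<in> closed_ball (2 * R) P \<Longrightarrow>
      Jf W2 - Jf W1 - hinner (grad W1) (lin_comb 1 W2 (-1) W1) \<ge> c * (hnorm (lin_comb 1 W2 (-1) W1))\<^sup>2"
    and Wmin: "Wmin \<in> closed_ball R P"
    and minimal: "\<And>V. V \<in> closed_ball R P \<Longrightarrow> Jf Wmin \<le> Jf V"
begin

lemma WminD: "Wmin \<in> H1" "bdry_eq a b m Wmin P" "hnorm Wmin \<le> R"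
  using Wmin by (auto simp: B_closed_def)

lemma B_closed_mono: "r \<le> s \<Longrightarrow> closed_ball r P \<subseteq> closed_ball s P"
  by (auto simp: B_closed_def)

text \<open>The ball is convex, so the whole segment from \<open>Wmin\<close> to V competes with
  \<open>Wmin\<close>. Dividing the expansion along it by t and letting t tend to 0 removes the
  quadratic error.\<close>

lemma variational_inequality:
  assumes V: "V \<in> closed_ball R P"
  shows "0 \<le> hinner (grad Wmin) (lin_comb 1 V (-1) Wmin)"
proof -
  let ?v = "lin_comb 1 V (-1) Wmin"
  have VH: "V \<in> H1" "bdry_eq a b m V P" "hnorm V \<le> R" using V by (auto simp: B_closed_def)
  have v: "?v \<in> H10" by (rule diff_H10[OF VH(1,2) WminD(1,2)])
  then have v1: "?v \<in> H1" using H10_subset by blast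
  have n: "hnorm ?v \<le> rad" using H1_norm_comb_le[OF VH(1) WminD(1), of 1 "-1"] VH WminD R by simp
  have gW: "hnorm Wmin \<le> rad" using WminD R by linarith
  have g1: "grad Wmin \<in> H1" using grad_H10[OF WminD(1) gW] H10_subset by blast
  define s where "s = hinner (grad Wmin) ?v"
  define q where "q = CQ * (hnorm ?v)\<^sup>2"
  have q0: "0 \<le> q" unfolding q_def using CQ_nonneg by simp
  have "- (t * q) \<le> s" if t: "0 < t" "t \<le> 1" for t
  proof -
    let ?tv = "lin_comb t ?v 0 ?v"
    have tv: "?tv \<in> H10" by (rule H10_comb_closed[OF v v])
    have nt: "hnorm ?tv = t * hnorm ?v"
      using t by (simp add: H1_norm_inner H.B_cmb_self[OF v1 v1] real_sqrt_mult)
    have "t * hnorm ?v \<le> 1 * hnorm ?v"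
      using t H1_norm_nonneg[OF v1] by (intro mult_right_mono) auto
    then have "\<bar>Jf (lin_comb 1 Wmin 1 ?tv) - Jf Wmin - hinner (grad Wmin) ?tv\<bar> \<le> CQ * (hnorm ?tv)\<^sup>2"
      using n nt by (intro grad_taylor[OF WminD(1) gW tv]) linarith
    moreover have "hinner (grad Wmin) ?tv = t * s"
      by (simp add: s_def H.B_cmb_right[OF v1 v1 g1])
    moreover have "CQ * (hnorm ?tv)\<^sup>2 = t * (t * q)"
      by (simp add: nt q_def power_mult_distrib power2_eq_square)
    moreover have "Jf Wmin \<le> Jf (lin_comb 1 Wmin 1 ?tv)"
    proof (rule minimal)
      have eq: "lin_comb 1 Wmin 1 ?tv = lin_comb (1 - t) Wmin t V"
        by (simp add: lin_comb_def fun_eq_iff algebra_simps)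
      have "hnorm (lin_comb (1 - t) Wmin t V) \<le> \<bar>1 - t\<bar> * hnorm Wmin + \<bar>t\<bar> * hnorm V"
        by (rule H1_norm_comb_le[OF WminD(1) VH(1)])
      also have "\<dots> \<le> (1 - t) * R + t * R" using t VH WminD H1_norm_nonneg[OF VH(1)] H1_norm_nonneg[OF WminD(1)] by (intro add_mono mult_mono) auto
      finally have "hnorm (lin_comb 1 Wmin 1 ?tv) \<le> R" unfolding eq by (simp add: algebra_simps)
      then show "lin_comb 1 Wmin 1 ?tv \<in> closed_ball R P"
        using lin_comb_H1_bdry[OF WminD(1,2) tv] by (simp add: B_closed_def)
    qed
    ultimately have "t * (- (t * q)) \<le> t * s" by linarith
    then show ?thesis using t by (simp only: mult_le_cancel_left_pos)
  qed
  note le = this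
  have "0 \<le> s + e" if e: "e > 0" for e
  proof -
    have "- (min 1 (e / (q + 1)) * q) \<le> s" using e q0 by (intro le) auto
    moreover have "min 1 (e / (q + 1)) * q \<le> e / (q + 1) * q" using q0 by (intro mult_right_mono) auto
    moreover have "e / (q + 1) * q \<le> e" using q0 e by (simp add: field_simps)
    ultimately show ?thesis by linarith
  qed
  then show ?thesis unfolding s_def[symmetric] by (rule field_le_epsilon)
qed

text \<open>In the convexity inequality at \<open>Wmin\<close> the gradient term is dropped by the
  variational inequality and the value at \<open>Wmin\<close> by nonnegativity; a small value of the
  functional alone thus forces V near the minimizer.\<close>

lemma minimizer_near:
  assumes V: "V \<in> closed_ball R P"
  shows "c * (hnorm (lin_comb 1 V (-1) Wmin))\<^sup>2 \<le> Jf V"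
proof -
  have "Wmin \<in> closed_ball (2 * R) P" "V \<in> closed_ball (2 * R) P"
    using B_closed_mono[of R "2 * R"] Wmin V R by auto
  from convex[OF this] show ?thesis using variational_inequality[OF V] Jf_nonneg[of Wmin] by linarith
qed

text \<open>At an interior minimizer small multiples of V and of -V are both admissible, so the
  variational inequality holds in both directions.\<close>

lemma gradient_zero:
  assumes int: "hnorm Wmin < R" and V: "V \<in> H10"
  shows "hinner (grad Wmin) V = 0"
proof -
  have gW: "hnorm Wmin \<le> rad" using WminD R by linarith
  have g1: "grad Wmin \<in> H1" using grad_H10[OF WminD(1) gW] H10_subset by blast
  have V1: "V \<in> H1" using V H10_subset by blast
  have "0 \<le> s * hinner (grad Wmin) V" if s: "\<bar>s\<bar> = 1" for s
  proof -
    define t where "t = (R - hnorm Wmin) / (hnorm V + 1)"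
    have n: "0 \<le> hnorm V" by (rule H1_norm_nonneg[OF V1])
    then have t: "0 < t" unfolding t_def using int by simp
    have tn: "t * hnorm V \<le> R - hnorm Wmin"
      unfolding t_def using n int by (simp add: field_simps)
    let ?U = "lin_comb 1 Wmin (t * s) V"
    have "hnorm ?U \<le> \<bar>1\<bar> * hnorm Wmin + \<bar>t * s\<bar> * hnorm V"
      by (rule H1_norm_comb_le[OF WminD(1) V1])
    then have "hnorm ?U \<le> R" using tn t s by (simp add: abs_mult)
    then have "?U \<in> closed_ball R P"
      using lin_comb_H1_bdry[OF WminD(1,2) V] by (simp add: B_closed_def)
    from variational_inequality[OF this] have "0 \<le> hinner (grad Wmin) (lin_comb 1 ?U (-1) Wmin)" .
    also have "lin_comb 1 ?U (-1) Wmin = lin_comb (t * s) V 0 V" by (simp add: lin_comb_def)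
    also have "hinner (grad Wmin) (lin_comb (t * s) V 0 V) = t * (s * hinner (grad Wmin) V)"
      by (simp add: H.B_cmb_right[OF V1 V1 g1])
    finally show ?thesis using t by (simp add: zero_le_mult_iff)
  qed
  from this[of 1] this[of "-1"] show ?thesis by simp
qed

text \<open>One step contracts the distance to the minimizer without any Lipschitz bound on the gradient:
  the second-order expansion gives $\|J'(W)\|^2 \le \frac{2}{t}\,(J(W) - J(W_{\min}))$, and
  convexity gives $\langle J'(W), W - W_{\min}\rangle \ge J(W) - J(W_{\min}) + c \|W - W_{\min}\|^2$.\<close>

lemma descent_convergence:
  assumes int: "hnorm Wmin < R / 3" and W0: "W0 \<in> B_set A a b m (R / 3) P"
  shows "\<exists>\<gamma>0>0. \<forall>\<gamma>. 0 < \<gamma> \<and> \<gamma> \<le> \<gamma>0 \<longrightarrow> (\<exists>\<theta>. 0 < \<theta> \<and> \<theta> < 1 \<and>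
    (\<forall>k. descent grad \<gamma> W0 k \<in> B_set A a b m R P \<and>
      hnorm (lin_comb 1 (descent grad \<gamma> W0 k) (-1) Wmin) \<le> \<theta> ^ k * hnorm (lin_comb 1 W0 (-1) Wmin)))"
proof -
  \<comment> \<open>An auxiliary step length, distinct from \<gamma>: the first bound makes the
    quadratic remainder at most half of the linear decrease, the second keeps the trial point within
    radius 2 R.\<close>
  define t where "t = min (1 / (2 * (CQ + 1))) (R / (CG + 1))"
  have t: "0 < t" "CQ * t \<le> 1 / 2" "t * CG \<le> R"
  proof -
    show "0 < t" unfolding t_def using CQ_nonneg CG_nonneg R by simp
    have "CQ * t \<le> CQ * (1 / (2 * (CQ + 1)))" using CQ_nonneg by (intro mult_left_mono) (auto simp: t_def)
    also have "\<dots> \<le> 1 / 2" using CQ_nonneg by (simp add: field_simps)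
    finally show "CQ * t \<le> 1 / 2" .
    have "t * CG \<le> R / (CG + 1) * CG" using CG_nonneg by (intro mult_right_mono) (auto simp: t_def)
    also have "\<dots> \<le> R" using CG_nonneg R by (simp add: field_simps)
    finally show "t * CG \<le> R" .
  qed
  have int': "hnorm Wmin < R" using int R by linarith
  have Wm2: "Wmin \<in> closed_ball (2 * R) P" using B_closed_mono[of R "2 * R"] Wmin R by auto
  \<comment> \<open>With zero gradient at \<open>Wmin\<close>, convexity gives growth on the larger
    ball, so \<open>Wmin\<close> is minimal there too. The trial point below lies only in that
    ball.\<close>
  have growth: "c * (hnorm (lin_comb 1 W (-1) Wmin))\<^sup>2 \<le> Jf W - Jf Wmin"
    if W: "W \<in> closed_ball (2 * R) P" for W
  proof -
    have "lin_comb 1 W (-1) Wmin \<in> H10"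
      using W WminD by (intro diff_H10[where P = P]) (auto simp: B_closed_def)
    from gradient_zero[OF int' this] convex[OF Wm2 W] show ?thesis by simp
  qed
  have step_est: "hnorm (lin_comb 1 (lin_comb 1 W (- \<gamma>) (grad W)) (-1) Wmin)
      \<le> sqrt (1 - 2 * \<gamma> * c) * hnorm (lin_comb 1 W (-1) Wmin)"
    if W: "W \<in> B_set A a b m R P" and \<gamma>: "0 < \<gamma>" "\<gamma> \<le> t" "2 * \<gamma> * c \<le> 1" for W \<gamma>
  proof -
    have WH: "W \<in> H1" "bdry_eq a b m W P" "hnorm W < R" using W by (auto simp: B_set_def)
    have W2: "W \<in> closed_ball (2 * R) P" using WH R by (simp add: B_closed_def)
    have Wr: "hnorm W \<le> rad" using WH R by linarith
    let ?G = "grad W" and ?e = "lin_comb 1 W (-1) Wmin"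
    have G: "?G \<in> H10" by (rule grad_H10[OF WH(1) Wr])
    then have G1: "?G \<in> H1" using H10_subset by blast
    have e1: "?e \<in> H1" by (rule H1_comb_closed[OF WH(1) WminD(1)])
    have gn: "hnorm ?G \<le> CG" by (rule grad_norm_le[OF WH(1) Wr])
    define \<Delta> where "\<Delta> = Jf W - Jf Wmin"
    define gg where "gg = hinner ?G ?G"
    define ee where "ee = hinner ?e ?e"
    have gg0: "0 \<le> gg" unfolding gg_def by (rule H.B_nonneg[OF G1])
    have \<Delta>0: "0 \<le> \<Delta>" using growth[OF W2] c unfolding \<Delta>_def by (smt (verit) mult_nonneg_nonneg zero_le_power2)
    \<comment> \<open>A trial step of length t along the negative gradient lowers the functional by
      at least half of \<open>t * gg\<close>, and it cannot fall below the minimum.\<close>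
    have grad_small: "t * gg \<le> 2 * \<Delta>"
    proof -
      let ?V = "lin_comb (- t) ?G 0 ?G"
      have V: "?V \<in> H10" by (rule H10_comb_closed[OF G G])
      then have V1: "?V \<in> H1" using H10_subset by blast
      have BV: "hinner ?V ?V = t\<^sup>2 * gg" by (simp add: H.B_cmb_self[OF G1 G1] gg_def)
      have nV: "hnorm ?V = t * hnorm ?G"
        using t by (simp add: H1_norm_inner BV gg_def real_sqrt_mult)
      have nVR: "hnorm ?V \<le> R"
        unfolding nV using mult_left_mono[OF gn, of t] t by linarith
      have "\<bar>Jf (lin_comb 1 W 1 ?V) - Jf W - hinner ?G ?V\<bar> \<le> CQ * (hnorm ?V)\<^sup>2"
        using nVR R by (intro grad_taylor[OF WH(1) Wr V]) linarith
      moreover have "hinner ?G ?V = - t * gg" by (simp add: H.B_cmb_right[OF G1 G1 G1] gg_def)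
      moreover have "(hnorm ?V)\<^sup>2 = t\<^sup>2 * gg" by (simp add: H1_norm_sq[OF V1] BV)
      ultimately have u1: "Jf (lin_comb 1 W 1 ?V) \<le> Jf W - t * gg + CQ * (t\<^sup>2 * gg)" by simp
      have u2: "CQ * (t\<^sup>2 * gg) \<le> 1 / 2 * (t * gg)"
        using mult_right_mono[OF t(2), of "t * gg"] t(1) gg0 by (simp add: power2_eq_square mult_ac)
      have u3: "Jf Wmin \<le> Jf (lin_comb 1 W 1 ?V)"
      proof -
        have "hnorm (lin_comb 1 W 1 ?V) \<le> 2 * R"
          using H1_norm_comb_le[OF WH(1) V1, of 1 1] nVR WH(3) by simp
        then have "lin_comb 1 W 1 ?V \<in> closed_ball (2 * R) P"
          using lin_comb_H1_bdry[OF WH(1,2) V] by (simp add: B_closed_def)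
        from growth[OF this] show ?thesis using c by (smt (verit) mult_nonneg_nonneg zero_le_power2)
      qed
      have "x \<le> 2 * (p - q)" if "q \<le> p - x + z" "z \<le> 1 / 2 * x" for x z p q :: real
        using add_mono[OF that] by simp
      from this[OF order_trans[OF u3 u1] u2] show ?thesis unfolding \<Delta>_def .
    qed
    have mono: "\<Delta> + c * ee \<le> hinner ?G ?e"
    proof -
      have "hinner ?G (lin_comb 1 Wmin (-1) W) = - hinner ?G ?e"
        by (simp add: H.B_cmb_right[OF _ _ G1] WH(1) WminD(1))
      moreover have "(hnorm (lin_comb 1 Wmin (-1) W))\<^sup>2 = ee"
        using WH(1) WminD(1)
        by (simp add: H1_norm_sq[OF H1_comb_closed] ee_def H.B_cmb_self H.B_sym[of Wmin W])
      ultimately show ?thesis using convex[OF W2 Wm2] unfolding \<Delta>_def by simp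
    qed
    let ?e' = "lin_comb 1 (lin_comb 1 W (- \<gamma>) ?G) (-1) Wmin"
    have e': "?e' = lin_comb 1 ?e (- \<gamma>) ?G" by (simp add: lin_comb_def fun_eq_iff)
    have "hinner ?e' ?e' = ee - 2 * \<gamma> * hinner ?G ?e + \<gamma>\<^sup>2 * gg"
      unfolding e' by (simp add: H.B_cmb_self[OF e1 G1] ee_def gg_def H.B_sym[OF e1 G1])
    \<comment> \<open>For \<gamma> <= t the squared gradient costs at most 2 \<gamma> \<Delta>,
      exactly what convexity gains, so the differences of values cancel and only the term with c
      remains.\<close>
    also have "\<dots> \<le> ee - 2 * \<gamma> * (\<Delta> + c * ee) + 2 * \<gamma> * \<Delta>"
    proof -
      have "2 * \<gamma> * (\<Delta> + c * ee) \<le> 2 * \<gamma> * hinner ?G ?e"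
        using mono \<gamma> by (intro mult_left_mono) auto
      moreover have "\<gamma>\<^sup>2 * gg \<le> 2 * \<gamma> * \<Delta>"
      proof -
        have "\<gamma> * gg \<le> t * gg" using \<gamma> gg0 by (intro mult_right_mono)
        then have "\<gamma> * (\<gamma> * gg) \<le> \<gamma> * (2 * \<Delta>)" using grad_small \<gamma> by (intro mult_left_mono) auto
        then show ?thesis by (simp add: power2_eq_square mult_ac)
      qed
      ultimately show ?thesis by linarith
    qed
    also have "\<dots> = (1 - 2 * \<gamma> * c) * ee" by (simp add: algebra_simps)
    finally have "sqrt (hinner ?e' ?e') \<le> sqrt ((1 - 2 * \<gamma> * c) * ee)" by (rule real_sqrt_le_mono)
    then show ?thesis by (simp add: H1_norm_inner real_sqrt_mult ee_def)
  qed
  show ?thesis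
  \<comment> \<open>The bound 1 / (4 c) yields 2 \<gamma> c <= 1 / 2, which makes the rate \<theta>
    the root of a positive number below 1.\<close>
  proof (rule exI[of _ "min t (1 / (4 * c))"], intro conjI allI impI)
    show "0 < min t (1 / (4 * c))" using t c by simp
    fix \<gamma> assume \<gamma>: "0 < \<gamma> \<and> \<gamma> \<le> min t (1 / (4 * c))"
    have \<gamma>c: "2 * \<gamma> * c \<le> 1 / 2"
    proof -
      have "\<gamma> * (4 * c) \<le> 1 / (4 * c) * (4 * c)" using \<gamma> c by (intro mult_right_mono) auto
      then show ?thesis using c by simp
    qed
    have \<gamma>c0: "0 < 2 * \<gamma> * c" using \<gamma> c by simp
    define \<theta> where "\<theta> = sqrt (1 - 2 * \<gamma> * c)"
    have \<theta>: "0 < \<theta>" "\<theta> < 1" using \<gamma>c \<gamma>c0 by (auto simp: \<theta>_def)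
    let ?W = "descent grad \<gamma> W0" and ?E = "hnorm (lin_comb 1 W0 (-1) Wmin)"
    have W0H: "W0 \<in> H1" "bdry_eq a b m W0 P" "hnorm W0 < R / 3" using W0 by (auto simp: B_set_def)
    have E: "?E < 2 * R / 3" using H1_norm_comb_le[OF W0H(1) WminD(1), of 1 "-1"] W0H int by simp
    have E0: "0 \<le> ?E" by (intro H1_norm_nonneg H1_comb_closed W0H WminD)
    \<comment> \<open>The distance to \<open>Wmin\<close> never exceeds the initial one, which is
      below 2 R / 3, and \<open>Wmin\<close> itself has norm below R / 3.\<close>
    have inB: "V \<in> B_set A a b m R P"
      if "V \<in> H1" "bdry_eq a b m V P" "hnorm (lin_comb 1 V (-1) Wmin) \<le> \<theta> ^ k * ?E" for V k
    proof -
      have "\<theta> ^ k * ?E \<le> 1 * ?E" using \<theta> E0 by (intro mult_right_mono power_le_one) auto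
      then have "hnorm (lin_comb 1 V (-1) Wmin) < 2 * R / 3" using that E by linarith
      moreover have "V = lin_comb 1 (lin_comb 1 V (-1) Wmin) 1 Wmin" by (simp add: lin_comb_def)
      then have "hnorm V \<le> hnorm (lin_comb 1 V (-1) Wmin) + hnorm Wmin"
        using H1_norm_comb_le[OF H1_comb_closed[OF that(1) WminD(1), of 1 "-1"] WminD(1), of 1 1] by simp
      ultimately have "hnorm V < R" using int by linarith
      then show ?thesis using that by (simp add: B_set_def)
    qed
    have "?W k \<in> H1 \<and> bdry_eq a b m (?W k) P \<and> hnorm (lin_comb 1 (?W k) (-1) Wmin) \<le> \<theta> ^ k * ?E" for k
    proof (induction k)
      case 0
      show ?case using W0H by simp
    next
      case (Suc k)
      have B: "?W k \<in> B_set A a b m R P" using inB Suc.IH by blast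
      have WH: "?W k \<in> H1" "bdry_eq a b m (?W k) P" "hnorm (?W k) < R" using B by (auto simp: B_set_def)
      have "hnorm (?W k) \<le> rad" using WH(3) R by linarith
      note G = grad_H10[OF WH(1) this]
      have eq: "?W (Suc k) = lin_comb 1 (?W k) (- \<gamma>) (grad (?W k))" by (simp add: lin_comb_def)
      have "hnorm (lin_comb 1 (?W (Suc k)) (-1) Wmin) \<le> \<theta> * hnorm (lin_comb 1 (?W k) (-1) Wmin)"
        unfolding eq \<theta>_def using \<gamma> \<gamma>c by (intro step_est[OF B]) auto
      also have "\<dots> \<le> \<theta> * (\<theta> ^ k * ?E)" using Suc.IH \<theta> by (intro mult_left_mono) auto
      finally have "hnorm (lin_comb 1 (?W (Suc k)) (-1) Wmin) \<le> \<theta> ^ Suc k * ?E" by simp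
      moreover have "?W (Suc k) \<in> H1" "bdry_eq a b m (?W (Suc k)) P"
        unfolding eq by (rule lin_comb_H1_bdry[OF WH(1,2) G])+
      ultimately show ?case by blast
    qed
    then show "\<exists>\<theta>. 0 < \<theta> \<and> \<theta> < 1 \<and> (\<forall>k. ?W k \<in> B_set A a b m R P \<and>
      hnorm (lin_comb 1 (?W k) (-1) Wmin) \<le> \<theta> ^ k * ?E)"
      using \<theta> inB by blast
  qed
qed

end

end

section \<open>Instantiation for the transport problem\<close>

lemma grid_pt_in_closure:
  assumes "0 < A" "a < b" "1 < m" "J \<in> inner_grid m" "y \<in> {a..b}"
  shows "grid_pt A m J y \<in> closure (Omega A a b :: 'n::finite point set)"
proof -
  have "- A \<le> - A + real (J $ i) * step A m \<and> - A + real (J $ i) * step A m \<le> A" for i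
  proof -
    have "J $ i \<le> m - 1" using assms(4) by (simp add: inner_grid_def)
    then have "real (J $ i) \<le> real m" by simp
    then have "real (J $ i) * (2 * A / real m) \<le> real m * (2 * A / real m)"
      using assms by (intro mult_right_mono) auto
    then show ?thesis using assms by (simp add: step_def)
  qed
  then show ?thesis
    unfolding closure_Omega[OF assms(1,2)] using assms(5) by (simp add: grid_pt_def mem_box_cart)
qed

lemma continuous_on_grid_pt: "continuous_on S (grid_pt A m J)"
  unfolding grid_pt_def[abs_def] by (intro continuous_intros)

text \<open>\<open>sd_functional\<close> has one bound for the matrices and for the nonlinearity at
  W = 0; the summand \<open>(2 * d)\<^sup>2 * (B * B)\<close> covers the latter.\<close>

lemma (in kernel_data) sd_functional_concrete:
  assumes m: "1 < m" and lam: "0 \<le> lam" and \<rho>: "0 < \<rho>"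
    and D: "\<And>x v. x \<in> \<Omega> \<Longrightarrow> norm ((D_mat d x :: 'N rmat) *v v) \<le> B * norm v"
    and Ax: "\<And>x i v. x \<in> \<Omega> \<Longrightarrow> norm ((Ax_mat d i x :: 'N rmat) *v v) \<le> B * norm v"
  shows "sd_functional a b lam (B + (2 * d)\<^sup>2 * (B * B)) \<rho> (CF \<rho>) m
    (\<lambda>J y. D_mat d (grid_pt A m J y) :: 'N rmat)
    (\<lambda>i J y. Ax_mat d i (grid_pt A m J y)) (\<lambda>J y w. F_fun d K \<mu> w (grid_pt A m J y)) (\<lambda>J y w. DF_mat (grid_pt A m J y) w)"
proof
  let ?B = "B + (2 * d)\<^sup>2 * (B * B)"
  have BB: "B \<le> ?B" using B0 by simp
  show "0 \<le> ?B" using B0 by simp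
  show "0 \<le> CF \<rho>" using \<rho> by (intro CF_nonneg) simp
  fix J :: "nat^'n::{finite,linorder}" assume J: "J \<in> inner_grid m"
  note g = grid_pt_in_closure[OF A0 ab m J]
  have img: "grid_pt A m J ` {a..b} \<subseteq> \<Omega>" using g by blast
  show "continuous_on {a..b} (\<lambda>y. D_mat d (grid_pt A m J y) :: 'N rmat)"
    by (rule continuous_on_compose2[OF continuous_on_D_mat continuous_on_grid_pt img]) (rule snd_pos)
  show "continuous_on {a..b} (\<lambda>y. Ax_mat d i (grid_pt A m J y) :: 'N rmat)" for i
    by (rule continuous_on_compose2[OF continuous_on_Ax_mat continuous_on_grid_pt img]) (rule snd_pos)
  show "continuous_on {a..b} (\<lambda>y. F_fun d K \<mu> (w y :: 'N rvec) (grid_pt A m J y))"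
    "continuous_on {a..b} (\<lambda>y. DF_mat (grid_pt A m J y) (w y))" if "continuous_on {a..b} w" for w
    by (intro F_fun_continuous DF_mat_continuous that continuous_on_grid_pt g; assumption)+
  fix y assume y: "y \<in> {a..b}"
  note x = g[OF y]
  show "norm ((D_mat d (grid_pt A m J y) :: 'N rmat) *v v) \<le> ?B * norm v" for v
    using D[OF x, of v] mult_right_mono[OF BB, of "norm v"] by simp
  show "norm ((Ax_mat d i (grid_pt A m J y) :: 'N rmat) *v v) \<le> ?B * norm v" for i v
    using Ax[OF x, of i v] mult_right_mono[OF BB, of "norm v"] by simp
  show "norm (F_fun d K \<mu> (0 :: 'N rvec) (grid_pt A m J y)) \<le> ?B"
    using F_fun_zero_bound[OF x] B0 by linarith
  show "norm (DF_mat (grid_pt A m J y) u *v v) \<le> CF \<rho> * norm v" if "norm u \<le> \<rho>" for u v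
    by (rule DF_mat_bound[OF x that])
  show "norm (F_fun d K \<mu> (u + v) (grid_pt A m J y) - F_fun d K \<mu> u (grid_pt A m J y) - DF_mat (grid_pt A m J y) u *v v)
      \<le> CF \<rho> * (norm v)\<^sup>2" if "norm u \<le> \<rho>" "norm v \<le> \<rho>" for u v
    by (rule F_fun_taylor[OF x that])
qed (use ab lam \<rho> in auto)

text \<open>\<rho> is the supremum bound that belongs to the H1 radius r, for W and for the
  difference alike. The pointwise Lipschitz estimate then applies off a null set, and
  \<open>norm_linear_part_le\<close>, used with the scalar norms as its vectors, squares it.\<close>

lemma (in kernel_data) reconstruct_error_bound:
  fixes W W' :: "('n::{finite,linorder}, 'N::{finite,linorder}) sdfun"
  assumes m: "1 < m" and \<rho>: "\<rho> = sobolev_const a b * r" "0 \<le> r"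
    and W: "W \<in> H1_space A a b m" "H1_norm A a b m W \<le> r" and W': "W' \<in> H1_space A a b m"
    and d: "H1_norm A a b m (lin_comb 1 W' (-1) W) \<le> r"
  shows "L2_norm a b m (\<lambda>J y. reconstruct A d m K \<mu> W' J y - reconstruct A d m K \<mu> W J y)
    \<le> sqrt (3 * ((CL \<rho>)\<^sup>2 * real CARD('n) + (CL \<rho>)\<^sup>2)) * H1_norm A a b m (lin_comb 1 W' (-1) W)"
proof -
  interpret H: semi_inner_space "H1_space A a b m :: ('n, 'N) sdfun set" lin_comb "H1_inner A a b m" by (rule semi_inner_H1)
  let ?V = "lin_comb 1 W' (-1) W"
  have V: "?V \<in> H1_space A a b m" by (rule H1_comb_closed[OF W' W(1)])
  have \<rho>0: "0 \<le> \<rho>" unfolding \<rho> using sobolev_const_pos[OF ab] \<rho>(2) by simp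
  note CL0 = CL_nonneg[OF \<rho>0]
  let ?c = "3 * ((CL \<rho>)\<^sup>2 * real CARD('n) + (CL \<rho>)\<^sup>2)"
  have sup: "norm (Q J y) \<le> \<rho>" if "Q \<in> H1_space A a b m" "H1_norm A a b m Q \<le> r" "J \<in> inner_grid m" "y \<in> {a..b}"
    for Q :: "('n, 'N) sdfun" and J y
    using H1_sup_bound[OF ab that(1,3,4)] mult_left_mono[OF that(2), of "sobolev_const a b"] sobolev_const_pos[OF ab]
    unfolding \<rho> by linarith
  have "(\<Sum>J\<in>inner_grid m. L2sq a b (\<lambda>y. reconstruct A d m K \<mu> W' J y - reconstruct A d m K \<mu> W J y))
     \<le> ?c * (H1_norm A a b m ?V)\<^sup>2"
  proof (rule H1_dominated[OF V])
    fix J :: "nat^'n::{finite,linorder}" assume J: "J \<in> inner_grid m"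
    obtain N where N: "negligible N" "\<And>y. y \<in> {a..b} - N \<Longrightarrow> dy ?V J y = 1 *\<^sub>R dy W' J y + (-1) *\<^sub>R dy W J y"
      by (rule dy_comb_ae[OF W' W(1) J, where s = 1 and t = "-1"]) blast
    have "(norm (reconstruct A d m K \<mu> W' J y - reconstruct A d m K \<mu> W J y))\<^sup>2
      \<le> ?c * ((norm (?V J y))\<^sup>2 + (\<Sum>k\<in>UNIV. (norm (dx A m k ?V J y))\<^sup>2) + (norm (dy ?V J y))\<^sup>2)"
      if y: "y \<in> {a..b} - N" for y
    proof -
      have y': "y \<in> {a..b}" using y by simp
      have e: "W' J y - W J y = ?V J y" "dx A m i W' J y - dx A m i W J y = dx A m i ?V J y" "dy W' J y - dy W J y = dy ?V J y" for i
        using N(2)[OF y] by (simp_all add: dx_comb) (simp add: lin_comb_def)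
      have "\<bar>reconstruct A d m K \<mu> W' J y - reconstruct A d m K \<mu> W J y\<bar>
        \<le> CL \<rho> * (norm (?V J y) + (\<Sum>i\<in>UNIV. norm (dx A m i ?V J y)) + norm (dy ?V J y))"
        using reconstruct_lipschitz[OF grid_pt_in_closure[OF A0 ab m J y'], of W \<rho> W'] sup[OF W J y'] sup[OF V d J y']
        unfolding e by simp
      also have "\<dots> = CL \<rho> * norm (dy ?V J y) + (\<Sum>i\<in>UNIV. CL \<rho> * norm (dx A m i ?V J y)) + CL \<rho> * norm (?V J y)"
        by (simp add: sum_distrib_left distrib_left)
      finally have "\<bar>reconstruct A d m K \<mu> W' J y - reconstruct A d m K \<mu> W J y\<bar>\<^sup>2
        \<le> (norm (CL \<rho> * norm (dy ?V J y) + (\<Sum>i\<in>UNIV. CL \<rho> * norm (dx A m i ?V J y)) + CL \<rho> * norm (?V J y)))\<^sup>2"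
        by (intro power_mono) auto
      also have "\<dots> \<le> ?c * ((norm (norm (?V J y)))\<^sup>2 + (\<Sum>k\<in>UNIV. (norm (norm (dx A m k ?V J y)))\<^sup>2) + (norm (norm (dy ?V J y)))\<^sup>2)"
        using CL0 by (intro norm_linear_part_le) (auto simp: abs_mult)
      finally show ?thesis by simp
    qed
    then show "\<exists>N. negligible N \<and> (\<forall>y\<in>{a..b} - N. (norm (reconstruct A d m K \<mu> W' J y - reconstruct A d m K \<mu> W J y))\<^sup>2
      \<le> ?c * ((norm (?V J y))\<^sup>2 + (\<Sum>k\<in>UNIV. (norm (dx A m k ?V J y))\<^sup>2) + (norm (dy ?V J y))\<^sup>2))"
      using N(1) by blast
  qed simp
  then have "L2_norm a b m (\<lambda>J y. reconstruct A d m K \<mu> W' J y - reconstruct A d m K \<mu> W J y) \<le> sqrt (?c * (H1_norm A a b m ?V)\<^sup>2)"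
    unfolding L2_norm_def by (rule real_sqrt_le_mono)
  also have "\<dots> = sqrt ?c * H1_norm A a b m ?V"
    using H.nrm_nonneg[OF V] by (simp add: real_sqrt_mult H.nrm_def H1_norm_inner)
  finally show ?thesis .
qed

lemma C2_on_continuous: "C2_on S f \<Longrightarrow> continuous_on S f"
  unfolding C2_on_def continuous_on_eq_continuous_within using has_derivative_continuous by blast

text \<open>Compactness suffices, because the closure of the domain stays in y >= a > 0. The bound
  is obtained before a kernel or a grid is given and is therefore independent of both.\<close>

lemma geometry_bounds:
  fixes \<mu> :: "'n::{finite,linorder} point \<Rightarrow> real"
  assumes "0 < A" "0 < d" "0 < a" "a < b" and \<mu>: "continuous_on UNIV \<mu>"
  obtains B where "0 \<le> B"
    "\<And>t. t \<in> {-d..d} \<Longrightarrow> norm (psi d t :: 'N::{finite,linorder} rvec) \<le> B"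
    "\<And>t. t \<in> {-d..d} \<Longrightarrow> norm (dpsi d t :: 'N rvec) \<le> B"
    "\<And>s t. s \<in> {-d..d} \<Longrightarrow> t \<in> {-d..d} \<Longrightarrow> norm (psi d t - psi d s :: 'N rvec) \<le> B"
    "\<And>x. x \<in> closure (Omega A a b) \<Longrightarrow> \<bar>\<mu> x\<bar> \<le> B"
    "\<And>x t. x \<in> closure (Omega A a b) \<Longrightarrow> t \<in> {-d..d} \<Longrightarrow>
       norm ((\<mu> x / snd (nu x t)) *\<^sub>R (psi d t :: 'N rvec)) \<le> B"
    "\<And>x v. x \<in> closure (Omega A a b) \<Longrightarrow>
       norm ((D_mat d (x :: 'n point) :: 'N rmat) *v v) \<le> B * norm v"
    "\<And>x i v. x \<in> closure (Omega A a b) \<Longrightarrow>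
       norm ((Ax_mat d i (x :: 'n point) :: 'N rmat) *v v) \<le> B * norm v"
proof -
  let ?\<Omega> = "closure (Omega A a b) :: 'n point set" and ?I = "{-d..d}"
  have comp: "compact ?\<Omega>" by (rule compact_closure_Omega[OF assms(1,4)])
  have pos: "0 < snd x" if "x \<in> ?\<Omega>" for x using that assms(3) by (auto simp: closure_Omega[OF assms(1,4)])
  have \<mu>': "continuous_on S (\<lambda>z. \<mu> (f z))" if "continuous_on S f" for S and f :: "'z::topological_space \<Rightarrow> 'n point"
    by (rule continuous_on_compose2[OF \<mu> that]) auto
  obtain B1 where B1: "0 \<le> B1" "\<And>t. t \<in> ?I \<Longrightarrow> norm (psi d t :: 'N rvec) \<le> B1"
    by (rule continuous_compact_bound[OF _ continuous_on_psi[OF continuous_on_id], of ?I d]) auto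
  obtain B2 where B2: "0 \<le> B2" "\<And>t. t \<in> ?I \<Longrightarrow> norm (dpsi d t :: 'N rvec) \<le> B2"
    by (rule continuous_compact_bound[OF _ continuous_on_dpsi[OF continuous_on_id], of ?I d]) auto
  obtain B3 where B3: "0 \<le> B3" "\<And>x. x \<in> ?\<Omega> \<Longrightarrow> norm (\<mu> x) \<le> B3"
    by (rule continuous_compact_bound[OF comp \<mu>'[OF continuous_on_id]]) auto
  have "continuous_on (?\<Omega> \<times> ?I) (\<lambda>z. (\<mu> (fst z) / snd (nu (fst z) (snd z))) *\<^sub>R (psi d (snd z) :: 'N rvec))"
    by (intro continuous_intros \<mu>' continuous_on_nu continuous_on_psi)
       (use pos snd_nu_pos[OF pos] in \<open>auto simp: less_imp_neq[THEN not_sym]\<close>)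
  then obtain B4 where B4: "0 \<le> B4" "\<And>z. z \<in> ?\<Omega> \<times> ?I \<Longrightarrow> norm ((\<mu> (fst z) / snd (nu (fst z) (snd z))) *\<^sub>R (psi d (snd z) :: 'N rvec)) \<le> B4"
    by (rule continuous_compact_bound[rotated]) (auto intro: compact_Times comp)
  obtain B5 where B5: "0 \<le> B5" "\<And>x. x \<in> ?\<Omega> \<Longrightarrow> norm (D_mat d x :: 'N rmat) \<le> B5"
    by (rule continuous_compact_bound[OF comp continuous_on_D_mat[OF pos]]) auto
  \<comment> \<open>Packing the matrices of all directions into one vector yields a bound uniform in
    i.\<close>
  have "continuous_on ?\<Omega> (\<lambda>x. (\<chi> i. Ax_mat d i x) :: 'N rmat^'n::{finite,linorder})"
    by (intro continuous_on_vec_lambda continuous_on_Ax_mat pos)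
  then obtain B6 where B6: "0 \<le> B6" "\<And>x. x \<in> ?\<Omega> \<Longrightarrow> norm ((\<chi> i. Ax_mat d i x) :: 'N rmat^'n::{finite,linorder}) \<le> B6"
    by (rule continuous_compact_bound[OF comp]) auto
  let ?n = "real CARD('N)"
  define B where "B = 2 * B1 + B2 + B3 + B4 + ?n * B5 + ?n * B6"
  have nB: "0 \<le> ?n * B5" "0 \<le> ?n * B6" using B5 B6 by auto
  show thesis
  proof (rule that[of B])
    show "0 \<le> B" unfolding B_def using B1 B2 B3 B4 nB by simp
    show "norm (psi d t :: 'N rvec) \<le> B" if "t \<in> ?I" for t
      using B1(2)[OF that] B1(1) B2(1) B3(1) B4(1) nB unfolding B_def by linarith
    show "norm (dpsi d t :: 'N rvec) \<le> B" if "t \<in> ?I" for t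
      using B2(2)[OF that] B1(1) B2(1) B3(1) B4(1) nB unfolding B_def by linarith
    show "norm (psi d t - psi d s :: 'N rvec) \<le> B" if "s \<in> ?I" "t \<in> ?I" for s t
      using norm_triangle_ineq4[of "psi d t :: 'N rvec" "psi d s"] B1(2)[OF that(1)] B1(2)[OF that(2)] B2(1) B3(1) B4(1) nB
      unfolding B_def by linarith
    show "\<bar>\<mu> x\<bar> \<le> B" if "x \<in> ?\<Omega>" for x
      using B3(2)[OF that] B1(1) B2(1) B3(1) B4(1) nB unfolding B_def real_norm_def by linarith
    show "norm ((\<mu> x / snd (nu x t)) *\<^sub>R (psi d t :: 'N rvec)) \<le> B" if "x \<in> ?\<Omega>" "t \<in> ?I" for x t
      using B4(2)[of "(x, t)"] that B1(1) B2(1) B3(1) B4(1) nB unfolding B_def fst_conv snd_conv by (smt (verit) SigmaI)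
    have mat: "norm (M *v v) \<le> B * norm v" if "norm M \<le> B5 + B6" for M :: "'N rmat" and v
    proof -
      have "?n * norm M \<le> ?n * (B5 + B6)" using that by (intro mult_left_mono) auto
      also have "\<dots> \<le> B" unfolding B_def using B1(1) B2(1) B3(1) B4(1) by (simp add: distrib_left)
      finally have "?n * norm M * norm v \<le> B * norm v" by (rule mult_right_mono) simp
      then show ?thesis using matrix_vector_norm_le[of M v] by linarith
    qed
    show "norm ((D_mat d x :: 'N rmat) *v v) \<le> B * norm v" if "x \<in> ?\<Omega>" for x v
      using B5(2)[OF that] B6(1) by (intro mat) simp
    show "norm ((Ax_mat d i x :: 'N rmat) *v v) \<le> B * norm v" if "x \<in> ?\<Omega>" for x i v
    proof (rule mat)
      have "norm (((\<chi> i. Ax_mat d i x) :: 'N rmat^'n::{finite,linorder}) $ i) \<le> B6"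
        using Finite_Cartesian_Product.norm_nth_le B6(2)[OF that] by (rule order_trans)
      then show "norm (Ax_mat d i x :: 'N rmat) \<le> B5 + B6" using B5(1) by simp
    qed
  qed
qed

lemma AE_lebesgue_on_negligible:
  assumes "AE y in lebesgue_on {a..b::real}. Q y"
  obtains N where "negligible N" "\<And>y. y \<in> {a..b} - N \<Longrightarrow> Q y"
proof -
  have "AE y in lebesgue. y \<in> {a..b} \<longrightarrow> Q y"
    using assms by (subst (asm) AE_restrict_space_iff) auto
  then obtain N where "negligible N" "{y. \<not> (y \<in> {a..b} \<longrightarrow> Q y)} \<subseteq> N"
    unfolding eventually_ae_filter_negligible by blast
  then show thesis using that[of N] by auto
qed

text \<open>The reconstruction formula is Lipschitz in the H1 distance with a constant that also
  multiplies the geometric term; this is the factor in front of \<theta>^k in the coefficient bound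
  for all k. Once the geometric term is small against \<delta>, a spare \<delta> inside
  \<open>C3 * \<delta>\<close> absorbs it, which gives the factor 1 for large k.\<close>

theorem theorem4p5:
  fixes A d a b a0 h0 R \<kappa> c lam2 :: real
    and \<mu> :: "'n::{finite,linorder} point \<Rightarrow> real"
  assumes pos: "A > 0" "d > 0" "h0 > 0" "R > 0"
    and ab: "1 < a" "a < b"
    and a0: "1 < a0"
      "\<And>a' b'. a0 \<le> a' \<Longrightarrow> a' < b' \<Longrightarrow>
         (\<forall>x\<in>closure (Omega A a' b') :: 'n point set.
            invertible (D_mat d x :: real^'N::{finite,linorder}^'N::{finite,linorder})) \<and>
         (\<exists>C>0. \<forall>x\<in>closure (Omega A a' b') :: 'n point set.
            onorm (\<lambda>v. matrix_inv (D_mat d x :: real^'N::{finite,linorder}^'N::{finite,linorder}) *v v) \<le> C)"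
    and a_ge: "a0 \<le> a"
    and \<mu>: "C2_on UNIV \<mu>" "\<And>x. 0 \<le> \<mu> x" "\<And>x. x \<notin> Omega A a b \<Longrightarrow> \<mu> x = 0"
    and c: "c > 0"
    and lam2: "lam2 \<ge> 1"
  shows "\<exists>C3>0. \<forall>K :: 'n point \<times> real \<times> real \<Rightarrow> real.
    C2_on (K_domain A d a b) K \<and> (\<forall>z\<in>K_domain A d a b. 0 \<le> K z) \<and>
    C1_norm (K_domain A d a b) K = \<kappa> \<and>
    (\<forall>lam\<ge>lam2. \<forall>m>1. h0 \<le> step A m \<longrightarrow>
       (\<forall>P (W1 :: ('n, 'N) sdfun) W2.
          W1 \<in> B_closed A a b m (2 * R) P \<and> W2 \<in> B_closed A a b m (2 * R) P \<longrightarrow>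
          J_fun A d a b m K \<mu> lam W2 - J_fun A d a b m K \<mu> lam W1
            - H1_inner A a b m (J_grad A d a b m K \<mu> lam W1) (\<lambda>J y. W2 J y - W1 J y)
          \<ge> c * exp (2 * lam * a) * (H1_norm A a b m (\<lambda>J y. W2 J y - W1 J y))\<^sup>2))
    \<longrightarrow>
    (\<forall>(m::nat) \<delta> \<alpha>0 (P :: ('n, 'N) sdfun) Pstar S Sstar Wstar Wmin W0.
      m > 1 \<and> h0 \<le> step A m \<and> \<delta> > 0 \<and>
      Wstar \<in> H1_space A a b m \<and>
      (\<forall>J\<in>inner_grid m. AE y in lebesgue_on {a..b}. residual A d m K \<mu> Wstar J y = 0) \<and>
      bdry_eq a b m Wstar Pstar \<and>
      S \<in> H1_space A a b m \<and> bdry_eq a b m S P \<and> H1_norm A a b m S < R \<and>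
      Sstar \<in> H1_space A a b m \<and> bdry_eq a b m Sstar Pstar \<and> H1_norm A a b m Sstar < R \<and>
      H1_norm A a b m (\<lambda>J y. S J y - Sstar J y) < \<delta> \<and>
      Wmin \<in> B_closed A a b m R P \<and>
      (\<forall>V\<in>B_closed A a b m R P. J_fun A d a b m K \<mu> lam2 Wmin \<le> J_fun A d a b m K \<mu> lam2 V) \<and>
      0 < \<alpha>0 \<and> \<alpha>0 < R \<and>
      Wstar \<in> B_set A a b m ((R - \<alpha>0) / 3) Pstar \<and>
      C3 * \<delta> < \<alpha>0 / 3 \<and>
      W0 \<in> B_set A a b m (R / 3) P
      \<longrightarrow>
      (\<exists>\<gamma>0>0. \<forall>\<gamma>. 0 < \<gamma> \<and> \<gamma> \<le> \<gamma>0 \<longrightarrow> (\<exists>\<theta>. 0 < \<theta> \<and> \<theta> < 1 \<and>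
        (let W = descent (J_grad A d a b m K \<mu> lam2) \<gamma> W0;
             E0 = H1_norm A a b m (\<lambda>J y. W0 J y - Wmin J y);
             err = (\<lambda>k. L2_norm a b m (\<lambda>J y.
                      reconstruct A d m K \<mu> (W k) J y - reconstruct A d m K \<mu> Wstar J y))
         in
           (\<forall>k. W k \<in> B_set A a b m R P) \<and>
           (\<forall>k. H1_norm A a b m (\<lambda>J y. W k J y - Wmin J y) \<le> \<theta> ^ k * E0) \<and>
           (\<forall>k. H1_norm A a b m (\<lambda>J y. W k J y - Wstar J y) \<le> C3 * \<delta> + \<theta> ^ k * E0) \<and>
           (\<forall>k. err k \<le> C3 * \<delta> + C3 * \<theta> ^ k * E0) \<and>
           (\<exists>k0. \<forall>k\<ge>k0. err k \<le> C3 * \<delta> + \<theta> ^ k * E0)))))"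
proof -
  have a_pos: "0 < a" using ab by simp
  obtain B' where B': "0 \<le> B'"
    "\<And>t. t \<in> {-d..d} \<Longrightarrow> norm (psi d t :: 'N rvec) \<le> B'"
    "\<And>t. t \<in> {-d..d} \<Longrightarrow> norm (dpsi d t :: 'N rvec) \<le> B'"
    "\<And>s t. s \<in> {-d..d} \<Longrightarrow> t \<in> {-d..d} \<Longrightarrow> norm (psi d t - psi d s :: 'N rvec) \<le> B'"
    "\<And>x. x \<in> closure (Omega A a b) \<Longrightarrow> \<bar>\<mu> x\<bar> \<le> B'"
    "\<And>x t. x \<in> closure (Omega A a b) \<Longrightarrow> t \<in> {-d..d} \<Longrightarrow>
       norm ((\<mu> x / snd (nu x t)) *\<^sub>R (psi d t :: 'N rvec)) \<le> B'"
    "\<And>x v. x \<in> closure (Omega A a b) \<Longrightarrow>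
       norm ((D_mat d (x :: 'n point) :: 'N rmat) *v v) \<le> B' * norm v"
    "\<And>x i v. x \<in> closure (Omega A a b) \<Longrightarrow>
       norm ((Ax_mat d i (x :: 'n point) :: 'N rmat) *v v) \<le> B' * norm v"
    by (rule geometry_bounds[OF pos(1,2) a_pos ab(2) C2_on_continuous[OF \<mu>(1)]]) (rule that)
  \<comment> \<open>The kernel enters the bounds only through \<open>\<kappa>\<close>; the absolute
    value keeps \<open>B\<close> nonnegative before any kernel of this norm is given.\<close>
  define B where "B = B' + \<bar>\<kappa>\<bar>"
  have BB: "B' \<le> B" and B0: "0 \<le> B" using B'(1) by (auto simp: B_def)
  \<comment> \<open>This value makes the radius \<open>rad\<close> of the expansion equal to 2 R,
    the radius on which convexity is assumed.\<close>
  define \<rho> where "\<rho> = sobolev_const a b * (2 * R)"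
  have \<rho>0: "0 < \<rho>" unfolding \<rho>_def using sobolev_const_pos[OF ab(2)] pos by simp
  \<comment> \<open>\<open>CF\<close>, \<open>CL\<close> and the constant of
    \<open>Jf_near_zero\<close> are written out, because their locales can be entered only after K
    is fixed.\<close>
  define CFc where "CFc = (2 * d)\<^sup>2 * (kconst B \<rho> * B)"
  define CLc where "CLc = B + 2 * d * (B * (kconst B \<rho> * (1 + \<rho>)))"
  define CJ where "CJ = exp (2 * lam2 * b) *
     (2 * (3 * ((B + (2 * d)\<^sup>2 * (B * B))\<^sup>2 * real CARD('n) + CFc\<^sup>2)) + 2 * CFc\<^sup>2 * \<rho>\<^sup>2)"
  define c' where "c' = c * exp (2 * lam2 * a)"
  \<comment> \<open>The root bounds the distance from \<open>Wmin\<close> to the corrected exact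
    solution per unit of noise; the 1 accounts for the correction itself.\<close>
  define CM where "CM = sqrt (CJ / c') + 1"
  define CE where "CE = sqrt (3 * (CLc\<^sup>2 * real CARD('n) + CLc\<^sup>2))"
  \<comment> \<open>Large enough for the function error and for the coefficient error; the 1 next to
    \<open>CE * CM\<close> reserves one \<delta> for the tail of the latter and also gives \<delta>
    < \<alpha>0 / 3.\<close>
  define C3 where "C3 = CM + CE * CM + CE + 1"
  have c'0: "0 < c'" using c by (simp add: c'_def)
  have CJ0: "0 \<le> CJ" by (simp add: CJ_def)
  have CM1: "1 \<le> CM" using CJ0 c'0 by (simp add: CM_def)
  have CE0: "0 \<le> CE" by (simp add: CE_def)
  have CEM: "0 \<le> CE * CM" using CE0 CM1 by simp
  have C3: "0 < C3" "1 \<le> C3" "CM \<le> C3" "CE \<le> C3" "CE * CM + 1 \<le> C3" unfolding C3_def using CM1 CE0 CEM by linarith+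
  show ?thesis
  proof (rule exI[of _ C3], intro conjI allI impI)
    show "0 < C3" by (rule C3(1))
  next
    fix K :: "'n point \<times> real \<times> real \<Rightarrow> real" and m :: nat and \<delta> \<alpha>0 :: real
      and P Pstar S Sstar Wstar Wmin W0 :: "('n, 'N) sdfun"
    assume hK: "C2_on (K_domain A d a b) K \<and> (\<forall>z\<in>K_domain A d a b. 0 \<le> K z) \<and>
      C1_norm (K_domain A d a b) K = \<kappa> \<and>
      (\<forall>lam\<ge>lam2. \<forall>m>1. h0 \<le> step A m \<longrightarrow>
       (\<forall>P (W1 :: ('n, 'N) sdfun) W2.
          W1 \<in> B_closed A a b m (2 * R) P \<and> W2 \<in> B_closed A a b m (2 * R) P \<longrightarrow>
          J_fun A d a b m K \<mu> lam W2 - J_fun A d a b m K \<mu> lam W1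
            - H1_inner A a b m (J_grad A d a b m K \<mu> lam W1) (\<lambda>J y. W2 J y - W1 J y)
          \<ge> c * exp (2 * lam * a) * (H1_norm A a b m (\<lambda>J y. W2 J y - W1 J y))\<^sup>2))"
    assume h: "m > 1 \<and> h0 \<le> step A m \<and> \<delta> > 0 \<and>
      Wstar \<in> H1_space A a b m \<and>
      (\<forall>J\<in>inner_grid m. AE y in lebesgue_on {a..b}. residual A d m K \<mu> Wstar J y = 0) \<and>
      bdry_eq a b m Wstar Pstar \<and>
      S \<in> H1_space A a b m \<and> bdry_eq a b m S P \<and> H1_norm A a b m S < R \<and>
      Sstar \<in> H1_space A a b m \<and> bdry_eq a b m Sstar Pstar \<and> H1_norm A a b m Sstar < R \<and>
      H1_norm A a b m (\<lambda>J y. S J y - Sstar J y) < \<delta> \<and>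
      Wmin \<in> B_closed A a b m R P \<and>
      (\<forall>V\<in>B_closed A a b m R P. J_fun A d a b m K \<mu> lam2 Wmin \<le> J_fun A d a b m K \<mu> lam2 V) \<and>
      0 < \<alpha>0 \<and> \<alpha>0 < R \<and>
      Wstar \<in> B_set A a b m ((R - \<alpha>0) / 3) Pstar \<and>
      C3 * \<delta> < \<alpha>0 / 3 \<and>
      W0 \<in> B_set A a b m (R / 3) P"
    have m: "1 < m" and hm: "h0 \<le> step A m" and \<delta>: "0 < \<delta>" using h by auto
    have Ws: "Wstar \<in> H1_space A a b m" "bdry_eq a b m Wstar Pstar" "H1_norm A a b m Wstar < (R - \<alpha>0) / 3"
      using h by (auto simp: B_set_def)
    have Sd: "S \<in> H1_space A a b m" "bdry_eq a b m S P" "Sstar \<in> H1_space A a b m" "bdry_eq a b m Sstar Pstar"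
      "H1_norm A a b m (lin_comb 1 S (-1) Sstar) < \<delta>"
      using h by (auto simp: diff_lin_comb)
    have \<alpha>0: "0 < \<alpha>0" "\<alpha>0 < R" "C3 * \<delta> < \<alpha>0 / 3" using h by auto
    have CM\<delta>: "CM * \<delta> < \<alpha>0 / 3" using mult_right_mono[OF C3(3), of \<delta>] \<delta> \<alpha>0 by linarith
    have K2: "C2_on (K_domain A d a b) K" and K1: "C1_norm (K_domain A d a b) K = \<kappa>" using hK by simp_all
    obtain Ka where Kc: "continuous_on (K_domain A d a b) K" "continuous_on (K_domain A d a b) Ka"
      and Kb: "\<And>z. z \<in> K_domain A d a b \<Longrightarrow> \<bar>K z\<bar> \<le> \<kappa>" "\<And>z. z \<in> K_domain A d a b \<Longrightarrow> \<bar>Ka z\<bar> \<le> \<kappa>"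
      and Kd: "\<And>x \<alpha> \<beta>. x \<in> closure (Omega A a b) \<Longrightarrow> \<alpha> \<in> {-d..d} \<Longrightarrow> \<beta> \<in> {-d..d} \<Longrightarrow>
       ((\<lambda>t. K (x, t, \<beta>)) has_real_derivative Ka (x, \<alpha>, \<beta>)) (at \<alpha> within {-d..d})"
      by (rule C2_kernel_data[OF pos(1) ab(2) pos(2) K2 K1]) (rule that)
    interpret kd: kernel_data A d a b B \<mu> K Ka "TYPE('N)"
    proof
      show "0 < A" "0 < d" "0 < a" "a < b" "0 \<le> B" by (fact pos a_pos ab B0)+
      show "continuous_on UNIV \<mu>" by (rule C2_on_continuous[OF \<mu>(1)])
      show "continuous_on (K_domain A d a b) K" "continuous_on (K_domain A d a b) Ka" by (fact Kc)+
      show "\<bar>K z\<bar> \<le> B" "\<bar>Ka z\<bar> \<le> B" if "z \<in> K_domain A d a b" for z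
        using Kb[OF that] B'(1) unfolding B_def by linarith+
      show "((\<lambda>t. K (x, t, \<beta>)) has_real_derivative Ka (x, \<alpha>, \<beta>)) (at \<alpha> within {-d..d})"
        if "x \<in> closure (Omega A a b)" "\<alpha> \<in> {-d..d}" "\<beta> \<in> {-d..d}" for x \<alpha> \<beta>
        by (rule Kd[OF that])
      show "norm (psi d t :: 'N rvec) \<le> B" "norm (dpsi d t :: 'N rvec) \<le> B"
        if "t \<in> {-d..d}" for t
        by (rule order_trans[OF _ BB], rule B'(2)[OF that], rule order_trans[OF _ BB], rule B'(3)[OF that])
      show "norm (psi d t - psi d s :: 'N rvec) \<le> B" if "s \<in> {-d..d}" "t \<in> {-d..d}" for s t
        by (rule order_trans[OF B'(4)[OF that] BB])
      show "\<bar>\<mu> x\<bar> \<le> B" if "x \<in> closure (Omega A a b)" for x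
        by (rule order_trans[OF B'(5)[OF that] BB])
      show "norm ((\<mu> x / snd (nu x t)) *\<^sub>R (psi d t :: 'N rvec)) \<le> B"
        if "x \<in> closure (Omega A a b)" "t \<in> {-d..d}" for x t
        by (rule order_trans[OF B'(6)[OF that] BB])
    qed
    have CFe: "kd.CF \<rho> = CFc" by (simp add: kd.CF_def CFc_def)
    have CLe: "kd.CL \<rho> = CLc" by (simp add: kd.CL_def CLc_def)
    have mat: "norm ((D_mat d x :: 'N rmat) *v v) \<le> B * norm v"
      "norm ((Ax_mat d i x :: 'N rmat) *v v) \<le> B * norm v"
      if "x \<in> closure (Omega A a b)" for x :: "'n point" and i v
      using B'(7)[OF that, of v] B'(8)[OF that, of i v] mult_right_mono[OF BB, of "norm v"] by auto
    have lam0: "0 \<le> lam2" using lam2 by simp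
    interpret sd: sd_functional A a b lam2 "B + (2 * d)\<^sup>2 * (B * B)" \<rho> CFc m
      "\<lambda>J y. D_mat d (grid_pt A m J y) :: 'N rmat"
      "\<lambda>i J y. Ax_mat d i (grid_pt A m J y)" "\<lambda>J y w. F_fun d K \<mu> w (grid_pt A m J y)" "\<lambda>J y w. kd.DF_mat (grid_pt A m J y) w"
      by (rule kd.sd_functional_concrete[OF m lam0 \<rho>0 mat, unfolded CFe])
    have res: "sd.res = residual A d m K \<mu>"
      by (intro ext) (simp add: sd.res_def residual_def)
    have Jf: "sd.Jf = J_fun A d a b m K \<mu> lam2"
      by (intro ext) (simp add: sd.Jf_def J_fun_def res)
    have grad: "sd.grad = J_grad A d a b m K \<mu> lam2"
      by (intro ext) (simp add: sd.grad_def J_grad_def Jf)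
    have rad: "sd.rad = 2 * R" unfolding sd.rad_def using sobolev_const_pos[OF ab(2)] by (simp add: \<rho>_def)
    have convex: "c' * (H1_norm A a b m (lin_comb 1 W2 (-1) W1))\<^sup>2
       \<le> sd.Jf W2 - sd.Jf W1 - H1_inner A a b m (sd.grad W1) (lin_comb 1 W2 (-1) W1)"
      if "W1 \<in> B_closed A a b m (2 * R) P" "W2 \<in> B_closed A a b m (2 * R) P" for W1 W2
      using hK m hm that unfolding Jf grad c'_def diff_lin_comb by blast
    have Wmin: "Wmin \<in> B_closed A a b m R P" and minimal: "\<And>V. V \<in> B_closed A a b m R P \<Longrightarrow> sd.Jf Wmin \<le> sd.Jf V"
      using h by (auto simp: Jf)
    have WminH: "Wmin \<in> H1_space A a b m" using Wmin by (simp add: B_closed_def)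
    have R2: "2 * R \<le> sd.rad" by (simp add: rad)
    \<comment> \<open>The boundary values of \<open>?Wh\<close> are \<open>Pstar\<close> +
      \<open>P\<close> - \<open>Pstar\<close> = \<open>P\<close>, and its norm stays below (R -
      \<alpha>0) / 3 + \<alpha>0 / 3, so it competes with \<open>Wmin\<close> on the ball of radius
      R.\<close>
    let ?D = "lin_comb 1 S (-1) Sstar" and ?Wh = "lin_comb 1 Wstar 1 (lin_comb 1 S (-1) Sstar)"
    have D: "?D \<in> H1_space A a b m" by (rule H1_comb_closed[OF Sd(1,3)])
    have Wh: "?Wh \<in> H1_space A a b m" by (rule H1_comb_closed[OF Ws(1) D])
    have \<delta>\<alpha>: "\<delta> < \<alpha>0 / 3" using mult_right_mono[OF C3(2), of \<delta>] \<delta> \<alpha>0 by linarith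
    have Wh_norm: "H1_norm A a b m ?Wh \<le> R"
      using sd.H1_norm_comb_le[OF Ws(1) D, of 1 1] Ws(3) Sd(5) \<delta>\<alpha> pos \<alpha>0 by simp
    have Wh_bdry: "bdry_eq a b m ?Wh P"
      using Ws(2) Sd(2,4) by (auto simp: bdry_eq_def lin_comb_def)
    have WhB: "?Wh \<in> B_closed A a b m R P" using Wh Wh_norm Wh_bdry by (simp add: B_closed_def)
    have zero: "\<exists>N. negligible N \<and> (\<forall>y\<in>{a..b} - N. sd.res Wstar J y = 0)" if "J \<in> inner_grid m" for J
    proof -
      have "AE y in lebesgue_on {a..b}. residual A d m K \<mu> Wstar J y = 0" using h that by blast
      then show ?thesis unfolding res by (rule AE_lebesgue_on_negligible) blast
    qed
    have WsR: "H1_norm A a b m Wstar < R" using Ws(3) \<alpha>0 pos by simp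
    have "sd.Jf ?Wh \<le> CJ * (H1_norm A a b m ?D)\<^sup>2"
      unfolding CJ_def using WsR Sd(5) \<delta>\<alpha> \<alpha>0 pos
      by (intro sd.Jf_near_zero[OF Ws(1) _ D _ zero]) (auto simp: rad)
    then have "c' * (H1_norm A a b m (lin_comb 1 ?Wh (-1) Wmin))\<^sup>2 \<le> CJ * (H1_norm A a b m ?D)\<^sup>2"
      using sd.minimizer_near[OF pos(4) R2 c'0 convex Wmin minimal WhB] by linarith
    then have "(H1_norm A a b m (lin_comb 1 ?Wh (-1) Wmin))\<^sup>2 \<le> CJ / c' * (H1_norm A a b m ?D)\<^sup>2"
      using c'0 by (simp add: field_simps)
    then have "sqrt ((H1_norm A a b m (lin_comb 1 ?Wh (-1) Wmin))\<^sup>2) \<le> sqrt (CJ / c' * (H1_norm A a b m ?D)\<^sup>2)"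
      by (rule real_sqrt_le_mono)
    then have near: "H1_norm A a b m (lin_comb 1 ?Wh (-1) Wmin) \<le> sqrt (CJ / c') * H1_norm A a b m ?D"
      using sd.H1_norm_nonneg[OF D] sd.H1_norm_nonneg[OF H1_comb_closed[OF Wh WminH, of 1 "-1"]]
      by (simp add: real_sqrt_mult real_sqrt_divide)
    have min_star: "H1_norm A a b m (lin_comb 1 Wmin (-1) Wstar) \<le> CM * \<delta>"
    proof -
      have "lin_comb 1 Wmin (-1) Wstar = lin_comb (-1) (lin_comb 1 ?Wh (-1) Wmin) 1 ?D"
        by (simp add: lin_comb_def fun_eq_iff)
      then have "H1_norm A a b m (lin_comb 1 Wmin (-1) Wstar) \<le> H1_norm A a b m (lin_comb 1 ?Wh (-1) Wmin) + H1_norm A a b m ?D"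
        using sd.H1_norm_comb_le[OF H1_comb_closed[OF Wh WminH, of 1 "-1"] D, of "-1" 1] by simp
      also have "\<dots> \<le> CM * H1_norm A a b m ?D" using near by (simp add: CM_def algebra_simps)
      also have "\<dots> \<le> CM * \<delta>" using CM1 Sd(5) by (intro mult_left_mono) auto
      finally show ?thesis .
    qed
    \<comment> \<open>The choice \<open>CM \<le> C3\<close> transfers the smallness of the noise to
      the distance of \<open>Wmin\<close> from \<open>Wstar\<close>, so the radii add up to less
      than R / 3.\<close>
    have min_int: "H1_norm A a b m Wmin < R / 3"
    proof -
      have "Wmin = lin_comb 1 (lin_comb 1 Wmin (-1) Wstar) 1 Wstar" by (simp add: lin_comb_def)
      then have "H1_norm A a b m Wmin \<le> H1_norm A a b m (lin_comb 1 Wmin (-1) Wstar) + H1_norm A a b m Wstar"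
        using sd.H1_norm_comb_le[OF H1_comb_closed[OF WminH Ws(1), of 1 "-1"] Ws(1), of 1 1] by simp
      then show ?thesis using min_star Ws(3) CM\<delta> by (simp add: field_simps)
    qed
    have W0: "W0 \<in> B_set A a b m (R / 3) P" using h by blast
    define E0 where "E0 = H1_norm A a b m (lin_comb 1 W0 (-1) Wmin)"
    have E0: "0 \<le> E0" unfolding E0_def
      using W0 by (intro sd.H1_norm_nonneg H1_comb_closed WminH) (simp add: B_set_def)
    obtain \<gamma>0 where \<gamma>0: "0 < \<gamma>0" and conv: "\<And>\<gamma>. 0 < \<gamma> \<and> \<gamma> \<le> \<gamma>0 \<Longrightarrow> \<exists>\<theta>. 0 < \<theta> \<and> \<theta> < 1 \<and>
      (\<forall>k. descent sd.grad \<gamma> W0 k \<in> B_set A a b m R P \<and>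
        H1_norm A a b m (lin_comb 1 (descent sd.grad \<gamma> W0 k) (-1) Wmin) \<le> \<theta> ^ k * E0)"
      using sd.descent_convergence[OF pos(4) R2 c'0 convex Wmin minimal min_int W0] unfolding E0_def by blast
    show "\<exists>\<gamma>0>0. \<forall>\<gamma>. 0 < \<gamma> \<and> \<gamma> \<le> \<gamma>0 \<longrightarrow> (\<exists>\<theta>. 0 < \<theta> \<and> \<theta> < 1 \<and>
        (let W = descent (J_grad A d a b m K \<mu> lam2) \<gamma> W0;
             E0 = H1_norm A a b m (\<lambda>J y. W0 J y - Wmin J y);
             err = (\<lambda>k. L2_norm a b m (\<lambda>J y.
                      reconstruct A d m K \<mu> (W k) J y - reconstruct A d m K \<mu> Wstar J y))
         in
           (\<forall>k. W k \<in> B_set A a b m R P) \<and>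
           (\<forall>k. H1_norm A a b m (\<lambda>J y. W k J y - Wmin J y) \<le> \<theta> ^ k * E0) \<and>
           (\<forall>k. H1_norm A a b m (\<lambda>J y. W k J y - Wstar J y) \<le> C3 * \<delta> + \<theta> ^ k * E0) \<and>
           (\<forall>k. err k \<le> C3 * \<delta> + C3 * \<theta> ^ k * E0) \<and>
           (\<exists>k0. \<forall>k\<ge>k0. err k \<le> C3 * \<delta> + \<theta> ^ k * E0)))"
      unfolding Let_def diff_lin_comb[of W0 Wmin] E0_def[symmetric] grad[symmetric]
    proof (rule exI[of _ \<gamma>0], rule conjI[OF \<gamma>0], rule allI, rule impI)
      fix \<gamma> assume "0 < \<gamma> \<and> \<gamma> \<le> \<gamma>0"
      from conv[OF this] obtain \<theta> where \<theta>: "0 < \<theta>" "\<theta> < 1"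
        and inB: "\<And>k. descent sd.grad \<gamma> W0 k \<in> B_set A a b m R P"
        and rate: "\<And>k. H1_norm A a b m (lin_comb 1 (descent sd.grad \<gamma> W0 k) (-1) Wmin) \<le> \<theta> ^ k * E0" by blast
      let ?W = "descent sd.grad \<gamma> W0"
      have WH: "?W k \<in> H1_space A a b m" "H1_norm A a b m (?W k) < R" for k using inB[of k] by (auto simp: B_set_def)
      have star: "H1_norm A a b m (lin_comb 1 (?W k) (-1) Wstar) \<le> CM * \<delta> + \<theta> ^ k * E0" for k
      proof -
        have "lin_comb 1 (?W k) (-1) Wstar = lin_comb 1 (lin_comb 1 (?W k) (-1) Wmin) 1 (lin_comb 1 Wmin (-1) Wstar)"
          by (simp add: lin_comb_def)
        then show ?thesis
          using sd.H1_norm_comb_le[OF H1_comb_closed[OF WH(1)[of k] WminH, of 1 "-1"] H1_comb_closed[OF WminH Ws(1), of 1 "-1"], of 1 1]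
            rate[of k] min_star by simp
      qed
      have err: "L2_norm a b m (\<lambda>J y. reconstruct A d m K \<mu> (?W k) J y - reconstruct A d m K \<mu> Wstar J y)
          \<le> CE * CM * \<delta> + CE * (\<theta> ^ k * E0)" for k
      proof -
        have "H1_norm A a b m (lin_comb 1 (?W k) (-1) Wstar) \<le> 2 * R"
          using sd.H1_norm_comb_le[OF WH(1)[of k] Ws(1), of 1 "-1"] WH(2)[of k] WsR by simp
        then have "L2_norm a b m (\<lambda>J y. reconstruct A d m K \<mu> (?W k) J y - reconstruct A d m K \<mu> Wstar J y)
          \<le> CE * H1_norm A a b m (lin_comb 1 (?W k) (-1) Wstar)"
          using kd.reconstruct_error_bound[OF m \<rho>_def _ Ws(1) _ WH(1)] WsR pos unfolding CLe CE_def by simp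
        also have "\<dots> \<le> CE * (CM * \<delta> + \<theta> ^ k * E0)" by (intro mult_left_mono star CE0)
        finally show ?thesis by (simp add: algebra_simps)
      qed
      have \<theta>E: "0 \<le> \<theta> ^ k * E0" for k using \<theta> E0 by simp
      have CM3: "CM * \<delta> \<le> C3 * \<delta>" using C3(3) \<delta> by (intro mult_right_mono) auto
      have CEM3: "CE * CM * \<delta> + \<delta> \<le> C3 * \<delta>"
        using mult_right_mono[OF C3(5), of \<delta>] \<delta> by (simp add: algebra_simps)
      show "\<exists>\<theta>. 0 < \<theta> \<and> \<theta> < 1 \<and> (\<forall>k. ?W k \<in> B_set A a b m R P) \<and>
           (\<forall>k. H1_norm A a b m (\<lambda>J y. ?W k J y - Wmin J y) \<le> \<theta> ^ k * E0) \<and>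
           (\<forall>k. H1_norm A a b m (\<lambda>J y. ?W k J y - Wstar J y) \<le> C3 * \<delta> + \<theta> ^ k * E0) \<and>
           (\<forall>k. L2_norm a b m (\<lambda>J y. reconstruct A d m K \<mu> (?W k) J y - reconstruct A d m K \<mu> Wstar J y)
              \<le> C3 * \<delta> + C3 * \<theta> ^ k * E0) \<and>
           (\<exists>k0. \<forall>k\<ge>k0. L2_norm a b m (\<lambda>J y. reconstruct A d m K \<mu> (?W k) J y - reconstruct A d m K \<mu> Wstar J y)
              \<le> C3 * \<delta> + \<theta> ^ k * E0)"
      proof (rule exI[of _ \<theta>], intro conjI allI)
        fix k
        show "0 < \<theta>" "\<theta> < 1" "?W k \<in> B_set A a b m R P" by (fact \<theta> inB)+
        show "H1_norm A a b m (\<lambda>J y. ?W k J y - Wmin J y) \<le> \<theta> ^ k * E0"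
          unfolding diff_lin_comb by (rule rate)
        show "H1_norm A a b m (\<lambda>J y. ?W k J y - Wstar J y) \<le> C3 * \<delta> + \<theta> ^ k * E0"
          unfolding diff_lin_comb using star[of k] CM3 by linarith
        have "CE * (\<theta> ^ k * E0) \<le> C3 * (\<theta> ^ k * E0)" using C3(4) \<theta>E by (rule mult_right_mono)
        then show "L2_norm a b m (\<lambda>J y. reconstruct A d m K \<mu> (?W k) J y - reconstruct A d m K \<mu> Wstar J y)
            \<le> C3 * \<delta> + C3 * \<theta> ^ k * E0"
          using err[of k] CEM3 \<delta> by (simp add: mult.assoc)
      next
        \<comment> \<open>The geometric term, multiplied by \<open>CE\<close>, eventually drops
          below the \<delta> reserved in \<open>C3 * \<delta>\<close>.\<close>
        have "(\<lambda>k. CE * (\<theta> ^ k * E0)) \<longlonglongrightarrow> CE * (0 * E0)"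
          by (intro tendsto_intros LIMSEQ_power_zero) (use \<theta> in auto)
        then have "\<forall>\<^sub>F k in sequentially. CE * (\<theta> ^ k * E0) < \<delta>"
          using \<delta> by (intro order_tendstoD(2)) auto
        then obtain k0 where k0: "\<And>k. k0 \<le> k \<Longrightarrow> CE * (\<theta> ^ k * E0) < \<delta>"
          unfolding eventually_sequentially by blast
        show "\<exists>k0. \<forall>k\<ge>k0. L2_norm a b m (\<lambda>J y. reconstruct A d m K \<mu> (?W k) J y - reconstruct A d m K \<mu> Wstar J y)
            \<le> C3 * \<delta> + \<theta> ^ k * E0"
        proof (rule exI[of _ k0], intro allI impI)
          fix k assume "k0 \<le> k"
          from k0[OF this] show "L2_norm a b m (\<lambda>J y. reconstruct A d m K \<mu> (?W k) J y - reconstruct A d m K \<mu> Wstar J y)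
            \<le> C3 * \<delta> + \<theta> ^ k * E0"
            using err[of k] CEM3 \<theta>E[of k] by linarith
        qed
      qed
    qed
  qed
qed

end
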